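(* 1. The functor $\Pi_{0\geq}=Id/\mu_{0\geq}: Simp(Grp)\to Simp(Grp)$ is naturally isomorphic to the connected component functor $\pi_0: Simp(Grp)\to Grp$ followed by the discrete functor $Dis: Grp\to Simp(Grp)$. 2. For $n\ge 1$, the functor $\Pi^{\geq n}_{n\geq}=\mu_{\geq n}/\mu_{n\geq}: Simp(Grp)\to Simp(Grp)$ is naturally isomorphic to the homotopy group functor $\pi_n: Simp(Grp)\to Ab$ followed by the embedding $K(\_,n): Ab\to Simp(Grp)$.
   Context: $Simp(Grp)$ is the category of simplicial groups, with face maps $d_i$. The Moore complex $N(X)$ is $N(X)_0=X_0$, $N(X)_k=\bigcap_{i=0}^{k-1}\ker(d_i:X_k\to X_{k-1})$ for $k\ge1$, with differential $\delta_k$ the restriction of $d_k$; $\pi_i(X)=H_i(N(X))$, so $\pi_0(X)=X_0/\delta_1(N(X)_1)$. $Dis(G)$ is the constant simplicial group on $G$ (all faces and degeneracies identities). For $n\ge 0$, $\mathcal{M}_{n\geq}$ is the full subcategory of simplicial groups with $N(X)_i=0$ for $i>n$, and $Cot_n$ is the left adjoint of the inclusion $\mathcal{M}_{n\geq}\to Simp(Grp)$ (it exists, its unit is a regular epimorphism, and $N(Cot_n(X))$ is $N(X)$ with $N(X)_n$ replaced by $N(X)_n/\delta_{n+1}(N(X)_{n+1})$ and $N(X)_i$ by $0$ for $i>n$). Set $\mu_{n\geq}(X)=\ker(X\to Cot_n(X))$. For $n\ge 1$, set $\mu_{\geq n}(X)=\ker(X\to cosk_{n-1}tr_{n-1}(X))$,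 the kernel of the unit of the adjunction $tr_{n-1}\dashv cosk_{n-1}$ between simplicial groups and $(n-1)$-truncated simplicial groups. One has $\mu_{n\geq}(X)\le\mu_{\geq n}(X)$ as normal simplicial subgroups of $X$, and quotients of such functors are taken objectwise. For an abelian group $A$ and $n\ge1$, $K(A,n)=cosk_{n+1}(k(A,n))$, where $k(A,n)$ is the $(n+1)$-truncated simplicial group that is $0$ in degrees $<n$, $A$ in degree $n$, $A^{n+1}$ in degree $n+1$, with faces $A^{n+1}\to A$ given by $(d_0,\dots,d_{n+1})=(p_0,p_0+p_1,\dots,p_{n-1}+p_n,p_n)$ ($p_0,\dots,p_n$ the product projections) and degeneracies $s_i:A\to A^{n+1}$, $0\le i\le n$, the inclusion in the $i$-th place. Its Moore complex is $A$ in degree $n$ and $0$ elsewhere. *)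

theory Defs
  imports "HOL-Algebra.Product_Groups" "HOL-Library.Extended_Nat"
begin

section \<open>Categories and functors\<close>

text \<open>Arrows are not tagged with their domain and codomain, so composition and the arrow part of
  a functor take the objects as arguments: \<open>Cmp C X Y Z g f\<close> is \<open>g \<circ> f\<close> for
  \<open>f : X \<rightarrow> Y\<close>, \<open>g : Y \<rightarrow> Z\<close>, and \<open>Farr F X Y f\<close> is \<open>F f\<close> for \<open>f : X \<rightarrow> Y\<close>.\<close>

record ('o, 'm) cat =
  Obj :: "'o set"
  Hom :: "'o \<Rightarrow> 'o \<Rightarrow> 'm set"
  Idn :: "'o \<Rightarrow> 'm"
  Cmp :: "'o \<Rightarrow> 'o \<Rightarrow> 'o \<Rightarrow> 'm \<Rightarrow> 'm \<Rightarrow> 'm"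

record ('o, 'm, 'p, 'q) func =
  Fobj :: "'o \<Rightarrow> 'p"
  Farr :: "'o \<Rightarrow> 'o \<Rightarrow> 'm \<Rightarrow> 'q"

definition is_functor :: "('o, 'm) cat \<Rightarrow> ('p, 'q) cat \<Rightarrow> ('o, 'm, 'p, 'q) func \<Rightarrow> bool" where
  "is_functor C D F \<longleftrightarrow>
     (\<forall>X\<in>Obj C. Fobj F X \<in> Obj D) \<and>
     (\<forall>X\<in>Obj C. \<forall>Y\<in>Obj C. \<forall>f\<in>Hom C X Y. Farr F X Y f \<in> Hom D (Fobj F X) (Fobj F Y)) \<and>
     (\<forall>X\<in>Obj C. Farr F X X (Idn C X) = Idn D (Fobj F X)) \<and>
     (\<forall>X\<in>Obj C. \<forall>Y\<in>Obj C. \<forall>Z\<in>Obj C. \<forall>f\<in>Hom C X Y. \<forall>g\<in>Hom C Y Z.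
        Farr F X Z (Cmp C X Y Z g f) =
        Cmp D (Fobj F X) (Fobj F Y) (Fobj F Z) (Farr F Y Z g) (Farr F X Y f))"

definition comp_functor ::
  "('p, 'q, 'r, 's) func \<Rightarrow> ('o, 'm, 'p, 'q) func \<Rightarrow> ('o, 'm, 'r, 's) func" (infixl \<open>\<circ>\<^sub>F\<close> 55) where
  "G \<circ>\<^sub>F F = \<lparr>Fobj = (\<lambda>X. Fobj G (Fobj F X)),
              Farr = (\<lambda>X Y f. Farr G (Fobj F X) (Fobj F Y) (Farr F X Y f))\<rparr>"

definition full_subcat :: "('o, 'm) cat \<Rightarrow> ('o \<Rightarrow> bool) \<Rightarrow> ('o, 'm) cat" where
  "full_subcat C P = C\<lparr>Obj := {X \<in> Obj C. P X}\<rparr>"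

text \<open>\<open>u : X \<rightarrow> R\<close> is a universal arrow from \<open>X\<close> to the inclusion of the full subcategory \<open>S\<close>
  into \<open>C\<close>; that is, \<open>R\<close> is the value at \<open>X\<close> of the left adjoint of the inclusion and \<open>u\<close> is the
  component at \<open>X\<close> of the unit.\<close>

definition is_reflection :: "('o, 'm) cat \<Rightarrow> ('o, 'm) cat \<Rightarrow> 'o \<Rightarrow> 'o \<Rightarrow> 'm \<Rightarrow> bool" where
  "is_reflection C S X R u \<longleftrightarrow>
     R \<in> Obj S \<and> u \<in> Hom C X R \<and>
     (\<forall>Y\<in>Obj S. \<forall>f\<in>Hom C X Y. \<exists>!g. g \<in> Hom S R Y \<and> Cmp C X R Y g u = f)"


section \<open>The categories of groups, abelian groups and simplicial groups\<close>

text \<open>All categories consist of objects with elements in a fixed type, which plays the role of the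
  universe. Maps are extensional, so that equality of arrows is equality in HOL.\<close>

definition Grp :: "('a monoid, 'a \<Rightarrow> 'a) cat" where
  "Grp = \<lparr>Obj = {G. group G},
          Hom = (\<lambda>G H. hom G H \<inter> extensional (carrier G)),
          Idn = (\<lambda>G. \<lambda>x\<in>carrier G. x),
          Cmp = (\<lambda>G _ _ g f. compose (carrier G) g f)\<rparr>"

definition Ab :: "('a monoid, 'a \<Rightarrow> 'a) cat" where
  "Ab = full_subcat Grp comm_group"

text \<open>\<open>fc X k i : X\<^sub>k \<rightarrow> X\<^sub>k\<^sub>-\<^sub>1\<close> and \<open>dg X k i : X\<^sub>k \<rightarrow> X\<^sub>k\<^sub>+\<^sub>1\<close> are the face \<open>d\<^sub>i\<close> and the degeneracy \<open>s\<^sub>i\<close>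
  defined on degree \<open>k\<close>, where \<open>i \<le> k\<close>. The same record is used for truncated simplicial groups.\<close>

record 'a sgrp =
  lev :: "nat \<Rightarrow> 'a monoid"
  fc :: "nat \<Rightarrow> nat \<Rightarrow> 'a \<Rightarrow> 'a"
  dg :: "nat \<Rightarrow> nat \<Rightarrow> 'a \<Rightarrow> 'a"

abbreviation elts :: "'a sgrp \<Rightarrow> nat \<Rightarrow> 'a set" where
  "elts X k \<equiv> carrier (lev X k)"

definition simplicial_group :: "'a sgrp \<Rightarrow> bool" where
  "simplicial_group X \<longleftrightarrow>
     (\<forall>k. group (lev X k)) \<and>
     (\<forall>k i. i \<le> Suc k \<longrightarrow> fc X (Suc k) i \<in> hom (lev X (Suc k)) (lev X k)) \<and>
     (\<forall>k i. i \<le> k \<longrightarrow> dg X k i \<in> hom (lev X k) (lev X (Suc k))) \<and>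
     (\<forall>k i j. \<forall>x\<in>elts X (k + 2). i < j \<and> j \<le> k + 2 \<longrightarrow>
        fc X (k + 1) i (fc X (k + 2) j x) = fc X (k + 1) (j - 1) (fc X (k + 2) i x)) \<and>
     (\<forall>k i j. \<forall>x\<in>elts X (k + 1). i < j \<and> j \<le> k + 1 \<longrightarrow>
        fc X (k + 2) i (dg X (k + 1) j x) = dg X k (j - 1) (fc X (k + 1) i x)) \<and>
     (\<forall>k j. \<forall>x\<in>elts X k. j \<le> k \<longrightarrow>
        fc X (k + 1) j (dg X k j x) = x \<and> fc X (k + 1) (j + 1) (dg X k j x) = x) \<and>
     (\<forall>k i j. \<forall>x\<in>elts X (k + 1). j + 1 < i \<and> i \<le> k + 2 \<longrightarrow>
        fc X (k + 2) i (dg X (k + 1) j x) = dg X k j (fc X (k + 1) (i - 1) x)) \<and>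
     (\<forall>k i j. \<forall>x\<in>elts X k. i \<le> j \<and> j \<le> k \<longrightarrow>
        dg X (k + 1) i (dg X k j x) = dg X (k + 1) (j + 1) (dg X k i x))"

definition simplicial_hom :: "'a sgrp \<Rightarrow> 'b sgrp \<Rightarrow> (nat \<Rightarrow> 'a \<Rightarrow> 'b) set" where
  "simplicial_hom X Y = {f.
     (\<forall>k. f k \<in> hom (lev X k) (lev Y k) \<inter> extensional (elts X k)) \<and>
     (\<forall>k i. \<forall>x\<in>elts X (Suc k). i \<le> Suc k \<longrightarrow> f k (fc X (Suc k) i x) = fc Y (Suc k) i (f (Suc k) x)) \<and>
     (\<forall>k i. \<forall>x\<in>elts X k. i \<le> k \<longrightarrow> f (Suc k) (dg X k i x) = dg Y k i (f k x))}"

definition simplicial_id :: "'a sgrp \<Rightarrow> nat \<Rightarrow> 'a \<Rightarrow> 'a" where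
  "simplicial_id X k = (\<lambda>x\<in>elts X k. x)"

definition simplicial_comp ::
  "'a sgrp \<Rightarrow> (nat \<Rightarrow> 'b \<Rightarrow> 'c) \<Rightarrow> (nat \<Rightarrow> 'a \<Rightarrow> 'b) \<Rightarrow> nat \<Rightarrow> 'a \<Rightarrow> 'c" where
  "simplicial_comp X g f k = compose (elts X k) (g k) (f k)"

definition SimpGrp :: "('a sgrp, nat \<Rightarrow> 'a \<Rightarrow> 'a) cat" where
  "SimpGrp = \<lparr>Obj = {X. simplicial_group X},
              Hom = simplicial_hom,
              Idn = simplicial_id,
              Cmp = (\<lambda>X _ _ g f. simplicial_comp X g f)\<rparr>"

definition simplicial_iso :: "'a sgrp \<Rightarrow> 'b sgrp \<Rightarrow> (nat \<Rightarrow> 'a \<Rightarrow> 'b) \<Rightarrow> bool" where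
  "simplicial_iso X Y f \<longleftrightarrow>
     f \<in> simplicial_hom X Y \<and>
     (\<exists>g\<in>simplicial_hom Y X.
        simplicial_comp X g f = simplicial_id X \<and> simplicial_comp Y f g = simplicial_id Y)"

text \<open>Natural isomorphism of two functors with values in simplicial groups. The two constructions to
  be compared produce simplicial groups with different element types, so the values of \<open>F\<close> and \<open>G\<close>
  lie in instances of \<open>SimpGrp\<close> at two types, and the components are simplicial homomorphisms
  between these.\<close>

definition naturally_isomorphic ::
  "('o, 'm) cat \<Rightarrow> ('o, 'm, 'p sgrp, nat \<Rightarrow> 'p \<Rightarrow> 'p) func \<Rightarrow>
   ('o, 'm, 'q sgrp, nat \<Rightarrow> 'q \<Rightarrow> 'q) func \<Rightarrow> bool" where
  "naturally_isomorphic C F G \<longleftrightarrow>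
     is_functor C SimpGrp F \<and> is_functor C SimpGrp G \<and>
     (\<exists>\<eta>. (\<forall>X\<in>Obj C. simplicial_iso (Fobj F X) (Fobj G X) (\<eta> X)) \<and>
          (\<forall>X\<in>Obj C. \<forall>Y\<in>Obj C. \<forall>f\<in>Hom C X Y.
             simplicial_comp (Fobj F X) (\<eta> Y) (Farr F X Y f) =
             simplicial_comp (Fobj F X) (Farr G X Y f) (\<eta> X)))"

definition Dis :: "('a monoid, 'a \<Rightarrow> 'a, 'a sgrp, nat \<Rightarrow> 'a \<Rightarrow> 'a) func" where
  "Dis = \<lparr>Fobj = (\<lambda>G. \<lparr>lev = (\<lambda>_. G), fc = (\<lambda>_ _ x. x), dg = (\<lambda>_ _ x. x)\<rparr>),
          Farr = (\<lambda>_ _ f _. f)\<rparr>"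


section \<open>Induced maps on quotients\<close>

text \<open>For normal subgroups \<open>M \<lhd> G\<close>, \<open>N \<lhd> H\<close> and a homomorphism \<open>f : G \<rightarrow> H\<close> with \<open>f(M) \<subseteq> N\<close>, this
  sends the coset \<open>M x\<close> to \<open>N f(x)\<close>.\<close>

definition coset_map :: "('b, 'c) monoid_scheme \<Rightarrow> 'b set \<Rightarrow> ('a \<Rightarrow> 'b) \<Rightarrow> 'a set \<Rightarrow> 'b set" where
  "coset_map H N f C = (\<Union>x\<in>C. N #>\<^bsub>H\<^esub> f x)"

definition quot_sgrp :: "'a sgrp \<Rightarrow> (nat \<Rightarrow> 'a set) \<Rightarrow> (nat \<Rightarrow> 'a set) \<Rightarrow> 'a set sgrp" where
  "quot_sgrp X P Q =
     \<lparr>lev = (\<lambda>k. ((lev X k)\<lparr>carrier := P k\<rparr>) Mod Q k),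
      fc = (\<lambda>k i. coset_map (lev X (k - 1)) (Q (k - 1)) (fc X k i)),
      dg = (\<lambda>k i. coset_map (lev X (Suc k)) (Q (Suc k)) (dg X k i))\<rparr>"

text \<open>The objectwise quotient \<open>P/Q\<close> of subfunctors \<open>Q \<le> P\<close> of the identity functor.\<close>

definition quot_functor ::
  "('a sgrp \<Rightarrow> nat \<Rightarrow> 'a set) \<Rightarrow> ('a sgrp \<Rightarrow> nat \<Rightarrow> 'a set) \<Rightarrow>
   ('a sgrp, nat \<Rightarrow> 'a \<Rightarrow> 'a, 'a set sgrp, nat \<Rightarrow> 'a set \<Rightarrow> 'a set) func" where
  "quot_functor P Q =
     \<lparr>Fobj = (\<lambda>X. quot_sgrp X (P X) (Q X)),
      Farr = (\<lambda>X Y f k. \<lambda>C\<in>elts (quot_sgrp X (P X) (Q X)) k. coset_map (lev Y k) (Q Y k) (f k) C)\<rparr>"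


section \<open>Moore complex and homotopy groups\<close>

definition moore :: "'a sgrp \<Rightarrow> nat \<Rightarrow> 'a set" where
  "moore X k = {x \<in> elts X k. \<forall>i<k. fc X k i x = \<one>\<^bsub>lev X (k - 1)\<^esub>}"

definition cycles :: "'a sgrp \<Rightarrow> nat \<Rightarrow> 'a set" where
  "cycles X n = {x \<in> moore X n. n \<ge> 1 \<longrightarrow> fc X n n x = \<one>\<^bsub>lev X (n - 1)\<^esub>}"

definition boundaries :: "'a sgrp \<Rightarrow> nat \<Rightarrow> 'a set" where
  "boundaries X n = fc X (Suc n) (Suc n) ` moore X (Suc n)"

definition homotopy_group :: "nat \<Rightarrow> 'a sgrp \<Rightarrow> 'a set monoid" where
  "homotopy_group n X = ((lev X n)\<lparr>carrier := cycles X n\<rparr>) Mod boundaries X n"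

definition pi_functor ::
  "nat \<Rightarrow> ('a sgrp, nat \<Rightarrow> 'a \<Rightarrow> 'a, 'a set monoid, 'a set \<Rightarrow> 'a set) func" where
  "pi_functor n =
     \<lparr>Fobj = homotopy_group n,
      Farr = (\<lambda>X Y f. \<lambda>C\<in>carrier (homotopy_group n X). coset_map (lev Y n) (boundaries Y n) (f n) C)\<rparr>"


section \<open>The reflection \<open>Cot\<^sub>n\<close>\<close>

definition M_le :: "nat \<Rightarrow> ('a sgrp, nat \<Rightarrow> 'a \<Rightarrow> 'a) cat" where
  "M_le n = full_subcat SimpGrp (\<lambda>X. \<forall>i>n. moore X i = {\<one>\<^bsub>lev X i\<^esub>})"

text \<open>A choice of the value of the left adjoint together with the unit component; it is unique up to
  isomorphism, so the kernel \<open>mu_le\<close> of the unit does not depend on the choice. No larger type is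
  needed for it: the reflection is a quotient of \<open>X\<close>, whose elements can be represented in \<open>'a\<close>.\<close>

definition Cot_with_unit :: "nat \<Rightarrow> 'a sgrp \<Rightarrow> 'a sgrp \<times> (nat \<Rightarrow> 'a \<Rightarrow> 'a)" where
  "Cot_with_unit n X = (SOME (R, u). is_reflection SimpGrp (M_le n) X R u)"

definition Cot :: "nat \<Rightarrow> 'a sgrp \<Rightarrow> 'a sgrp" where
  "Cot n X = fst (Cot_with_unit n X)"

definition Cot_unit :: "nat \<Rightarrow> 'a sgrp \<Rightarrow> nat \<Rightarrow> 'a \<Rightarrow> 'a" where
  "Cot_unit n X = snd (Cot_with_unit n X)"

definition mu_le :: "nat \<Rightarrow> 'a sgrp \<Rightarrow> nat \<Rightarrow> 'a set" where
  "mu_le n X k = kernel (lev X k) (lev (Cot n X) k) (Cot_unit n X k)"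


section \<open>Truncation and coskeleton\<close>

definition trunc :: "nat \<Rightarrow> 'a sgrp \<Rightarrow> 'a sgrp" where
  "trunc m X =
     \<lparr>lev = (\<lambda>k. if k \<le> m then lev X k else undefined),
      fc = (\<lambda>k. if k \<le> m then fc X k else undefined),
      dg = (\<lambda>k. if Suc k \<le> m then dg X k else undefined)\<rparr>"

text \<open>The \<open>j\<close>-simplices of the standard simplex \<open>\<Delta>[k]\<close> are the monotone maps
  \<open>{0..j} \<rightarrow> {0..k}\<close>, written as the list of their \<open>j + 1\<close> values. \<open>simplices m k\<close> consists of
  those with \<open>j \<le> m\<close>.\<close>

definition sdim :: "nat list \<Rightarrow> nat" where
  "sdim \<sigma> = length \<sigma> - 1"

definition simplices :: "enat \<Rightarrow> nat \<Rightarrow> nat list set" where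
  "simplices m k = {\<sigma>. \<sigma> \<noteq> [] \<and> sorted \<sigma> \<and> set \<sigma> \<subseteq> {..k} \<and> enat (sdim \<sigma>) \<le> m}"

definition sface :: "nat \<Rightarrow> nat list \<Rightarrow> nat list" where
  "sface i \<sigma> = take i \<sigma> @ drop (Suc i) \<sigma>"

definition sdegen :: "nat \<Rightarrow> nat list \<Rightarrow> nat list" where
  "sdegen i \<sigma> = take (Suc i) \<sigma> @ drop i \<sigma>"

text \<open>Maps of \<open>m\<close>-truncated simplicial sets from \<open>tr\<^sub>m \<Delta>[k]\<close> to \<open>T\<close>; for \<open>m = \<infinity>\<close>,
  maps of simplicial sets from \<open>\<Delta>[k]\<close> to \<open>T\<close>.\<close>

definition simplex_maps :: "enat \<Rightarrow> 'a sgrp \<Rightarrow> nat \<Rightarrow> (nat list \<Rightarrow> 'a) set" where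
  "simplex_maps m T k = {f \<in> (\<Pi>\<^sub>E \<sigma>\<in>simplices m k. elts T (sdim \<sigma>)).
     (\<forall>\<sigma>\<in>simplices m k. \<forall>i\<le>sdim \<sigma>.
        (sdim \<sigma> \<ge> 1 \<longrightarrow> f (sface i \<sigma>) = fc T (sdim \<sigma>) i (f \<sigma>)) \<and>
        (enat (Suc (sdim \<sigma>)) \<le> m \<longrightarrow> f (sdegen i \<sigma>) = dg T (sdim \<sigma>) i (f \<sigma>)))}"

definition coface :: "nat \<Rightarrow> nat \<Rightarrow> nat" where
  "coface i v = (if v < i then v else v + 1)"

definition codegen :: "nat \<Rightarrow> nat \<Rightarrow> nat" where
  "codegen i v = (if v \<le> i then v else v - 1)"

text \<open>The right adjoint of truncation, \<open>cosk\<^sub>m(T)\<^sub>k = Hom(tr\<^sub>m \<Delta>[k], T)\<close> with the pointwise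
  group structure and the faces and degeneracies given by precomposition.\<close>

definition cosk :: "nat \<Rightarrow> 'a sgrp \<Rightarrow> (nat list \<Rightarrow> 'a) sgrp" where
  "cosk m T =
     \<lparr>lev = (\<lambda>k. (product_group (simplices m k) (\<lambda>\<sigma>. lev T (sdim \<sigma>)))\<lparr>carrier := simplex_maps m T k\<rparr>),
      fc = (\<lambda>k i f. \<lambda>\<tau>\<in>simplices m (k - 1). f (map (coface i) \<tau>)),
      dg = (\<lambda>k i f. \<lambda>\<tau>\<in>simplices m (Suc k). f (map (codegen i) \<tau>))\<rparr>"

definition cosk_arr ::
  "nat \<Rightarrow> 'a sgrp \<Rightarrow> (nat \<Rightarrow> 'a \<Rightarrow> 'b) \<Rightarrow> nat \<Rightarrow> (nat list \<Rightarrow> 'a) \<Rightarrow> nat list \<Rightarrow> 'b" where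
  "cosk_arr m T t k = (\<lambda>f\<in>elts (cosk m T) k. \<lambda>\<sigma>\<in>simplices m k. t (sdim \<sigma>) (f \<sigma>))"

text \<open>The map \<open>\<Delta>[k] \<rightarrow> X\<close> corresponding to \<open>x \<in> X\<^sub>k\<close> under the Yoneda lemma; \<open>[0..<Suc k]\<close> is the
  identity \<open>k\<close>-simplex.\<close>

definition classifying_map :: "'a sgrp \<Rightarrow> nat \<Rightarrow> 'a \<Rightarrow> nat list \<Rightarrow> 'a" where
  "classifying_map X k x = (THE f. f \<in> simplex_maps \<infinity> X k \<and> f [0..<Suc k] = x)"

text \<open>The unit \<open>X \<rightarrow> cosk\<^sub>m(tr\<^sub>m(X))\<close>, which restricts the classifying map of \<open>x\<close> to \<open>tr\<^sub>m \<Delta>[k]\<close>.\<close>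

definition cosk_unit :: "nat \<Rightarrow> 'a sgrp \<Rightarrow> nat \<Rightarrow> 'a \<Rightarrow> nat list \<Rightarrow> 'a" where
  "cosk_unit m X k = (\<lambda>x\<in>elts X k. restrict (classifying_map X k x) (simplices m k))"

text \<open>Intended for \<open>n \<ge> 1\<close>.\<close>

definition mu_ge :: "nat \<Rightarrow> 'a sgrp \<Rightarrow> nat \<Rightarrow> 'a set" where
  "mu_ge n X k = kernel (lev X k) (lev (cosk (n - 1) (trunc (n - 1) X)) k) (cosk_unit (n - 1) X k)"

definition Pi_zero :: "('a sgrp, nat \<Rightarrow> 'a \<Rightarrow> 'a, 'a set sgrp, nat \<Rightarrow> 'a set \<Rightarrow> 'a set) func" where
  "Pi_zero = quot_functor elts (mu_le 0)"

definition Pi_layer ::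
  "nat \<Rightarrow> ('a sgrp, nat \<Rightarrow> 'a \<Rightarrow> 'a, 'a set sgrp, nat \<Rightarrow> 'a set \<Rightarrow> 'a set) func" where
  "Pi_layer n = quot_functor (mu_ge n) (mu_le n)"


section \<open>Eilenberg--MacLane simplicial groups\<close>

text \<open>The truncated simplicial group \<open>k(A,n)\<close>, for \<open>n \<ge> 1\<close>. In order to have a common element type, the
  groups \<open>0\<close>, \<open>A\<close>, \<open>A\<^sup>n\<^sup>+\<^sup>1\<close> in degrees \<open>< n\<close>, \<open>n\<close>, \<open>n + 1\<close> are all represented as powers
  \<open>A\<^sup>r\<close>, with elements the functions on \<open>{..<r}\<close>; thus \<open>a \<in> A\<close> is \<open>\<lambda>j\<in>{..<1}. a\<close>. What is written in
  degrees \<open>> n + 1\<close> is cut off by \<open>trunc\<close>.\<close>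

definition em_rank :: "nat \<Rightarrow> nat \<Rightarrow> nat" where
  "em_rank n k = (if k < n then 0 else if k = n then 1 else n + 1)"

definition em_lev :: "'a monoid \<Rightarrow> nat \<Rightarrow> nat \<Rightarrow> (nat \<Rightarrow> 'a) monoid" where
  "em_lev A n k = product_group {..<em_rank n k} (\<lambda>_. A)"

definition em_trunc :: "'a monoid \<Rightarrow> nat \<Rightarrow> (nat \<Rightarrow> 'a) sgrp" where
  "em_trunc A n = trunc (n + 1)
     \<lparr>lev = em_lev A n,
      fc = (\<lambda>k i v.
        if k = n + 1
        then (\<lambda>j\<in>{..<1}. if i = 0 then v 0 else if i = n + 1 then v n else v (i - 1) \<otimes>\<^bsub>A\<^esub> v i)
        else \<one>\<^bsub>em_lev A n (k - 1)\<^esub>),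
      dg = (\<lambda>k i v.
        if k = n
        then (\<lambda>j\<in>{..<n + 1}. if j = i then v 0 else \<one>\<^bsub>A\<^esub>)
        else \<one>\<^bsub>em_lev A n (k + 1)\<^esub>)\<rparr>"

definition em_trunc_arr :: "nat \<Rightarrow> ('a \<Rightarrow> 'b) \<Rightarrow> nat \<Rightarrow> (nat \<Rightarrow> 'a) \<Rightarrow> nat \<Rightarrow> 'b" where
  "em_trunc_arr n h k v = (\<lambda>j\<in>{..<em_rank n k}. h (v j))"

definition K_functor ::
  "nat \<Rightarrow> ('a monoid, 'a \<Rightarrow> 'a, (nat list \<Rightarrow> nat \<Rightarrow> 'a) sgrp,
     nat \<Rightarrow> (nat list \<Rightarrow> nat \<Rightarrow> 'a) \<Rightarrow> (nat list \<Rightarrow> nat \<Rightarrow> 'a)) func" where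
  "K_functor n =
     \<lparr>Fobj = (\<lambda>A. cosk (n + 1) (em_trunc A n)),
      Farr = (\<lambda>A B h. cosk_arr (n + 1) (em_trunc A n) (em_trunc_arr n h))\<rparr>"

end

theory Submission
  imports Defs
begin

text \<open>By the Yoneda lemma a simplex \<open>x \<in> X\<^sub>k\<close> is a map \<open>\<Delta>[k] \<rightarrow> X\<close>, and both subgroups are described by
  the values of that map: \<open>x\<close> lies in \<open>\<mu>\<^bsub>\<ge>n\<^esub>\<close> iff all its faces of dimension \<open>< n\<close> are trivial, and in
  \<open>\<mu>\<^bsub>n\<ge>\<^esub>\<close> iff moreover its \<open>n\<close>-dimensional faces are boundaries. The second description holds because
  an \<open>(n+1)\<close>-simplex whose faces are cycles can be multiplied by degenerate simplices until only its
  last face is nontrivial, so the alternating product of its faces is a boundary.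

  For \<open>x \<in> \<mu>\<^bsub>\<ge>n\<^esub>\<close> the \<open>n\<close>-dimensional faces are cycles, and their classes in \<open>\<pi>\<^sub>n\<close> form a map
  \<open>tr\<^sub>n\<^sub>+\<^sub>1 \<Delta>[k] \<rightarrow> k(\<pi>\<^sub>n, n)\<close> by the same alternating product relation. This gives a homomorphism
  \<open>\<mu>\<^bsub>\<ge>n\<^esub> \<rightarrow> K(\<pi>\<^sub>n, n)\<close> with kernel \<open>\<mu>\<^bsub>n\<ge>\<^esub>\<close>. It is surjective because a simplicial group is generated under
  degeneracies by its Moore complex, which for \<open>K(\<pi>\<^sub>n, n)\<close> is concentrated in degree \<open>n\<close>. For \<open>n = 0\<close>
  one takes instead the component of any vertex of \<open>x\<close>.\<close>

section \<open>Simplices of the standard simplex\<close>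

text \<open>\<open>Cot\<close> and \<open>classifying_map\<close> are defined by choice or
  description, so nothing can be computed from their definitions: a reflection and a Yoneda map have
  to be constructed, and the chosen ones are compared with them by uniqueness. The Yoneda map needs
  one formula covering all iterated faces and degeneracies; the number of occurrences of each vertex
  provides it, and its verification is where all simplicial identities of X are spent. Afterwards
  one case split recurs: a low-dimensional simplex of \<Delta>[k+1] either misses one of the
  vertices 0,...,k and lies in a facet already understood, or for reasons of dimension is the last
  facet, where the alternating product relation decides. The obstacle is that the levels of X are
  not abelian, so alternating products depend on the order of their factors until they are read in
  \<pi>_n, which is abelian for n at least 1. Commutativity is also what makes the faces of
  k(\<pi>_n,n) homomorphisms, which is why n = 0 gets a different target.\<close>

lemma simplices_iff:
  "\<sigma> \<in> simplices m k \<longleftrightarrow> \<sigma> \<noteq> [] \<and> sorted \<sigma> \<and> set \<sigma> \<subseteq> {..k} \<and> enat (sdim \<sigma>) \<le> m"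
  by (simp add: simplices_def)

lemma simplices_mono: "\<sigma> \<in> simplices m k \<Longrightarrow> m \<le> m' \<Longrightarrow> \<sigma> \<in> simplices m' k"
  by (auto simp: simplices_iff intro: order_trans)

lemma simplices_infinity: "\<sigma> \<in> simplices m k \<Longrightarrow> \<sigma> \<in> simplices \<infinity> k"
  by (auto simp: simplices_iff)

lemma simplices_sdim: "\<sigma> \<in> simplices (enat m) k \<Longrightarrow> sdim \<sigma> \<le> m"
  by (simp add: simplices_iff)

lemma length_simplex: "\<sigma> \<in> simplices m k \<Longrightarrow> length \<sigma> = Suc (sdim \<sigma>)"
  by (cases \<sigma>) (auto simp: simplices_iff sdim_def)

lemma upt_simplex: "enat k \<le> m \<Longrightarrow> [0..<Suc k] \<in> simplices m k"
  by (auto simp: simplices_iff sdim_def simp del: upt_Suc)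

lemma sdim_upt [simp]: "sdim [0..<Suc k] = k"
  by (simp add: sdim_def)

lemma sface_simplex:
  assumes "\<sigma> \<in> simplices m k" "i \<le> sdim \<sigma>" "sdim \<sigma> \<ge> 1"
  shows "sface i \<sigma> \<in> simplices m k" "sdim (sface i \<sigma>) = sdim \<sigma> - 1"
proof -
  have len: "length (sface i \<sigma>) = length \<sigma> - 1"
    using assms by (auto simp: sface_def sdim_def)
  then show dim: "sdim (sface i \<sigma>) = sdim \<sigma> - 1"
    by (simp add: sdim_def)
  have "sorted \<sigma>"
    using assms by (simp add: simplices_iff)
  then have "sorted (take i \<sigma> @ drop i \<sigma>)"
    by simp
  then have "\<forall>x\<in>set (take i \<sigma>). \<forall>y\<in>set (drop (Suc i) \<sigma>). x \<le> y"
    unfolding sorted_append using set_drop_subset_set_drop[of i "Suc i" \<sigma>] by auto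
  then have "sorted (sface i \<sigma>)"
    using \<open>sorted \<sigma>\<close> by (auto simp: sface_def sorted_append sorted_wrt_take sorted_wrt_drop)
  moreover have "set (sface i \<sigma>) \<subseteq> set \<sigma>"
    by (auto simp: sface_def dest: in_set_takeD in_set_dropD)
  moreover have "sface i \<sigma> \<noteq> []"
    using len assms by (auto simp: sdim_def)
  moreover have "enat (sdim (sface i \<sigma>)) \<le> m"
    using dim assms by (auto simp: simplices_iff intro: order_trans[rotated])
  ultimately show "sface i \<sigma> \<in> simplices m k"
    using assms by (auto simp: simplices_iff)
qed

lemma sdegen_simplex:
  assumes "\<sigma> \<in> simplices m k" "i \<le> sdim \<sigma>" "enat (Suc (sdim \<sigma>)) \<le> m"
  shows "sdegen i \<sigma> \<in> simplices m k" "sdim (sdegen i \<sigma>) = Suc (sdim \<sigma>)"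
proof -
  have i: "i < length \<sigma>"
    using assms length_simplex[OF assms(1)] by simp
  have len: "length (sdegen i \<sigma>) = Suc (length \<sigma>)"
    using i by (auto simp: sdegen_def)
  then show dim: "sdim (sdegen i \<sigma>) = Suc (sdim \<sigma>)"
    using i by (simp add: sdim_def)
  have sorted: "sorted \<sigma>"
    using assms by (simp add: simplices_iff)
  have "x \<le> y" if "x \<in> set (take (Suc i) \<sigma>)" "y \<in> set (drop i \<sigma>)" for x y
  proof -
    obtain a where a: "a < Suc i" "a < length \<sigma>" "x = \<sigma> ! a"
      using \<open>x \<in> set (take (Suc i) \<sigma>)\<close> by (auto simp: in_set_conv_nth)
    obtain b where b: "i + b < length \<sigma>" "y = \<sigma> ! (i + b)"
      using \<open>y \<in> set (drop i \<sigma>)\<close> i unfolding in_set_conv_nth by (force simp: less_diff_conv add.commute)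
    show "x \<le> y"
      using a b sorted by (auto intro: sorted_nth_mono)
  qed
  then have "sorted (sdegen i \<sigma>)"
    using sorted by (auto simp: sdegen_def sorted_append sorted_wrt_take sorted_wrt_drop)
  moreover have "set (sdegen i \<sigma>) \<subseteq> set \<sigma>"
    by (auto simp: sdegen_def dest: in_set_takeD in_set_dropD)
  moreover have "sdegen i \<sigma> \<noteq> []"
    using len by auto
  ultimately show "sdegen i \<sigma> \<in> simplices m k"
    using assms dim by (auto simp: simplices_iff)
qed

lemma coface_mono: "u \<le> v \<Longrightarrow> coface i u \<le> coface i v"
  by (auto simp: coface_def)

lemma codegen_mono: "u \<le> v \<Longrightarrow> codegen i u \<le> codegen i v"
  by (auto simp: codegen_def)

lemma sorted_map_mono: "sorted (\<sigma> :: nat list) \<Longrightarrow> (\<And>u v. u \<le> v \<Longrightarrow> f u \<le> f v) \<Longrightarrow> sorted (map f \<sigma> :: nat list)"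
  by (induction \<sigma>) auto

lemma sdim_map [simp]: "sdim (map f \<sigma>) = sdim \<sigma>"
  by (simp add: sdim_def)

lemma sface_map: "sface i (map f \<sigma>) = map f (sface i \<sigma>)"
  by (simp add: sface_def take_map drop_map)

lemma sdegen_map: "sdegen i (map f \<sigma>) = map f (sdegen i \<sigma>)"
  by (simp add: sdegen_def take_map drop_map)

lemma map_coface_simplex: "\<sigma> \<in> simplices m k \<Longrightarrow> map (coface i) \<sigma> \<in> simplices m (Suc k)"
  by (fastforce simp: simplices_iff coface_def intro!: sorted_map_mono[OF _ coface_mono])

lemma map_codegen_simplex:
  "\<sigma> \<in> simplices m (Suc k) \<Longrightarrow> i \<le> k \<Longrightarrow> map (codegen i) \<sigma> \<in> simplices m k"
  by (fastforce simp: simplices_iff codegen_def intro!: sorted_map_mono[OF _ codegen_mono])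

text \<open>On the identity simplex, precomposition becomes \<open>sface\<close> or
  \<open>sdegen\<close>; through the Yoneda lemma this turns precompositions into the faces and
  degeneracies of X.\<close>

lemma map_coface_upt: "i \<le> Suc k \<Longrightarrow> map (coface i) [0..<Suc k] = sface i [0..<Suc (Suc k)]"
  by (rule nth_equalityI) (auto simp: sface_def coface_def nth_append simp del: upt_Suc)

lemma map_codegen_upt: "i \<le> k \<Longrightarrow> map (codegen i) [0..<Suc (Suc k)] = sdegen i [0..<Suc k]"
  by (rule nth_equalityI) (auto simp: sdegen_def codegen_def nth_append min_def simp del: upt_Suc)

text \<open>Geometrically, \<sigma> lies in the facet opposite \<open>i\<close>. Values of x on such
  simplices can then be computed from the face d_i x.\<close>

lemma missing_vertex_coface:
  assumes "\<sigma> \<in> simplices m (Suc k)" "i \<le> Suc k" "i \<notin> set \<sigma>"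
  obtains \<tau> where "\<tau> \<in> simplices m k" "\<sigma> = map (coface i) \<tau>"
proof
  \<comment> \<open>This map inverts \<open>coface i\<close> away from the value
    \<open>i\<close>.\<close>
  let ?\<tau> = "map (\<lambda>v. if v < i then v else v - 1) \<sigma>"
  have mono: "(if u < i then u else u - 1) \<le> (if v < i then v else v - 1)" if "u \<le> v" for u v
    using that by auto
  show "?\<tau> \<in> simplices m k"
    using assms by (fastforce simp: simplices_iff intro!: sorted_map_mono[OF _ mono])
  have "coface i (if v < i then v else v - 1) = v" if "v \<in> set \<sigma>" for v
    using that assms by (cases "v = i") (auto simp: coface_def)
  then show "\<sigma> = map (coface i) ?\<tau>"
    by (simp add: map_idI)
qed

text \<open>With k distinct values to hold, a list of length at most k has no room for anything
  else. This singles out the last facet of \<Delta>[k] among the simplices of dimension below k that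
  lie in none of the other facets.\<close>

lemma sorted_eq_upt:
  assumes "sorted \<sigma>" "{..<k} \<subseteq> set \<sigma>" "length \<sigma> \<le> k"
  shows "\<sigma> = [0..<k]"
proof -
  have "k \<le> card (set \<sigma>)"
    using card_mono[OF finite_set assms(2)] by simp
  then have card: "card (set \<sigma>) = k" "length \<sigma> = k"
    using card_length[of \<sigma>] assms(3) by linarith+
  then have "distinct \<sigma>"
    by (intro card_distinct) simp
  moreover have "set \<sigma> = {..<k}"
    using card_subset_eq[OF finite_set assms(2)] card by simp
  ultimately show ?thesis
    using sorted_distinct_set_unique[OF assms(1), of "[0..<k]"] by (simp add: atLeast0LessThan)
qed

text \<open>In a sorted list a repetition occurs at adjacent places, so deleting one copy and
  repeating the other restores the list. No vertex is lost, which keeps the induction in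
  \<open>simplex_maps_unique\<close> inside its case.\<close>

lemma non_distinct_is_degenerate:
  fixes \<sigma> :: "nat list"
  assumes "sorted \<sigma>" "\<not> distinct \<sigma>"
  obtains i where "Suc i < length \<sigma>" "sdegen i (sface i \<sigma>) = \<sigma>" "set (sface i \<sigma>) = set \<sigma>"
proof -
  obtain a b where ab: "a < b" "b < length \<sigma>" "\<sigma> ! a = \<sigma> ! b"
    using assms by (metis distinct_conv_nth linorder_neqE_nat)
  then have len: "Suc a < length \<sigma>"
    by linarith
  have "\<sigma> ! a \<le> \<sigma> ! Suc a" "\<sigma> ! Suc a \<le> \<sigma> ! b"
    using ab(1,2) len by (auto intro!: sorted_nth_mono[OF assms(1)])
  then have eq: "\<sigma> ! a = \<sigma> ! Suc a"
    using ab by simp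
  have \<sigma>: "\<sigma> = take a \<sigma> @ \<sigma> ! Suc a # \<sigma> ! Suc a # drop (Suc (Suc a)) \<sigma>"
    using len eq by (metis Cons_nth_drop_Suc Suc_lessD id_take_nth_drop)
  have face: "sface a \<sigma> = take a \<sigma> @ \<sigma> ! Suc a # drop (Suc (Suc a)) \<sigma>"
    unfolding sface_def using len by (simp add: Cons_nth_drop_Suc)
  show thesis
  proof
    show "Suc a < length \<sigma>" by (fact len)
    have la: "length (take a \<sigma>) = a"
      using len by simp
    show "sdegen a (sface a \<sigma>) = \<sigma>"
      unfolding face sdegen_def by (subst (3) \<sigma>) (simp add: la del: length_take)
    show "set (sface a \<sigma>) = set \<sigma>"
      unfolding face by (subst (3) \<sigma>) auto
  qed
qed

lemma insort_split: "\<exists>ys zs. xs = ys @ zs \<and> insort v xs = ys @ v # zs"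
proof (induction xs)
  case (Cons a xs)
  then obtain ys zs where "xs = ys @ zs" "insort v xs = ys @ v # zs" by blast
  then show ?case
    by (cases "v \<le> a")
      (auto intro: exI[of _ "[]"] exI[of _ "a # ys"])
qed auto

text \<open>The vertex is inserted at its sorted place. This raises the dimension by one, so
  simplices of unbounded dimension are required.\<close>

lemma missing_vertex_is_face:
  assumes "\<sigma> \<in> simplices \<infinity> k" "v \<le> k"
  obtains \<tau> i where "\<tau> \<in> simplices \<infinity> k" "sdim \<tau> \<ge> 1" "i \<le> sdim \<tau>" "sface i \<tau> = \<sigma>"
    "set \<tau> = insert v (set \<sigma>)"
proof -
  obtain ys zs where *: "\<sigma> = ys @ zs" "insort v \<sigma> = ys @ v # zs"
    using insort_split by metis
  show thesis
  proof (rule that)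
    show "insort v \<sigma> \<in> simplices \<infinity> k"
      using assms sorted_insort[of v \<sigma>]
      by (auto simp: simplices_iff set_insort_key insort_not_Nil)
    show "sdim (insort v \<sigma>) \<ge> 1" "length ys \<le> sdim (insort v \<sigma>)"
      using assms * by (auto simp: sdim_def simplices_iff Suc_le_eq)
    show "sface (length ys) (insort v \<sigma>) = \<sigma>"
      using * by (simp add: sface_def)
    show "set (insort v \<sigma>) = insert v (set \<sigma>)"
      by (simp add: set_insort_key)
  qed
qed

section \<open>Maps out of a standard simplex and their determination by one value\<close>

lemma simplex_maps_face:
  "f \<in> simplex_maps m T k \<Longrightarrow> \<sigma> \<in> simplices m k \<Longrightarrow> i \<le> sdim \<sigma> \<Longrightarrow> sdim \<sigma> \<ge> 1 \<Longrightarrow>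
    f (sface i \<sigma>) = fc T (sdim \<sigma>) i (f \<sigma>)"
  by (simp add: simplex_maps_def)

lemma simplex_maps_degen:
  "f \<in> simplex_maps m T k \<Longrightarrow> \<sigma> \<in> simplices m k \<Longrightarrow> i \<le> sdim \<sigma> \<Longrightarrow> enat (Suc (sdim \<sigma>)) \<le> m \<Longrightarrow>
    f (sdegen i \<sigma>) = dg T (sdim \<sigma>) i (f \<sigma>)"
  by (simp add: simplex_maps_def)

lemma simplex_maps_in:
  "f \<in> simplex_maps m T k \<Longrightarrow> \<sigma> \<in> simplices m k \<Longrightarrow> f \<sigma> \<in> elts T (sdim \<sigma>)"
  by (auto simp: simplex_maps_def)

lemma simplex_maps_extensional: "f \<in> simplex_maps m T k \<Longrightarrow> f \<in> extensional (simplices m k)"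
  by (auto simp: simplex_maps_def PiE_def)

text \<open>Adding the missing vertices and then removing repetitions turns any simplex of
  \<open>\<Delta>[k]\<close> into the identity simplex.\<close>

lemma simplex_maps_unique:
  assumes f: "f \<in> simplex_maps \<infinity> X k" and g: "g \<in> simplex_maps \<infinity> X k"
    and eq: "f [0..<Suc k] = g [0..<Suc k]"
  shows "f = g"
proof -
  \<comment> \<open>For \<sigma> hitting all vertices, removing a repetition shortens the list
    without leaving this case, and the only list without repetitions is the identity
    simplex.\<close>
  have surj: "f \<sigma> = g \<sigma>" if "\<sigma> \<in> simplices \<infinity> k" "{..k} \<subseteq> set \<sigma>" for \<sigma>
    using that
  proof (induction "length \<sigma>" arbitrary: \<sigma> rule: less_induct)
    case less
    have sorted: "sorted \<sigma>"
      using less.prems by (simp add: simplices_iff)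
    show ?case
    proof (cases "distinct \<sigma>")
      case True
      have "set \<sigma> = {..k}"
        using less.prems by (auto simp: simplices_iff)
      then have "\<sigma> = [0..<Suc k]"
        using sorted True by (intro sorted_distinct_set_unique) (auto simp: atLeast0LessThan lessThan_Suc_atMost simp del: upt_Suc)
      then show ?thesis
        using eq by simp
    next
      case False
      obtain i where i: "Suc i < length \<sigma>" "sdegen i (sface i \<sigma>) = \<sigma>" "set (sface i \<sigma>) = set \<sigma>"
        using non_distinct_is_degenerate[OF sorted False] .
      have dim: "i \<le> sdim \<sigma>" "sdim \<sigma> \<ge> 1" "i \<le> sdim \<sigma> - 1"
        using i by (auto simp: sdim_def)
      note face = sface_simplex[OF less.prems(1) dim(1,2)]
      have "f (sface i \<sigma>) = g (sface i \<sigma>)"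
        using less.prems face i dim by (intro less.hyps) (auto simp: sface_def)
      then show ?thesis
        using simplex_maps_degen[OF f face(1), of i] simplex_maps_degen[OF g face(1), of i] i face dim
        by simp
    qed
  qed
  \<comment> \<open>Inserting a missing vertex raises the dimension, so the induction runs on the
    number of missing vertices and ends in the surjective case.\<close>
  have "f \<sigma> = g \<sigma>" if "\<sigma> \<in> simplices \<infinity> k" for \<sigma>
    using that
  proof (induction "card ({..k} - set \<sigma>)" arbitrary: \<sigma> rule: less_induct)
    case less
    show ?case
    proof (cases "{..k} \<subseteq> set \<sigma>")
      case True
      then show ?thesis
        using surj less.prems by blast
    next
      case False
      then obtain v where v: "v \<le> k" "v \<notin> set \<sigma>" by auto
      obtain \<tau> i where \<tau>: "\<tau> \<in> simplices \<infinity> k" "sdim \<tau> \<ge> 1" "i \<le> sdim \<tau>" "sface i \<tau> = \<sigma>"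
        "set \<tau> = insert v (set \<sigma>)"
        using missing_vertex_is_face[OF less.prems v(1)] .
      have "card ({..k} - set \<tau>) < card ({..k} - set \<sigma>)"
        using v \<tau> by (intro psubset_card_mono) auto
      then have "f \<tau> = g \<tau>"
        using less.hyps \<tau> by blast
      then show ?thesis
        using simplex_maps_face[OF f \<tau>(1,3,2)] simplex_maps_face[OF g \<tau>(1,3,2)] \<tau>(4) by simp
    qed
  qed
  then show ?thesis
    using simplex_maps_extensional[OF f] simplex_maps_extensional[OF g]
    by (intro extensionalityI) auto
qed

section \<open>The Yoneda lemma\<close>

locale sgroup =
  fixes X :: "'a sgrp"
  assumes simplicial_group: "simplicial_group X"
begin

lemma group_lev [simp, intro]: "group (lev X k)"
  using simplicial_group by (simp add: simplicial_group_def)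

sublocale grp: group "lev X k" for k
  by simp

lemma fc_hom: "i \<le> Suc k \<Longrightarrow> fc X (Suc k) i \<in> hom (lev X (Suc k)) (lev X k)"
  using simplicial_group by (simp add: simplicial_group_def)

lemma dg_hom: "i \<le> k \<Longrightarrow> dg X k i \<in> hom (lev X k) (lev X (Suc k))"
  using simplicial_group by (simp add: simplicial_group_def)

lemma fc_closed [simp]: "i \<le> Suc k \<Longrightarrow> x \<in> elts X (Suc k) \<Longrightarrow> fc X (Suc k) i x \<in> elts X k"
  using fc_hom by (blast dest: hom_in_carrier)

lemma dg_closed [simp]: "i \<le> k \<Longrightarrow> x \<in> elts X k \<Longrightarrow> dg X k i x \<in> elts X (Suc k)"
  using dg_hom by (blast dest: hom_in_carrier)

lemma fc_one [simp]: "i \<le> Suc k \<Longrightarrow> fc X (Suc k) i \<one>\<^bsub>lev X (Suc k)\<^esub> = \<one>\<^bsub>lev X k\<^esub>"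
  using fc_hom by (intro hom_one) auto

lemma dg_one [simp]: "i \<le> k \<Longrightarrow> dg X k i \<one>\<^bsub>lev X k\<^esub> = \<one>\<^bsub>lev X (Suc k)\<^esub>"
  using dg_hom by (intro hom_one) auto

lemma fc_mult [simp]:
  "i \<le> Suc k \<Longrightarrow> x \<in> elts X (Suc k) \<Longrightarrow> y \<in> elts X (Suc k) \<Longrightarrow>
    fc X (Suc k) i (x \<otimes>\<^bsub>lev X (Suc k)\<^esub> y) = fc X (Suc k) i x \<otimes>\<^bsub>lev X k\<^esub> fc X (Suc k) i y"
  using fc_hom by (blast dest: hom_mult)

lemma dg_mult [simp]:
  "i \<le> k \<Longrightarrow> x \<in> elts X k \<Longrightarrow> y \<in> elts X k \<Longrightarrow>
    dg X k i (x \<otimes>\<^bsub>lev X k\<^esub> y) = dg X k i x \<otimes>\<^bsub>lev X (Suc k)\<^esub> dg X k i y"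
  using dg_hom by (blast dest: hom_mult)

lemma fc_inv [simp]:
  "i \<le> Suc k \<Longrightarrow> x \<in> elts X (Suc k) \<Longrightarrow>
    fc X (Suc k) i (inv\<^bsub>lev X (Suc k)\<^esub> x) = inv\<^bsub>lev X k\<^esub> fc X (Suc k) i x"
  using fc_hom by (intro group_hom.hom_inv) (auto simp: group_hom_def group_hom_axioms_def)

lemma fc_fc:
  "x \<in> elts X (Suc (Suc k)) \<Longrightarrow> i < j \<Longrightarrow> j \<le> Suc (Suc k) \<Longrightarrow>
    fc X (Suc k) i (fc X (Suc (Suc k)) j x) = fc X (Suc k) (j - 1) (fc X (Suc (Suc k)) i x)"
  using simplicial_group by (simp add: simplicial_group_def)

lemma fc_dg_below:
  "x \<in> elts X (Suc k) \<Longrightarrow> i < j \<Longrightarrow> j \<le> Suc k \<Longrightarrow>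
    fc X (Suc (Suc k)) i (dg X (Suc k) j x) = dg X k (j - 1) (fc X (Suc k) i x)"
  using simplicial_group by (simp add: simplicial_group_def)

lemma fc_dg_same [simp]:
  "x \<in> elts X k \<Longrightarrow> j \<le> k \<Longrightarrow> fc X (Suc k) j (dg X k j x) = x"
  "x \<in> elts X k \<Longrightarrow> j \<le> k \<Longrightarrow> fc X (Suc k) (Suc j) (dg X k j x) = x"
  using simplicial_group by (simp_all add: simplicial_group_def)

lemma fc_dg_above:
  "x \<in> elts X (Suc k) \<Longrightarrow> Suc j < i \<Longrightarrow> i \<le> Suc (Suc k) \<Longrightarrow>
    fc X (Suc (Suc k)) i (dg X (Suc k) j x) = dg X k j (fc X (Suc k) (i - 1) x)"
  using simplicial_group by (simp add: simplicial_group_def)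

lemma dg_dg:
  "x \<in> elts X k \<Longrightarrow> i \<le> j \<Longrightarrow> j \<le> k \<Longrightarrow>
    dg X (Suc k) i (dg X k j x) = dg X (Suc k) (Suc j) (dg X k i x)"
  using simplicial_group by (simp add: simplicial_group_def)

end

text \<open>A simplex of \<open>\<Delta>[k]\<close> is determined by the number \<open>c v\<close> of occurrences of each vertex
  \<open>v\<close>. It is obtained from the identity simplex by treating the vertices \<open>k, \<dots>, 0\<close> in turn:
  the vertex \<open>v\<close> is still in position \<open>v\<close> when its turn comes, and is deleted by \<open>d\<^sub>v\<close> or repeated
  by a power of \<open>s\<^sub>v\<close>.\<close>

fun repeat_vertex :: "'a sgrp \<Rightarrow> nat \<Rightarrow> nat \<Rightarrow> nat \<Rightarrow> 'a \<Rightarrow> 'a" where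
  "repeat_vertex X v 0 l y = y"
| "repeat_vertex X v (Suc m) l y = dg X (l + m) v (repeat_vertex X v m l y)"

fun adjust_vertex :: "'a sgrp \<Rightarrow> nat \<Rightarrow> nat \<Rightarrow> nat \<Rightarrow> 'a \<Rightarrow> 'a" where
  "adjust_vertex X v 0 l y = fc X l v y"
| "adjust_vertex X v (Suc m) l y = repeat_vertex X v m l y"

text \<open>The degree changes by \<open>c v - 1\<close>, since the single position of
  \<open>v\<close> becomes \<open>c v\<close> positions.\<close>

fun adjust_vertices :: "'a sgrp \<Rightarrow> (nat \<Rightarrow> nat) \<Rightarrow> nat \<Rightarrow> nat \<Rightarrow> 'a \<Rightarrow> 'a" where
  "adjust_vertices X c 0 l y = y"
| "adjust_vertices X c (Suc v) l y =
     adjust_vertices X c v (l + c v - 1) (adjust_vertex X v (c v) l y)"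

lemma adjust_vertices_cong:
  "(\<And>u. u < v \<Longrightarrow> c u = c' u) \<Longrightarrow> adjust_vertices X c v l y = adjust_vertices X c' v l y"
  by (induction v arbitrary: l y) auto

context sgroup
begin

lemma repeat_vertex_closed: "y \<in> elts X l \<Longrightarrow> v \<le> l \<Longrightarrow> repeat_vertex X v m l y \<in> elts X (l + m)"
  by (induction m) auto

text \<open>After \<open>Suc m\<close> repetitions the positions v to v + m + 1 carry the same
  vertex, so deleting any of them undoes one repetition. The first two positions cancel the
  outermost degeneracy; the others pass through it to the inner ones.\<close>

lemma fc_repeat_vertex:
  assumes "y \<in> elts X l" "v \<le> l" "r \<le> Suc m"
  shows "fc X (Suc (l + m)) (v + r) (repeat_vertex X v (Suc m) l y) = repeat_vertex X v m l y"
  using assms(3)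
proof (induction m arbitrary: r)
  case 0
  then have "r = 0 \<or> r = 1" by auto
  then show ?case using assms by auto
next
  case (Suc m)
  note closed = repeat_vertex_closed[OF assms(1,2), of "Suc m"]
  show ?case
  proof (cases "r \<le> 1")
    case True
    then have "r = 0 \<or> r = 1" by auto
    then show ?thesis using assms closed by auto
  next
    case False
    then obtain q where q: "r = Suc q" "0 < q" by (cases r) auto
    have "fc X (Suc (l + Suc m)) (v + r) (repeat_vertex X v (Suc (Suc m)) l y)
        = fc X (Suc (Suc (l + m))) (v + r) (dg X (Suc (l + m)) v (repeat_vertex X v (Suc m) l y))"
      by simp
    also have "\<dots> = dg X (l + m) v (fc X (Suc (l + m)) (v + r - 1) (repeat_vertex X v (Suc m) l y))"
      using closed q Suc.prems assms by (intro fc_dg_above) auto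
    also have "v + r - 1 = v + q"
      using q by simp
    also have "fc X (Suc (l + m)) (v + q) (repeat_vertex X v (Suc m) l y) = repeat_vertex X v m l y"
      using Suc.prems q by (intro Suc.IH) auto
    finally show ?thesis by simp
  qed
qed

lemma fc_repeat_vertex_above:
  assumes "y \<in> elts X (Suc l)" "v \<le> l" "v < i" "i \<le> Suc l"
  shows "fc X (Suc (l + m)) (i + m) (repeat_vertex X v m (Suc l) y) =
    repeat_vertex X v m l (fc X (Suc l) i y)"
proof (induction m)
  case (Suc m)
  have "fc X (Suc (l + Suc m)) (i + Suc m) (repeat_vertex X v (Suc m) (Suc l) y)
      = fc X (Suc (Suc (l + m))) (i + Suc m) (dg X (Suc (l + m)) v (repeat_vertex X v m (Suc l) y))"
    by simp
  also have "\<dots> = dg X (l + m) v (fc X (Suc (l + m)) (i + Suc m - 1) (repeat_vertex X v m (Suc l) y))"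
    using repeat_vertex_closed[OF assms(1), of v m] assms by (intro fc_dg_above) auto
  finally show ?case
    using Suc by simp
qed simp

text \<open>Repeating a later copy of \<open>v\<close> is the same as repeating the first one, by
  the exchange rule for degeneracies.\<close>

lemma dg_repeat_vertex:
  assumes "y \<in> elts X l" "v \<le> l" "r \<le> m"
  shows "dg X (l + m) (v + r) (repeat_vertex X v m l y) = repeat_vertex X v (Suc m) l y"
  using assms(3)
proof (induction m arbitrary: r)
  case (Suc m)
  show ?case
  proof (cases r)
    case (Suc q)
    have "dg X (l + Suc m) (v + r) (repeat_vertex X v (Suc m) l y)
        = dg X (Suc (l + m)) (Suc (v + q)) (dg X (l + m) v (repeat_vertex X v m l y))"
      using Suc by simp
    also have "\<dots> = dg X (Suc (l + m)) v (dg X (l + m) (v + q) (repeat_vertex X v m l y))"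
      using repeat_vertex_closed[OF assms(1,2), of m] Suc \<open>r \<le> Suc m\<close> assms
      by (intro dg_dg[symmetric]) auto
    finally show ?thesis
      using Suc.IH[of q] Suc \<open>r \<le> Suc m\<close> by simp
  qed simp
qed simp

lemma dg_repeat_vertex_above:
  assumes "y \<in> elts X l" "v < i" "i \<le> l"
  shows "dg X (l + m) (i + m) (repeat_vertex X v m l y) = repeat_vertex X v m (Suc l) (dg X l i y)"
proof (induction m)
  case (Suc m)
  have "dg X (l + Suc m) (i + Suc m) (repeat_vertex X v (Suc m) l y)
      = dg X (Suc (l + m)) (Suc (i + m)) (dg X (l + m) v (repeat_vertex X v m l y))"
    by simp
  also have "\<dots> = dg X (Suc (l + m)) v (dg X (l + m) (i + m) (repeat_vertex X v m l y))"
    using repeat_vertex_closed[OF assms(1), of v m] assms by (intro dg_dg[symmetric]) auto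
  finally show ?case
    using Suc by simp
qed simp

lemma adjust_vertex_closed:
  assumes "y \<in> elts X l" "v \<le> l" "0 < l + c"
  shows "adjust_vertex X v c l y \<in> elts X (l + c - 1)"
proof (cases c)
  case 0
  then show ?thesis using assms by (cases l) auto
qed (use assms repeat_vertex_closed in auto)

lemma fc_adjust_vertex:
  assumes "y \<in> elts X l" "v \<le> l" "r < c" "1 < l + c"
  shows "fc X (l + c - 1) (v + r) (adjust_vertex X v c l y) = adjust_vertex X v (c - 1) l y"
proof (cases c)
  case (Suc m)
  show ?thesis
  proof (cases m)
    case 0
    then show ?thesis using assms Suc by simp
  next
    case (Suc m')
    then show ?thesis
      using fc_repeat_vertex[OF assms(1,2), of r m'] assms \<open>c = Suc m\<close> by simp
  qed
qed (use assms in simp)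

lemma fc_adjust_vertex_above:
  assumes "y \<in> elts X (Suc l)" "v < i" "i \<le> Suc l" "0 < l + c"
  shows "fc X (l + c) (i + c - 1) (adjust_vertex X v c (Suc l) y) =
    adjust_vertex X v c l (fc X (Suc l) i y)"
proof (cases c)
  case 0
  then obtain l' where "l = Suc l'" using assms by (cases l) auto
  then show ?thesis
    using 0 assms fc_fc[of y l' v i] by simp
next
  case (Suc m)
  then show ?thesis
    using fc_repeat_vertex_above[OF assms(1), of v i m] assms by simp
qed

lemma dg_adjust_vertex:
  assumes "y \<in> elts X l" "v \<le> l" "r < c"
  shows "dg X (l + c - 1) (v + r) (adjust_vertex X v c l y) = adjust_vertex X v (Suc c) l y"
proof (cases c)
  case (Suc m)
  then show ?thesis
    using dg_repeat_vertex[OF assms(1,2), of r m] assms by simp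
qed (use assms in simp)

lemma dg_adjust_vertex_above:
  assumes "y \<in> elts X l" "v < i" "i \<le> l" "0 < l + c"
  shows "dg X (l + c - 1) (i + c - 1) (adjust_vertex X v c l y) =
    adjust_vertex X v c (Suc l) (dg X l i y)"
proof (cases c)
  case 0
  then obtain l' where "l = Suc l'" using assms by (cases l) auto
  then show ?thesis
    using 0 assms fc_dg_below[of y l' v i] by simp
next
  case (Suc m)
  then show ?thesis
    using dg_repeat_vertex_above[OF assms(1,2,3), of m] by simp
qed

text \<open>The last hypothesis says that at least one vertex survives; otherwise the subtraction in
  the resulting degree would be truncated.\<close>

lemma adjust_vertices_closed:
  assumes "y \<in> elts X l" "v \<le> Suc l" "v \<le> l + sum c {..<v}"
  shows "adjust_vertices X c v l y \<in> elts X (l + sum c {..<v} - v)"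
  using assms
proof (induction v arbitrary: l y)
  case (Suc v)
  have "adjust_vertices X c v (l + c v - 1) (adjust_vertex X v (c v) l y)
      \<in> elts X (l + c v - 1 + sum c {..<v} - v)"
    using Suc.prems by (intro Suc.IH adjust_vertex_closed) (auto intro!: Nat.gr0I)
  moreover have "l + c v - 1 + sum c {..<v} - v = l + sum c {..<Suc v} - Suc v"
    using Suc.prems by (cases "l + c v") auto
  ultimately show ?case by simp
qed simp

text \<open>Positions from \<open>v\<close> on belong to vertices treated already. The remaining
  treatment replaces the first \<open>v\<close> positions by \<open>sum c {..<v}\<close> ones, which
  shifts \<open>i\<close> by the difference, and the face can be taken beforehand.\<close>

lemma fc_adjust_vertices_above:
  assumes "y \<in> elts X l" "v \<le> i" "i \<le> l" "v < l + sum c {..<v}"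
  shows "fc X (l + sum c {..<v} - v) (i + sum c {..<v} - v) (adjust_vertices X c v l y) =
    adjust_vertices X c v (l - 1) (fc X l i y)"
  using assms
proof (induction v arbitrary: l i y)
  case (Suc v)
  obtain l' where l: "l = Suc l'" using Suc.prems by (cases l) auto
  have pos: "0 < l' + c v"
    using Suc.prems l by (cases v) auto
  have lev: "l + c v - 1 + sum c {..<v} - v = l + sum c {..<Suc v} - Suc v"
    "i + c v - 1 + sum c {..<v} - v = i + sum c {..<Suc v} - Suc v"
    using Suc.prems by auto
  have "fc X (l + c v - 1 + sum c {..<v} - v) (i + c v - 1 + sum c {..<v} - v)
      (adjust_vertices X c v (l + c v - 1) (adjust_vertex X v (c v) l y))
    = adjust_vertices X c v (l + c v - 1 - 1)
        (fc X (l + c v - 1) (i + c v - 1) (adjust_vertex X v (c v) l y))"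
    using Suc.prems l pos by (intro Suc.IH adjust_vertex_closed) auto
  also have "fc X (l + c v - 1) (i + c v - 1) (adjust_vertex X v (c v) l y)
      = adjust_vertex X v (c v) l' (fc X l i y)"
    using fc_adjust_vertex_above[of y l' v i "c v"] Suc.prems l pos by simp
  finally show ?case
    unfolding lev by (simp add: l)
qed simp

lemma dg_adjust_vertices_above:
  assumes "y \<in> elts X l" "v \<le> i" "i \<le> l" "v \<le> l + sum c {..<v}"
  shows "dg X (l + sum c {..<v} - v) (i + sum c {..<v} - v) (adjust_vertices X c v l y) =
    adjust_vertices X c v (Suc l) (dg X l i y)"
  using assms
proof (induction v arbitrary: l i y)
  case (Suc v)
  have pos: "0 < l + c v"
    using Suc.prems by auto
  have lev: "l + c v - 1 + sum c {..<v} - v = l + sum c {..<Suc v} - Suc v"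
    "i + c v - 1 + sum c {..<v} - v = i + sum c {..<Suc v} - Suc v"
    using Suc.prems by auto
  have "dg X (l + c v - 1 + sum c {..<v} - v) (i + c v - 1 + sum c {..<v} - v)
      (adjust_vertices X c v (l + c v - 1) (adjust_vertex X v (c v) l y))
    = adjust_vertices X c v (Suc (l + c v - 1))
        (dg X (l + c v - 1) (i + c v - 1) (adjust_vertex X v (c v) l y))"
    using Suc.prems pos by (intro Suc.IH adjust_vertex_closed) auto
  also have "dg X (l + c v - 1) (i + c v - 1) (adjust_vertex X v (c v) l y)
      = adjust_vertex X v (c v) (Suc l) (dg X l i y)"
    using Suc.prems pos by (intro dg_adjust_vertex_above) auto
  finally show ?case
    unfolding lev using pos by simp
qed simp

text \<open>The prefix sums place position \<open>i\<close> in the block of copies of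
  \<open>u\<close>. Vertices above \<open>u\<close> are treated earlier and do not see this face;
  the treatment of those below \<open>u\<close> is passed by
  \<open>fc_adjust_vertices_above\<close>.\<close>

lemma fc_adjust_vertices:
  assumes "y \<in> elts X l" "v \<le> Suc l" "Suc v < Suc l + sum c {..<v}"
    and "u < v" "sum c {..<u} \<le> i" "i < sum c {..<Suc u}"
  shows "fc X (l + sum c {..<v} - v) i (adjust_vertices X c v l y) =
    adjust_vertices X (c(u := c u - 1)) v l y"
  using assms
proof (induction v arbitrary: l y)
  case (Suc v)
  have pos: "0 < l + c v"
    using Suc.prems by (auto intro!: Nat.gr0I)
  have lev: "l + c v - 1 + sum c {..<v} - v = l + sum c {..<Suc v} - Suc v"
    using pos by auto
  show ?case
  proof (cases "u = v")
    case False
    have "fc X (l + c v - 1 + sum c {..<v} - v) i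
        (adjust_vertices X c v (l + c v - 1) (adjust_vertex X v (c v) l y))
      = adjust_vertices X (c(u := c u - 1)) v (l + c v - 1) (adjust_vertex X v (c v) l y)"
      using Suc.prems False pos by (intro Suc.IH adjust_vertex_closed) auto
    then show ?thesis
      unfolding lev using False by (simp add: fun_upd_def)
  next
    case True
    \<comment> \<open>Offset of position \<open>i\<close> within the block of copies of
      \<open>v\<close>.\<close>
    define r where "r = i - sum c {..<v}"
    have r: "r < c v" "i = v + r + sum c {..<v} - v"
      using Suc.prems True by (auto simp: r_def)
    have "fc X (l + c v - 1 + sum c {..<v} - v) i
        (adjust_vertices X c v (l + c v - 1) (adjust_vertex X v (c v) l y))
      = adjust_vertices X c v (l + c v - 1 - 1)
        (fc X (l + c v - 1) (v + r) (adjust_vertex X v (c v) l y))"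
      unfolding r(2) using Suc.prems pos r
      by (intro fc_adjust_vertices_above adjust_vertex_closed) auto
    also have "fc X (l + c v - 1) (v + r) (adjust_vertex X v (c v) l y)
        = adjust_vertex X v (c v - 1) l y"
    proof (rule fc_adjust_vertex)
      \<comment> \<open>Otherwise \<open>v\<close> would be the only vertex of a 0-simplex, which
        has no faces; the hypothesis on the total count excludes this.\<close>
      show "1 < l + c v"
      proof (rule ccontr)
        assume "\<not> ?thesis"
        then have "l = 0" "c v = 1" using r by auto
        then show False using Suc.prems by simp
      qed
    qed (use Suc.prems r in auto)
    also have "adjust_vertices X c v (l + c v - 1 - 1) (adjust_vertex X v (c v - 1) l y)
        = adjust_vertices X (c(v := c v - 1)) v (l + c v - 1 - 1) (adjust_vertex X v (c v - 1) l y)"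
      by (rule adjust_vertices_cong) simp
    finally show ?thesis
      unfolding lev using True r by (simp add: fun_upd_def)
  qed
qed simp

lemma dg_adjust_vertices:
  assumes "y \<in> elts X l" "v \<le> Suc l" "Suc v \<le> Suc l + sum c {..<v}"
    and "u < v" "sum c {..<u} \<le> i" "i < sum c {..<Suc u}"
  shows "dg X (l + sum c {..<v} - v) i (adjust_vertices X c v l y) =
    adjust_vertices X (c(u := Suc (c u))) v l y"
  using assms
proof (induction v arbitrary: l y)
  case (Suc v)
  have pos: "0 < l + c v"
    using Suc.prems by (auto intro!: Nat.gr0I)
  have lev: "l + c v - 1 + sum c {..<v} - v = l + sum c {..<Suc v} - Suc v"
    using pos by auto
  show ?case
  proof (cases "u = v")
    case False
    have "dg X (l + c v - 1 + sum c {..<v} - v) i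
        (adjust_vertices X c v (l + c v - 1) (adjust_vertex X v (c v) l y))
      = adjust_vertices X (c(u := Suc (c u))) v (l + c v - 1) (adjust_vertex X v (c v) l y)"
      using Suc.prems False pos by (intro Suc.IH adjust_vertex_closed) auto
    then show ?thesis
      unfolding lev using False by (simp add: fun_upd_def)
  next
    case True
    define r where "r = i - sum c {..<v}"
    have r: "r < c v" "i = v + r + sum c {..<v} - v"
      using Suc.prems True by (auto simp: r_def)
    have "dg X (l + c v - 1 + sum c {..<v} - v) i
        (adjust_vertices X c v (l + c v - 1) (adjust_vertex X v (c v) l y))
      = adjust_vertices X c v (Suc (l + c v - 1))
        (dg X (l + c v - 1) (v + r) (adjust_vertex X v (c v) l y))"
      unfolding r(2) using Suc.prems pos r
      by (intro dg_adjust_vertices_above adjust_vertex_closed) auto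
    also have "dg X (l + c v - 1) (v + r) (adjust_vertex X v (c v) l y)
        = adjust_vertex X v (Suc (c v)) l y"
      using Suc.prems r by (intro dg_adjust_vertex) auto
    also have "adjust_vertices X c v (Suc (l + c v - 1)) (adjust_vertex X v (Suc (c v)) l y)
        = adjust_vertices X (c(v := Suc (c v))) v (Suc (l + c v - 1)) (adjust_vertex X v (Suc (c v)) l y)"
      by (rule adjust_vertices_cong) simp
    finally show ?thesis
      unfolding lev using True pos by (simp add: fun_upd_def)
  qed
qed simp

lemma adjust_vertices_id: "(\<And>u. u < v \<Longrightarrow> c u = 1) \<Longrightarrow> adjust_vertices X c v l y = y"
  by (induction v arbitrary: l) auto

end

section \<open>Vertex counts of a simplex and their change under faces and degeneracies\<close>

lemma sum_count_list_below:
  fixes \<sigma> :: "nat list"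
  shows "sum (count_list \<sigma>) {..<u} = length (filter (\<lambda>x. x < u) \<sigma>)"
proof (induction \<sigma>)
  case (Cons a \<sigma>)
  have "count_list (a # \<sigma>) = (\<lambda>x. count_list \<sigma> x + (if a = x then 1 else 0))"
    by auto
  then show ?case
    using Cons by (simp add: sum.distrib)
qed simp

lemma count_list_upt: "u < n \<Longrightarrow> count_list [0..<n] u = 1"
  by (induction n) (auto simp: less_Suc_eq)

text \<open>All smaller entries come before position \<open>i\<close>, and the copies of its entry
  form one block. These are the hypotheses of \<open>fc_adjust_vertices\<close> for the vertex at
  \<open>i\<close>.\<close>

lemma sorted_count_bounds:
  fixes \<sigma> :: "nat list"
  assumes "sorted \<sigma>" "i < length \<sigma>"
  shows "sum (count_list \<sigma>) {..<\<sigma> ! i} \<le> i" "i < sum (count_list \<sigma>) {..<Suc (\<sigma> ! i)}"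
proof -
  have "{p. p < length \<sigma> \<and> \<sigma> ! p < \<sigma> ! i} \<subseteq> {..<i}"
    using sorted_nth_mono[OF assms(1), of i] by (force simp: not_le[symmetric])
  from card_mono[OF _ this] show "sum (count_list \<sigma>) {..<\<sigma> ! i} \<le> i"
    by (simp add: sum_count_list_below length_filter_conv_card del: sum.lessThan_Suc)
  have "{..i} \<subseteq> {p. p < length \<sigma> \<and> \<sigma> ! p < Suc (\<sigma> ! i)}"
    using assms by (auto simp: less_Suc_eq_le intro: sorted_nth_mono)
  from card_mono[OF _ this] show "i < sum (count_list \<sigma>) {..<Suc (\<sigma> ! i)}"
    by (simp add: sum_count_list_below length_filter_conv_card del: sum.lessThan_Suc)
qed

lemma count_list_sface:
  assumes "i < length \<sigma>"
  shows "count_list (sface i \<sigma>) = (count_list \<sigma>)(\<sigma> ! i := count_list \<sigma> (\<sigma> ! i) - 1)"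
proof
  fix u
  have "count_list \<sigma> u = count_list (take i \<sigma> @ \<sigma> ! i # drop (Suc i) \<sigma>) u"
    using assms by (simp add: id_take_nth_drop[symmetric])
  then show "count_list (sface i \<sigma>) u = ((count_list \<sigma>)(\<sigma> ! i := count_list \<sigma> (\<sigma> ! i) - 1)) u"
    by (auto simp: sface_def)
qed

lemma count_list_sdegen:
  assumes "i < length \<sigma>"
  shows "count_list (sdegen i \<sigma>) = (count_list \<sigma>)(\<sigma> ! i := Suc (count_list \<sigma> (\<sigma> ! i)))"
proof
  fix u
  have 1: "count_list \<sigma> u = count_list (take i \<sigma> @ \<sigma> ! i # drop (Suc i) \<sigma>) u"
    using assms by (simp add: id_take_nth_drop[symmetric])
  have 2: "sdegen i \<sigma> = take i \<sigma> @ \<sigma> ! i # \<sigma> ! i # drop (Suc i) \<sigma>"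
    using assms by (simp add: sdegen_def take_Suc_conv_app_nth Cons_nth_drop_Suc)
  show "count_list (sdegen i \<sigma>) u = ((count_list \<sigma>)(\<sigma> ! i := Suc (count_list \<sigma> (\<sigma> ! i)))) u"
    using 1 unfolding 2 by auto
qed

context sgroup
begin

text \<open>The candidate value on \<sigma> is the normal form given by its vertex counts.
  Simpliciality then reduces to the fact that a face lowers, and a degeneracy raises, the count of
  the vertex at that position.\<close>

lemma classifying_map_exists:
  assumes "x \<in> elts X k"
  shows "\<exists>f. f \<in> simplex_maps \<infinity> X k \<and> f [0..<Suc k] = x"
proof -
  define f where "f = (\<lambda>\<sigma>\<in>simplices \<infinity> k. adjust_vertices X (count_list \<sigma>) (Suc k) k x)"
  \<comment> \<open>All entries are at most \<open>k\<close>, so the counts add up to the length;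
    hence the normal form lands in degree \<open>sdim \<sigma>\<close>.\<close>
  have lev: "sum (count_list \<sigma>) {..<Suc k} = Suc (sdim \<sigma>)" if "\<sigma> \<in> simplices \<infinity> k" for \<sigma>
    using that length_simplex[OF that]
    by (subst sum_count_list_below, subst filter_True) (auto simp: simplices_iff)
  have closed: "f \<sigma> \<in> elts X (sdim \<sigma>)" if "\<sigma> \<in> simplices \<infinity> k" for \<sigma>
    using adjust_vertices_closed[OF assms, of "Suc k" "count_list \<sigma>"] that
    by (simp add: lev[OF that] f_def del: sum.lessThan_Suc adjust_vertices.simps)
  have "f (sface i \<sigma>) = fc X (sdim \<sigma>) i (f \<sigma>)"
    if \<sigma>: "\<sigma> \<in> simplices \<infinity> k" "i \<le> sdim \<sigma>" "sdim \<sigma> \<ge> 1" for \<sigma> i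
  proof -
    have i: "i < length \<sigma>"
      using \<sigma> length_simplex by simp
    have "\<sigma> ! i < Suc k"
      using \<sigma> nth_mem[OF i] by (auto simp: simplices_iff)
    moreover note sorted_count_bounds[OF _ i]
    moreover have "sorted \<sigma>"
      using \<sigma> by (simp add: simplices_iff)
    ultimately show ?thesis
      using fc_adjust_vertices[OF assms, of "Suc k" "count_list \<sigma>" "\<sigma> ! i" i] \<sigma>
        sface_simplex[OF \<sigma>]
      by (simp add: lev[OF \<sigma>(1)] f_def count_list_sface[OF i] del: sum.lessThan_Suc adjust_vertices.simps)
  qed
  moreover have "f (sdegen i \<sigma>) = dg X (sdim \<sigma>) i (f \<sigma>)"
    if \<sigma>: "\<sigma> \<in> simplices \<infinity> k" "i \<le> sdim \<sigma>" for \<sigma> i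
  proof -
    have i: "i < length \<sigma>"
      using \<sigma> length_simplex by simp
    have "\<sigma> ! i < Suc k"
      using \<sigma> nth_mem[OF i] by (auto simp: simplices_iff)
    moreover note sorted_count_bounds[OF _ i]
    moreover have "sorted \<sigma>"
      using \<sigma> by (simp add: simplices_iff)
    ultimately show ?thesis
      using dg_adjust_vertices[OF assms, of "Suc k" "count_list \<sigma>" "\<sigma> ! i" i] \<sigma>
        sdegen_simplex[OF \<sigma>]
      by (simp add: lev[OF \<sigma>(1)] f_def count_list_sdegen[OF i] del: sum.lessThan_Suc adjust_vertices.simps)
  qed
  ultimately have "f \<in> simplex_maps \<infinity> X k"
    using closed by (auto simp: simplex_maps_def f_def intro!: PiE_I)
  moreover have "f [0..<Suc k] = x"
    using upt_simplex[of k \<infinity>] adjust_vertices_id[of "Suc k" "count_list [0..<Suc k]" k x]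
    by (simp add: f_def count_list_upt del: upt_Suc adjust_vertices.simps)
  ultimately show ?thesis by blast
qed

lemma
  assumes "x \<in> elts X k"
  shows classifying_map: "classifying_map X k x \<in> simplex_maps \<infinity> X k"
    and classifying_map_id: "classifying_map X k x [0..<Suc k] = x"
proof -
  have "\<exists>!f. f \<in> simplex_maps \<infinity> X k \<and> f [0..<Suc k] = x"
    using classifying_map_exists[OF assms] simplex_maps_unique by blast
  from theI'[OF this]
  show "classifying_map X k x \<in> simplex_maps \<infinity> X k" "classifying_map X k x [0..<Suc k] = x"
    unfolding classifying_map_def by auto
qed

lemma classifying_map_eqI:
  assumes "f \<in> simplex_maps \<infinity> X k" "f [0..<Suc k] = x"
  shows "classifying_map X k x = f"
proof -
  have "[0..<Suc k] \<in> simplices \<infinity> k"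
    by (simp add: upt_simplex del: upt_Suc)
  from simplex_maps_in[OF assms(1) this] have "x \<in> elts X k"
    using assms(2) by (simp del: upt_Suc)
  then show ?thesis
    using assms classifying_map classifying_map_id simplex_maps_unique by metis
qed

end

section \<open>Precomposition with cosimplicial operators, and simplicial homomorphisms\<close>

lemma simplex_maps_coface:
  assumes "f \<in> simplex_maps m T (Suc k)"
  shows "(\<lambda>\<tau>\<in>simplices m k. f (map (coface i) \<tau>)) \<in> simplex_maps m T k"
proof -
  have "f (map (coface i) \<tau>) \<in> elts T (sdim \<tau>)" if "\<tau> \<in> simplices m k" for \<tau>
    using simplex_maps_in[OF assms map_coface_simplex[OF that]] by simp
  moreover have "f (map (coface i) (sface j \<tau>)) = fc T (sdim \<tau>) j (f (map (coface i) \<tau>))"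
    if "\<tau> \<in> simplices m k" "j \<le> sdim \<tau>" "sdim \<tau> \<ge> 1" for \<tau> j
    using simplex_maps_face[OF assms map_coface_simplex[OF that(1)], of j] that by (simp add: sface_map)
  moreover have "f (map (coface i) (sdegen j \<tau>)) = dg T (sdim \<tau>) j (f (map (coface i) \<tau>))"
    if "\<tau> \<in> simplices m k" "j \<le> sdim \<tau>" "enat (Suc (sdim \<tau>)) \<le> m" for \<tau> j
    using simplex_maps_degen[OF assms map_coface_simplex[OF that(1)], of j] that by (simp add: sdegen_map)
  ultimately show ?thesis
    by (auto simp: simplex_maps_def sface_simplex sdegen_simplex)
qed

lemma simplex_maps_codegen:
  assumes "f \<in> simplex_maps m T k" "i \<le> k"
  shows "(\<lambda>\<tau>\<in>simplices m (Suc k). f (map (codegen i) \<tau>)) \<in> simplex_maps m T (Suc k)"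
proof -
  note codegen = map_codegen_simplex[OF _ assms(2)]
  have "f (map (codegen i) \<tau>) \<in> elts T (sdim \<tau>)" if "\<tau> \<in> simplices m (Suc k)" for \<tau>
    using simplex_maps_in[OF assms(1) codegen[OF that]] by simp
  moreover have "f (map (codegen i) (sface j \<tau>)) = fc T (sdim \<tau>) j (f (map (codegen i) \<tau>))"
    if "\<tau> \<in> simplices m (Suc k)" "j \<le> sdim \<tau>" "sdim \<tau> \<ge> 1" for \<tau> j
    using simplex_maps_face[OF assms(1) codegen[OF that(1)], of j] that by (simp add: sface_map)
  moreover have "f (map (codegen i) (sdegen j \<tau>)) = dg T (sdim \<tau>) j (f (map (codegen i) \<tau>))"
    if "\<tau> \<in> simplices m (Suc k)" "j \<le> sdim \<tau>" "enat (Suc (sdim \<tau>)) \<le> m" for \<tau> j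
    using simplex_maps_degen[OF assms(1) codegen[OF that(1)], of j] that by (simp add: sdegen_map)
  ultimately show ?thesis
    by (auto simp: simplex_maps_def sface_simplex sdegen_simplex)
qed

lemma simplicial_hom_hom: "f \<in> simplicial_hom X Y \<Longrightarrow> f k \<in> hom (lev X k) (lev Y k)"
  by (simp add: simplicial_hom_def)

lemma simplicial_hom_extensional: "f \<in> simplicial_hom X Y \<Longrightarrow> f k \<in> extensional (elts X k)"
  by (simp add: simplicial_hom_def)

lemma simplicial_hom_fc:
  "f \<in> simplicial_hom X Y \<Longrightarrow> x \<in> elts X (Suc k) \<Longrightarrow> i \<le> Suc k \<Longrightarrow>
    f k (fc X (Suc k) i x) = fc Y (Suc k) i (f (Suc k) x)"
  by (simp add: simplicial_hom_def)

lemma simplicial_hom_dg: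
  "f \<in> simplicial_hom X Y \<Longrightarrow> x \<in> elts X k \<Longrightarrow> i \<le> k \<Longrightarrow>
    f (Suc k) (dg X k i x) = dg Y k i (f k x)"
  by (simp add: simplicial_hom_def)

lemma simplicial_hom_closed: "f \<in> simplicial_hom X Y \<Longrightarrow> x \<in> elts X k \<Longrightarrow> f k x \<in> elts Y k"
  using simplicial_hom_hom by (blast dest: hom_in_carrier)

lemma simplicial_hom_one:
  assumes "simplicial_group X" "simplicial_group Y" "f \<in> simplicial_hom X Y"
  shows "f k \<one>\<^bsub>lev X k\<^esub> = \<one>\<^bsub>lev Y k\<^esub>"
  by (rule hom_one[OF simplicial_hom_hom[OF assms(3)]
      sgroup.group_lev[OF sgroup.intro[OF assms(1)]] sgroup.group_lev[OF sgroup.intro[OF assms(2)]]])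

context sgroup
begin

lemma classifying_map_in:
  "x \<in> elts X k \<Longrightarrow> \<sigma> \<in> simplices m k \<Longrightarrow> classifying_map X k x \<sigma> \<in> elts X (sdim \<sigma>)"
  by (rule simplex_maps_in[OF classifying_map simplices_infinity])

lemma classifying_map_sface:
  "x \<in> elts X k \<Longrightarrow> \<sigma> \<in> simplices m k \<Longrightarrow> i \<le> sdim \<sigma> \<Longrightarrow> 1 \<le> sdim \<sigma> \<Longrightarrow>
    classifying_map X k x (sface i \<sigma>) = fc X (sdim \<sigma>) i (classifying_map X k x \<sigma>)"
  by (rule simplex_maps_face[OF classifying_map simplices_infinity])

lemma classifying_map_sdegen:
  "x \<in> elts X k \<Longrightarrow> \<sigma> \<in> simplices m k \<Longrightarrow> i \<le> sdim \<sigma> \<Longrightarrow>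
    classifying_map X k x (sdegen i \<sigma>) = dg X (sdim \<sigma>) i (classifying_map X k x \<sigma>)"
  by (rule simplex_maps_degen[OF classifying_map simplices_infinity]) auto

text \<open>The pointwise product of two classifying maps is again a simplicial map with the right
  value at the identity simplex, so uniqueness applies. Compatibility with \<open>fc\<close>,
  \<open>dg\<close> and homomorphisms follows the same scheme.\<close>

lemma classifying_map_mult:
  assumes x: "x \<in> elts X k" and y: "y \<in> elts X k" and "\<sigma> \<in> simplices m k"
  shows "classifying_map X k (x \<otimes>\<^bsub>lev X k\<^esub> y) \<sigma> =
    classifying_map X k x \<sigma> \<otimes>\<^bsub>lev X (sdim \<sigma>)\<^esub> classifying_map X k y \<sigma>"
proof -
  let ?f = "\<lambda>\<sigma>\<in>simplices \<infinity> k.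
    classifying_map X k x \<sigma> \<otimes>\<^bsub>lev X (sdim \<sigma>)\<^esub> classifying_map X k y \<sigma>"
  have "?f (sface i \<sigma>) = fc X (sdim \<sigma>) i (?f \<sigma>)"
    if "\<sigma> \<in> simplices \<infinity> k" "i \<le> sdim \<sigma>" "sdim \<sigma> \<ge> 1" for \<sigma> i
  proof -
    obtain d where d: "sdim \<sigma> = Suc d"
      using \<open>sdim \<sigma> \<ge> 1\<close> by (auto simp: Suc_le_eq gr0_conv_Suc)
    show ?thesis
      using that d classifying_map_in[OF x that(1)] classifying_map_in[OF y that(1)]
      by (simp add: sface_simplex classifying_map_sface[OF x] classifying_map_sface[OF y])
  qed
  moreover have "?f (sdegen i \<sigma>) = dg X (sdim \<sigma>) i (?f \<sigma>)"
    if "\<sigma> \<in> simplices \<infinity> k" "i \<le> sdim \<sigma>" for \<sigma> i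
    using that classifying_map_in[OF x that(1)] classifying_map_in[OF y that(1)]
    by (simp add: sdegen_simplex classifying_map_sdegen[OF x] classifying_map_sdegen[OF y])
  ultimately have "?f \<in> simplex_maps \<infinity> X k"
    using classifying_map_in x y by (auto simp: simplex_maps_def)
  moreover have "?f [0..<Suc k] = x \<otimes>\<^bsub>lev X k\<^esub> y"
    using x y by (simp add: upt_simplex classifying_map_id del: upt_Suc)
  ultimately have "classifying_map X k (x \<otimes>\<^bsub>lev X k\<^esub> y) = ?f"
    by (rule classifying_map_eqI)
  then show ?thesis
    using assms simplices_infinity by auto
qed

lemma classifying_map_hom:
  "\<sigma> \<in> simplices m k \<Longrightarrow> (\<lambda>x. classifying_map X k x \<sigma>) \<in> hom (lev X k) (lev X (sdim \<sigma>))"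
  by (intro homI classifying_map_in classifying_map_mult)

lemma classifying_map_one:
  "\<sigma> \<in> simplices m k \<Longrightarrow> classifying_map X k \<one>\<^bsub>lev X k\<^esub> \<sigma> = \<one>\<^bsub>lev X (sdim \<sigma>)\<^esub>"
  using hom_one[OF classifying_map_hom] by simp

lemma classifying_map_inv:
  "\<sigma> \<in> simplices m k \<Longrightarrow> x \<in> elts X k \<Longrightarrow>
    classifying_map X k (inv\<^bsub>lev X k\<^esub> x) \<sigma> = inv\<^bsub>lev X (sdim \<sigma>)\<^esub> classifying_map X k x \<sigma>"
  using group_hom.hom_inv[of "lev X k" "lev X (sdim \<sigma>)" "\<lambda>x. classifying_map X k x \<sigma>" x]
    classifying_map_hom[of \<sigma> m k]
  by (simp add: group_hom_def group_hom_axioms_def)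

lemma classifying_map_fc:
  assumes "x \<in> elts X (Suc k)" "i \<le> Suc k" "\<sigma> \<in> simplices m k"
  shows "classifying_map X k (fc X (Suc k) i x) \<sigma> = classifying_map X (Suc k) x (map (coface i) \<sigma>)"
proof -
  have "classifying_map X (Suc k) x (map (coface i) [0..<Suc k]) = fc X (Suc k) i x"
    using assms classifying_map_sface[OF assms(1) upt_simplex, of \<infinity> i]
    by (simp add: map_coface_upt classifying_map_id del: upt_Suc)
  then have "classifying_map X k (fc X (Suc k) i x) =
      (\<lambda>\<tau>\<in>simplices \<infinity> k. classifying_map X (Suc k) x (map (coface i) \<tau>))"
    using assms by (intro classifying_map_eqI simplex_maps_coface classifying_map)
      (auto simp: upt_simplex simp del: upt_Suc)
  then show ?thesis
    using assms simplices_infinity by auto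
qed

lemma classifying_map_dg:
  assumes "x \<in> elts X k" "i \<le> k" "\<sigma> \<in> simplices m (Suc k)"
  shows "classifying_map X (Suc k) (dg X k i x) \<sigma> = classifying_map X k x (map (codegen i) \<sigma>)"
proof -
  have "classifying_map X k x (map (codegen i) [0..<Suc (Suc k)]) = dg X k i x"
    using assms classifying_map_sdegen[OF assms(1) upt_simplex, of \<infinity> i]
    by (simp add: map_codegen_upt classifying_map_id del: upt_Suc)
  then have "classifying_map X (Suc k) (dg X k i x) =
      (\<lambda>\<tau>\<in>simplices \<infinity> (Suc k). classifying_map X k x (map (codegen i) \<tau>))"
    using assms by (intro classifying_map_eqI simplex_maps_codegen classifying_map)
      (auto simp: upt_simplex simp del: upt_Suc)
  then show ?thesis
    using assms simplices_infinity by auto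
qed

lemma classifying_map_natural:
  assumes "sgroup Y" "f \<in> simplicial_hom X Y" "x \<in> elts X k" "\<sigma> \<in> simplices m k"
  shows "classifying_map Y k (f k x) \<sigma> = f (sdim \<sigma>) (classifying_map X k x \<sigma>)"
proof -
  interpret Y: sgroup Y by fact
  let ?g = "\<lambda>\<sigma>\<in>simplices \<infinity> k. f (sdim \<sigma>) (classifying_map X k x \<sigma>)"
  note closed = simplicial_hom_closed[OF assms(2)]
  have "?g (sface i \<sigma>) = fc Y (sdim \<sigma>) i (?g \<sigma>)"
    if "\<sigma> \<in> simplices \<infinity> k" "i \<le> sdim \<sigma>" "sdim \<sigma> \<ge> 1" for \<sigma> i
  proof -
    obtain d where d: "sdim \<sigma> = Suc d"
      using \<open>sdim \<sigma> \<ge> 1\<close> by (auto simp: Suc_le_eq gr0_conv_Suc)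
    show ?thesis
      using that d classifying_map_in[OF assms(3) that(1)] simplicial_hom_fc[OF assms(2)]
      by (simp add: sface_simplex classifying_map_sface[OF assms(3)])
  qed
  moreover have "?g (sdegen i \<sigma>) = dg Y (sdim \<sigma>) i (?g \<sigma>)"
    if "\<sigma> \<in> simplices \<infinity> k" "i \<le> sdim \<sigma>" for \<sigma> i
    using that classifying_map_in[OF assms(3) that(1)] simplicial_hom_dg[OF assms(2)]
    by (simp add: sdegen_simplex classifying_map_sdegen[OF assms(3)])
  ultimately have "?g \<in> simplex_maps \<infinity> Y k"
    using classifying_map_in[OF assms(3)] closed by (auto simp: simplex_maps_def)
  moreover have "?g [0..<Suc k] = f k x"
    using assms by (simp add: upt_simplex classifying_map_id del: upt_Suc)
  ultimately have "classifying_map Y k (f k x) = ?g"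
    by (rule Y.classifying_map_eqI)
  then show ?thesis
    using assms simplices_infinity by auto
qed

end

section \<open>Simplicial subgroups, images and quotients\<close>

definition sub_sgrp :: "'a sgrp \<Rightarrow> (nat \<Rightarrow> 'a set) \<Rightarrow> 'a sgrp" where
  "sub_sgrp X P = X\<lparr>lev := \<lambda>k. (lev X k)\<lparr>carrier := P k\<rparr>\<rparr>"

lemma sub_sgrp_simps [simp]:
  "lev (sub_sgrp X P) k = (lev X k)\<lparr>carrier := P k\<rparr>"
  "fc (sub_sgrp X P) = fc X" "dg (sub_sgrp X P) = dg X"
  by (simp_all add: sub_sgrp_def)

lemma simplicial_groupI:
  assumes "\<And>k. group (lev X k)"
    and "\<And>k i. i \<le> Suc k \<Longrightarrow> fc X (Suc k) i \<in> hom (lev X (Suc k)) (lev X k)"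
    and "\<And>k i. i \<le> k \<Longrightarrow> dg X k i \<in> hom (lev X k) (lev X (Suc k))"
    and "\<And>k i j x. x \<in> elts X (Suc (Suc k)) \<Longrightarrow> i < j \<Longrightarrow> j \<le> Suc (Suc k) \<Longrightarrow>
      fc X (Suc k) i (fc X (Suc (Suc k)) j x) = fc X (Suc k) (j - 1) (fc X (Suc (Suc k)) i x)"
    and "\<And>k i j x. x \<in> elts X (Suc k) \<Longrightarrow> i < j \<Longrightarrow> j \<le> Suc k \<Longrightarrow>
      fc X (Suc (Suc k)) i (dg X (Suc k) j x) = dg X k (j - 1) (fc X (Suc k) i x)"
    and "\<And>k j x. x \<in> elts X k \<Longrightarrow> j \<le> k \<Longrightarrow> fc X (Suc k) j (dg X k j x) = x"
    and "\<And>k j x. x \<in> elts X k \<Longrightarrow> j \<le> k \<Longrightarrow> fc X (Suc k) (Suc j) (dg X k j x) = x"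
    and "\<And>k i j x. x \<in> elts X (Suc k) \<Longrightarrow> Suc j < i \<Longrightarrow> i \<le> Suc (Suc k) \<Longrightarrow>
      fc X (Suc (Suc k)) i (dg X (Suc k) j x) = dg X k j (fc X (Suc k) (i - 1) x)"
    and "\<And>k i j x. x \<in> elts X k \<Longrightarrow> i \<le> j \<Longrightarrow> j \<le> k \<Longrightarrow>
      dg X (Suc k) i (dg X k j x) = dg X (Suc k) (Suc j) (dg X k i x)"
  shows "simplicial_group X"
  unfolding simplicial_group_def Suc_eq_plus1[symmetric] add_2_eq_Suc'
proof (intro conjI allI ballI impI, goal_cases)
  case (4 k i j x) then show ?case using assms(4)[of x k i j] by simp
next
  case (5 k i j x) then show ?case using assms(5)[of x k i j] by simp
next
  case (6 k j x) then show ?case using assms(6)[of x k j] by simp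
next
  case (7 k j x) then show ?case using assms(7)[of x k j] by simp
next
  case (8 k i j x) then show ?case using assms(8)[of x k j i] by simp
next
  case (9 k i j x) then show ?case using assms(9)[of x k i j] by simp
qed (fact assms(1), rule assms(2), assumption, rule assms(3), assumption)

locale simplicial_subgroup = sgroup X for X :: "'a sgrp" +
  fixes P :: "nat \<Rightarrow> 'a set"
  assumes subgroup: "subgroup (P k) (lev X k)"
    and fc_sub: "i \<le> Suc k \<Longrightarrow> x \<in> P (Suc k) \<Longrightarrow> fc X (Suc k) i x \<in> P k"
    and dg_sub: "i \<le> k \<Longrightarrow> x \<in> P k \<Longrightarrow> dg X k i x \<in> P (Suc k)"
begin

lemma sub_closed: "x \<in> P k \<Longrightarrow> x \<in> elts X k"
  by (rule subgroup.mem_carrier[OF subgroup])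

lemma sgroup_sub_sgrp: "sgroup (sub_sgrp X P)"
proof
  show "simplicial_group (sub_sgrp X P)"
    by (rule simplicial_groupI)
      (simp_all add: hom_def Pi_iff grp.subgroup_imp_group[OF subgroup] sub_closed fc_sub dg_sub
        fc_fc fc_dg_below fc_dg_above dg_dg)
qed

end

text \<open>The axioms descend along the surjections \<open>u\<close>; not even the group laws of R
  are assumed. Both models of a quotient, by cosets and by representatives, are obtained this
  way.\<close>

lemma simplicial_group_image:
  assumes "sgroup X" and surj: "\<And>k. u k ` elts X k = elts R k"
    and mult: "\<And>k x y. x \<in> elts X k \<Longrightarrow> y \<in> elts X k \<Longrightarrow>
      u k (x \<otimes>\<^bsub>lev X k\<^esub> y) = u k x \<otimes>\<^bsub>lev R k\<^esub> u k y"
    and one: "\<And>k. u k \<one>\<^bsub>lev X k\<^esub> = \<one>\<^bsub>lev R k\<^esub>"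
    and fc: "\<And>k i x. i \<le> Suc k \<Longrightarrow> x \<in> elts X (Suc k) \<Longrightarrow>
      fc R (Suc k) i (u (Suc k) x) = u k (fc X (Suc k) i x)"
    and dg: "\<And>k i x. i \<le> k \<Longrightarrow> x \<in> elts X k \<Longrightarrow> dg R k i (u k x) = u (Suc k) (dg X k i x)"
  shows "simplicial_group R"
proof -
  interpret sgroup X by fact
  note mult [symmetric, simp] one [symmetric, simp] fc [simp] dg [simp]
  have "group (lev R k)" for k
  proof (rule groupI)
    show "\<exists>y\<in>elts R k. y \<otimes>\<^bsub>lev R k\<^esub> x = \<one>\<^bsub>lev R k\<^esub>" if "x \<in> elts R k" for x
    proof -
      obtain x' where "x' \<in> elts X k" "x = u k x'"
        using \<open>x \<in> elts R k\<close> unfolding surj[symmetric] by blast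
      then show ?thesis
        by (intro bexI[of _ "u k (inv\<^bsub>lev X k\<^esub> x')"]) (auto simp flip: surj)
    qed
  qed (auto simp: grp.m_assoc simp flip: surj)
  then show ?thesis
    by (rule simplicial_groupI)
      (auto simp: hom_def fc_fc fc_dg_below fc_dg_above dg_dg simp flip: surj)
qed

lemma simplicial_isoI:
  assumes X: "simplicial_group X" and Y: "simplicial_group Y" and f: "f \<in> simplicial_hom X Y"
    and bij: "\<And>k. bij_betw (f k) (elts X k) (elts Y k)"
  shows "simplicial_iso X Y f"
proof -
  interpret X: sgroup X by standard fact
  interpret Y: sgroup Y by standard fact
  define g where "g k = (\<lambda>y\<in>elts Y k. inv_into (elts X k) (f k) y)" for k
  have gf: "g k (f k x) = x" if "x \<in> elts X k" for k x
    using bij[of k] that simplicial_hom_closed[OF f] by (auto simp: g_def bij_betw_def)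
  have fg: "f k (g k y) = y" and g_closed: "g k y \<in> elts X k" if "y \<in> elts Y k" for k y
    using bij[of k] that by (auto simp: g_def bij_betw_def f_inv_into_f inv_into_into)
  have eqI: "x = x'" if "f k x = f k x'" "x \<in> elts X k" "x' \<in> elts X k" for k x x'
    using gf that by metis
  have "g \<in> simplicial_hom Y X"
    unfolding simplicial_hom_def
  proof (intro CollectI conjI allI ballI impI IntI homI)
    fix k x y assume *: "x \<in> elts Y k" "y \<in> elts Y k"
    show "g k (x \<otimes>\<^bsub>lev Y k\<^esub> y) = g k x \<otimes>\<^bsub>lev X k\<^esub> g k y"
      using * hom_mult[OF simplicial_hom_hom[OF f, of k]]
      by (intro eqI[of k]) (simp_all add: fg g_closed)
  next
    fix k i y assume *: "y \<in> elts Y (Suc k)" "i \<le> Suc k"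
    show "g k (fc Y (Suc k) i y) = fc X (Suc k) i (g (Suc k) y)"
      using * by (intro eqI[of k]) (simp_all add: fg g_closed simplicial_hom_fc[OF f])
  next
    fix k i y assume *: "y \<in> elts Y k" "i \<le> k"
    show "g (Suc k) (dg Y k i y) = dg X k i (g k y)"
      using * by (intro eqI[of "Suc k"]) (simp_all add: fg g_closed simplicial_hom_dg[OF f])
  next
    show "g k y \<in> elts X k" if "y \<in> elts Y k" for k y
      using that by (rule g_closed)
  qed (simp add: g_def)
  moreover have "simplicial_comp X g f = simplicial_id X" "simplicial_comp Y f g = simplicial_id Y"
    by (auto simp: simplicial_comp_def simplicial_id_def compose_def fun_eq_iff gf fg restrict_def)
  ultimately show ?thesis
    using f by (auto simp: simplicial_iso_def)
qed

section \<open>Cosets and objectwise quotients\<close>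

lemma (in group) mult_inv_eq_one_iff:
  "x \<in> carrier G \<Longrightarrow> y \<in> carrier G \<Longrightarrow> x \<otimes> inv y = \<one> \<longleftrightarrow> x = y"
  using inv_equality[of x "inv y"] by auto

lemma (in normal) coset_eq_iff:
  assumes "x \<in> carrier G" "y \<in> carrier G"
  shows "H #> x = H #> y \<longleftrightarrow> x \<otimes> inv y \<in> H"
proof
  assume "H #> x = H #> y"
  then have "H #> (x \<otimes> inv y) = H"
    using assms subset coset_mult_inv2 by blast
  then show "x \<otimes> inv y \<in> H"
    using assms coset_join1[OF _ _ is_subgroup] by simp
next
  assume "x \<otimes> inv y \<in> H"
  then have "H #> (x \<otimes> inv y) = H"
    using assms coset_join2[OF _ is_subgroup] by simp
  then show "H #> x = H #> y"
    using assms subset coset_mult_inv1 by blast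
qed

text \<open>\<open>coset_map\<close> takes a union over all representatives; the union collapses
  because each of them yields the same coset.\<close>

lemma coset_map_coset:
  assumes M: "M \<lhd> G" and N: "N \<lhd> H" and P: "subgroup P G" "M \<subseteq> P"
    and f: "f \<in> hom (G\<lparr>carrier := P\<rparr>) H" "f ` M \<subseteq> N" and x: "x \<in> P"
  shows "coset_map H N f (M #>\<^bsub>G\<^esub> x) = N #>\<^bsub>H\<^esub> f x"
proof -
  interpret M: normal M G by fact
  interpret N: normal N H by fact
  interpret P: subgroup P G by fact
  have x': "x \<in> carrier G" "f x \<in> carrier H"
    using x f by (auto simp: hom_def)
  have "N #>\<^bsub>H\<^esub> f y = N #>\<^bsub>H\<^esub> f x" if y: "y \<in> M #>\<^bsub>G\<^esub> x" for y
  proof -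
    obtain m where m: "m \<in> M" "y = m \<otimes>\<^bsub>G\<^esub> x"
      using y by (auto simp: r_coset_def)
    then have "f y = f m \<otimes>\<^bsub>H\<^esub> f x" "f m \<in> N"
      using f x P by (auto simp: hom_def)
    then have "f y \<in> N #>\<^bsub>H\<^esub> f x"
      by (auto simp: r_coset_def)
    then show ?thesis
      using N.repr_independence x' N.is_subgroup by metis
  qed
  moreover have "x \<in> M #>\<^bsub>G\<^esub> x"
    using x' by (intro M.rcos_self[OF _ M.is_subgroup])
  ultimately show ?thesis
    unfolding coset_map_def by blast
qed

lemma set_mult_carrier_update [simp]: "set_mult (G\<lparr>carrier := P\<rparr>) = set_mult G"
  by (auto simp: set_mult_def fun_eq_iff)

lemma r_coset_carrier_update [simp]: "r_coset (G\<lparr>carrier := P\<rparr>) = r_coset G"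
  by (auto simp: r_coset_def fun_eq_iff)

text \<open>\<open>Q\<close> is normal in all of X, as kernels are, so the coset calculus of the
  ambient level groups is available although \<open>P\<close> may be smaller.\<close>

locale sgroup_quotient = simplicial_subgroup X P for X :: "'a sgrp" and P +
  fixes Q :: "nat \<Rightarrow> 'a set"
  assumes normal: "Q k \<lhd> lev X k" and Q_le_P: "Q k \<subseteq> P k"
    and fc_quot: "i \<le> Suc k \<Longrightarrow> x \<in> Q (Suc k) \<Longrightarrow> fc X (Suc k) i x \<in> Q k"
    and dg_quot: "i \<le> k \<Longrightarrow> x \<in> Q k \<Longrightarrow> dg X k i x \<in> Q (Suc k)"
begin

abbreviation coset :: "nat \<Rightarrow> 'a \<Rightarrow> 'a set" where
  "coset k x \<equiv> Q k #>\<^bsub>lev X k\<^esub> x"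

lemma quot_simps [simp]:
  "elts (quot_sgrp X P Q) k = coset k ` P k"
  "\<one>\<^bsub>lev (quot_sgrp X P Q) k\<^esub> = Q k"
  "x \<in> P k \<Longrightarrow> y \<in> P k \<Longrightarrow>
    coset k x \<otimes>\<^bsub>lev (quot_sgrp X P Q) k\<^esub> coset k y = coset k (x \<otimes>\<^bsub>lev X k\<^esub> y)"
  by (simp_all add: quot_sgrp_def carrier_FactGroup normal.rcos_sum[OF normal] sub_closed)

lemma quot_fc [simp]:
  "i \<le> Suc k \<Longrightarrow> x \<in> P (Suc k) \<Longrightarrow>
    fc (quot_sgrp X P Q) (Suc k) i (coset (Suc k) x) = coset k (fc X (Suc k) i x)"
  unfolding quot_sgrp_def
  by (simp, rule coset_map_coset[OF normal normal subgroup Q_le_P])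
    (auto simp: hom_def fc_quot sub_closed)

lemma quot_dg [simp]:
  "i \<le> k \<Longrightarrow> x \<in> P k \<Longrightarrow>
    dg (quot_sgrp X P Q) k i (coset k x) = coset (Suc k) (dg X k i x)"
  unfolding quot_sgrp_def
  by (simp, rule coset_map_coset[OF normal normal subgroup Q_le_P])
    (auto simp: hom_def dg_quot sub_closed)

lemma simplicial_group_quot: "simplicial_group (quot_sgrp X P Q)"
proof (rule simplicial_group_image[of "sub_sgrp X P" coset])
  show "sgroup (sub_sgrp X P)"
    by (rule sgroup_sub_sgrp)
  show "coset k \<one>\<^bsub>lev (sub_sgrp X P) k\<^esub> = \<one>\<^bsub>lev (quot_sgrp X P Q) k\<^esub>" for k
    by (simp add: grp.coset_mult_one normal.axioms(1)[OF normal] subgroup.subset normal_imp_subgroup normal)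
qed auto

lemma coset_eq_iff:
  "x \<in> elts X k \<Longrightarrow> y \<in> elts X k \<Longrightarrow> coset k x = coset k y \<longleftrightarrow> x \<otimes>\<^bsub>lev X k\<^esub> inv\<^bsub>lev X k\<^esub> y \<in> Q k"
  by (rule normal.coset_eq_iff[OF normal])

text \<open>The first isomorphism theorem in each degree. The value of \<eta> on cosets is exported
  because naturality is checked there.\<close>

lemma quot_iso:
  assumes Y: "simplicial_group Y"
    and hom: "\<And>k. \<phi> k \<in> hom ((lev X k)\<lparr>carrier := P k\<rparr>) (lev Y k)"
    and fc: "\<And>k i x. i \<le> Suc k \<Longrightarrow> x \<in> P (Suc k) \<Longrightarrow>
      \<phi> k (fc X (Suc k) i x) = fc Y (Suc k) i (\<phi> (Suc k) x)"
    and dg: "\<And>k i x. i \<le> k \<Longrightarrow> x \<in> P k \<Longrightarrow> \<phi> (Suc k) (dg X k i x) = dg Y k i (\<phi> k x)"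
    and surj: "\<And>k. elts Y k \<subseteq> \<phi> k ` P k"
    and kernel: "\<And>k x. x \<in> P k \<Longrightarrow> \<phi> k x = \<one>\<^bsub>lev Y k\<^esub> \<longleftrightarrow> x \<in> Q k"
  obtains \<eta> where "simplicial_iso (quot_sgrp X P Q) Y \<eta>" "\<And>k x. x \<in> P k \<Longrightarrow> \<eta> k (coset k x) = \<phi> k x"
proof
  interpret Y: sgroup Y by standard fact
  define \<eta> where "\<eta> k = (\<lambda>C\<in>coset k ` P k. \<phi> k (SOME x. x \<in> P k \<and> C = coset k x))" for k
  have closed: "\<phi> k x \<in> elts Y k" if "x \<in> P k" for k x
    using hom[of k] that by (auto simp: hom_def)
  have eq_iff: "\<phi> k x = \<phi> k y \<longleftrightarrow> coset k x = coset k y" if "x \<in> P k" "y \<in> P k" for k x y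
  proof -
    interpret P: group "(lev X k)\<lparr>carrier := P k\<rparr>"
      by (rule grp.subgroup_imp_group[OF subgroup])
    interpret \<phi>: group_hom "(lev X k)\<lparr>carrier := P k\<rparr>" "lev Y k" "\<phi> k"
      using hom by unfold_locales
    have inv: "inv\<^bsub>(lev X k)\<lparr>carrier := P k\<rparr>\<^esub> y = inv\<^bsub>lev X k\<^esub> y"
      using that subgroup by (simp add: grp.m_inv_consistent)
    then have closed': "inv\<^bsub>lev X k\<^esub> y \<in> P k"
      using P.inv_closed that by fastforce
    have "\<phi> k x = \<phi> k y \<longleftrightarrow> \<phi> k x \<otimes>\<^bsub>lev Y k\<^esub> inv\<^bsub>lev Y k\<^esub> \<phi> k y = \<one>\<^bsub>lev Y k\<^esub>"
      using closed that by (simp add: Y.grp.mult_inv_eq_one_iff)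
    also have "\<phi> k x \<otimes>\<^bsub>lev Y k\<^esub> inv\<^bsub>lev Y k\<^esub> \<phi> k y = \<phi> k (x \<otimes>\<^bsub>lev X k\<^esub> inv\<^bsub>lev X k\<^esub> y)"
      using \<phi>.hom_mult[of x "inv\<^bsub>lev X k\<^esub> y"] \<phi>.hom_inv[of y] that inv closed' by simp
    also have "\<dots> = \<one>\<^bsub>lev Y k\<^esub> \<longleftrightarrow> x \<otimes>\<^bsub>lev X k\<^esub> inv\<^bsub>lev X k\<^esub> y \<in> Q k"
      using that closed' subgroup.m_closed[OF subgroup] by (intro kernel) auto
    finally show ?thesis
      using coset_eq_iff that sub_closed by simp
  qed
  show \<eta>: "\<eta> k (coset k x) = \<phi> k x" if "x \<in> P k" for k x
  proof -
    have "(SOME y. y \<in> P k \<and> coset k x = coset k y) \<in> P k \<and>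
        coset k x = coset k (SOME y. y \<in> P k \<and> coset k x = coset k y)"
      by (rule someI[of _ x]) (simp add: that)
    then show ?thesis
      using that eq_iff by (auto simp: \<eta>_def)
  qed
  show "simplicial_iso (quot_sgrp X P Q) Y \<eta>"
  proof (rule simplicial_isoI[OF simplicial_group_quot Y])
    show "\<eta> \<in> simplicial_hom (quot_sgrp X P Q) Y"
    proof -
      have "\<phi> k (x \<otimes>\<^bsub>lev X k\<^esub> y) = \<phi> k x \<otimes>\<^bsub>lev Y k\<^esub> \<phi> k y" if "x \<in> P k" "y \<in> P k" for k x y
        using hom[of k] that by (simp add: hom_def)
      moreover have "\<eta> k \<in> extensional (coset k ` P k)" for k
        by (simp add: \<eta>_def)
      ultimately show ?thesis
        unfolding simplicial_hom_def using subgroup.m_closed[OF subgroup]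
        by (auto simp: hom_def \<eta> closed fc dg fc_sub dg_sub)
    qed
    show "bij_betw (\<eta> k) (elts (quot_sgrp X P Q) k) (elts Y k)" for k
      using surj[of k] closed[of _ k]
      by (force simp: bij_betw_def inj_on_def \<eta> eq_iff image_image)
  qed
qed

end

section \<open>Cycles and boundaries\<close>

text \<open>Additively this is a_j - a_(j-1) + a_(j-2) - ... In a nonabelian level the order of the
  factors matters: it is the one produced by the successive corrections in
  \<open>last_face_mod_boundaries\<close>.\<close>

fun alt_prod :: "('b, 'c) monoid_scheme \<Rightarrow> (nat \<Rightarrow> 'b) \<Rightarrow> nat \<Rightarrow> 'b" where
  "alt_prod G a 0 = a 0"
| "alt_prod G a (Suc j) = a (Suc j) \<otimes>\<^bsub>G\<^esub> inv\<^bsub>G\<^esub> alt_prod G a j"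

lemma (in group) alt_prod_in_subgroup:
  assumes "subgroup H G" "\<And>i. i \<le> j \<Longrightarrow> a i \<in> H"
  shows "alt_prod G a j \<in> H"
  using assms(2)
  by (induction j) (auto intro: subgroup.m_closed[OF assms(1)] subgroup.m_inv_closed[OF assms(1)])

lemma alt_prod_cong: "(\<And>i. i \<le> j \<Longrightarrow> a i = b i) \<Longrightarrow> alt_prod G a j = alt_prod G b j"
  by (induction j) auto

context sgroup
begin

lemma moore_Suc:
  "x \<in> moore X (Suc k) \<longleftrightarrow> x \<in> elts X (Suc k) \<and> (\<forall>i\<le>k. fc X (Suc k) i x = \<one>\<^bsub>lev X k\<^esub>)"
  by (auto simp: moore_def less_Suc_eq_le)

lemma cycles_0: "cycles X 0 = elts X 0"
  by (simp add: cycles_def moore_def)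

lemma cycles_Suc:
  "x \<in> cycles X (Suc k) \<longleftrightarrow> x \<in> elts X (Suc k) \<and> (\<forall>i\<le>Suc k. fc X (Suc k) i x = \<one>\<^bsub>lev X k\<^esub>)"
  by (auto simp: cycles_def moore_Suc elim: le_SucE)

lemma cycles_closed: "x \<in> cycles X n \<Longrightarrow> x \<in> elts X n"
  by (simp add: cycles_def moore_def)

lemma cycles_subgroup: "subgroup (cycles X n) (lev X n)"
proof (cases n)
  case 0
  then show ?thesis by (simp add: cycles_0 grp.subgroup_self)
next
  case (Suc k)
  then show ?thesis
    by (intro subgroup.intro) (auto simp: cycles_Suc)
qed

lemma boundaries_le_cycles: "boundaries X n \<subseteq> cycles X n"
proof
  fix b assume "b \<in> boundaries X n"
  then obtain z where z: "z \<in> moore X (Suc n)" "b = fc X (Suc n) (Suc n) z"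
    by (auto simp: boundaries_def)
  show "b \<in> cycles X n"
  proof (cases n)
    case 0
    then show ?thesis
      using z by (simp add: cycles_0 moore_Suc)
  next
    case (Suc k)
    have "fc X (Suc k) i b = \<one>\<^bsub>lev X k\<^esub>" if "i \<le> Suc k" for i
      using z that Suc fc_fc[of z k i "Suc (Suc k)"] by (simp add: moore_Suc)
    then show ?thesis
      using z Suc by (simp add: cycles_Suc moore_Suc)
  qed
qed

lemma boundaries_normal: "boundaries X n \<lhd> lev X n"
  unfolding grp.normal_inv_iff
proof (intro conjI ballI)
  have "subgroup (moore X (Suc n)) (lev X (Suc n))"
    by (intro subgroup.intro) (auto simp: moore_Suc)
  then show "subgroup (boundaries X n) (lev X n)"
    unfolding boundaries_def
    using group_hom.subgroup_img_is_subgroup[of "lev X (Suc n)" "lev X n" "fc X (Suc n) (Suc n)"]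
      fc_hom by (simp add: group_hom_def group_hom_axioms_def)
next
  fix g b assume g: "g \<in> elts X n" and "b \<in> boundaries X n"
  then obtain z where z: "z \<in> moore X (Suc n)" "b = fc X (Suc n) (Suc n) z"
    by (auto simp: boundaries_def)
  \<comment> \<open>The element s_n g has last face g, and conjugation by it keeps the other faces
    of \<open>z\<close> trivial.\<close>
  let ?z = "dg X n n g \<otimes>\<^bsub>lev X (Suc n)\<^esub> z \<otimes>\<^bsub>lev X (Suc n)\<^esub> inv\<^bsub>lev X (Suc n)\<^esub> dg X n n g"
  have "?z \<in> moore X (Suc n)"
    using z g by (simp add: moore_Suc)
  moreover have "fc X (Suc n) (Suc n) ?z = g \<otimes>\<^bsub>lev X n\<^esub> b \<otimes>\<^bsub>lev X n\<^esub> inv\<^bsub>lev X n\<^esub> g"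
    using z g by (simp add: moore_Suc)
  ultimately show "g \<otimes>\<^bsub>lev X n\<^esub> b \<otimes>\<^bsub>lev X n\<^esub> inv\<^bsub>lev X n\<^esub> g \<in> boundaries X n"
    unfolding boundaries_def by (metis imageI)
qed

lemma boundaries_subgroup: "subgroup (boundaries X n) (lev X n)"
  using boundaries_normal normal_imp_subgroup by blast

text \<open>Away from j and j + 1 the face passes through the degeneracy and meets the cycle, whose
  faces are trivial.\<close>

lemma fc_dg_cycle:
  assumes "x \<in> cycles X n" "j \<le> n" "i \<le> Suc n" "i \<noteq> j" "i \<noteq> Suc j"
  shows "fc X (Suc n) i (dg X n j x) = \<one>\<^bsub>lev X n\<^esub>"
proof (cases n)
  case (Suc k)
  show ?thesis
  proof (cases "i < j")
    case True
    then show ?thesis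
      using assms Suc fc_dg_below[of x k i j] by (simp add: cycles_Suc)
  next
    case False
    then show ?thesis
      using assms Suc fc_dg_above[of x k j i] by (simp add: cycles_Suc)
  qed
qed (use assms in auto)

text \<open>Multiply \<open>x\<close> successively by elements \<open>s\<^sub>j(p)\<^sup>-\<^sup>1\<close> to make its faces trivial
  one after the other.\<close>

lemma last_face_mod_boundaries:
  assumes x: "x \<in> elts X (Suc n)" and "\<And>i. i \<le> n \<Longrightarrow> fc X (Suc n) i x \<in> cycles X n"
  shows "fc X (Suc n) (Suc n) x \<otimes>\<^bsub>lev X n\<^esub>
    inv\<^bsub>lev X n\<^esub> alt_prod (lev X n) (\<lambda>i. fc X (Suc n) i x) n \<in> boundaries X n"
proof -
  let ?p = "alt_prod (lev X n) (\<lambda>i. fc X (Suc n) i x)"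
  have cyc: "?p j \<in> cycles X n" if "j \<le> n" for j
    using assms(2) that by (intro grp.alt_prod_in_subgroup cycles_subgroup) auto
  have "\<exists>w\<in>elts X (Suc n). (\<forall>i<j. fc X (Suc n) i w = \<one>\<^bsub>lev X n\<^esub>) \<and>
      fc X (Suc n) j w = ?p j \<and> (\<forall>i\<le>Suc n. j < i \<longrightarrow> fc X (Suc n) i w = fc X (Suc n) i x)"
    if "j \<le> Suc n" for j
    using that
  proof (induction j)
    case 0
    show ?case using x by (intro bexI[of _ x]) auto
  next
    case (Suc j)
    then obtain w where w: "w \<in> elts X (Suc n)" "\<forall>i<j. fc X (Suc n) i w = \<one>\<^bsub>lev X n\<^esub>"
      "fc X (Suc n) j w = ?p j" "\<forall>i\<le>Suc n. j < i \<longrightarrow> fc X (Suc n) i w = fc X (Suc n) i x"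
      by auto
    have p: "?p j \<in> cycles X n" "?p j \<in> elts X n"
      using cyc[of j] cycles_closed Suc.prems by auto
    \<comment> \<open>Faces j and j + 1 of s_j(p_j) are both p_j. So the new factor kills face j and
      turns face j + 1 into d_(j+1) x times the inverse of p_j, which is p_(j+1). The other faces
      are unaffected because p_j is a cycle.\<close>
    let ?w = "w \<otimes>\<^bsub>lev X (Suc n)\<^esub> inv\<^bsub>lev X (Suc n)\<^esub> dg X n j (?p j)"
    have "fc X (Suc n) i ?w = \<one>\<^bsub>lev X n\<^esub>" if "i < Suc j" for i
    proof (cases "i = j")
      case False
      then show ?thesis
        using w p that Suc.prems by (simp add: fc_dg_cycle)
    qed (use w p Suc.prems in simp)
    moreover have "fc X (Suc n) (Suc j) ?w = ?p (Suc j)"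
      using w p Suc.prems by simp
    moreover have "fc X (Suc n) i ?w = fc X (Suc n) i x" if "i \<le> Suc n" "Suc j < i" for i
      using w p that x Suc.prems by (simp add: fc_dg_cycle)
    ultimately show ?case
      using w p Suc.prems by (intro bexI[of _ ?w]) auto
  qed
  from this[of "Suc n"] obtain w where "w \<in> moore X (Suc n)" "fc X (Suc n) (Suc n) w = ?p (Suc n)"
    by (auto simp: moore_Suc less_Suc_eq_le)
  then show ?thesis
    unfolding boundaries_def by (metis alt_prod.simps(2) imageI)
qed

text \<open>At every face but the last, \<open>u\<close> or \<open>v\<close> is trivial, so their
  commutator lies in the Moore complex, and its last face is the commutator of \<open>x\<close> and
  \<open>y\<close>. Two different degeneracies of \<open>x\<close> are used, hence the positive
  degree. This is why \<pi>_n is abelian for n at least 1.\<close>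

lemma commutator_boundary:
  assumes x: "x \<in> cycles X (Suc m)" and y: "y \<in> cycles X (Suc m)"
  shows "x \<otimes>\<^bsub>lev X (Suc m)\<^esub> y \<otimes>\<^bsub>lev X (Suc m)\<^esub> inv\<^bsub>lev X (Suc m)\<^esub> x \<otimes>\<^bsub>lev X (Suc m)\<^esub>
    inv\<^bsub>lev X (Suc m)\<^esub> y \<in> boundaries X (Suc m)"
proof -
  let ?G = "lev X (Suc (Suc m))"
  \<comment> \<open>The factor from s_m cancels face m + 1 and leaves the last face equal to
    \<open>x\<close>.\<close>
  define u where "u = dg X (Suc m) (Suc m) x \<otimes>\<^bsub>?G\<^esub> inv\<^bsub>?G\<^esub> dg X (Suc m) m x"
  define v where "v = dg X (Suc m) (Suc m) y"
  have elts: "x \<in> elts X (Suc m)" "y \<in> elts X (Suc m)"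
    using x y cycles_closed by auto
  then have uv: "u \<in> elts X (Suc (Suc m))" "v \<in> elts X (Suc (Suc m))"
    by (auto simp: u_def v_def)
  have v_fc: "fc X (Suc (Suc m)) i v = \<one>\<^bsub>lev X (Suc m)\<^esub>" if "i \<le> m" for i
    using that by (simp add: v_def fc_dg_cycle[OF y])
  have u_fc: "fc X (Suc (Suc m)) (Suc m) u = \<one>\<^bsub>lev X (Suc m)\<^esub>"
    using elts by (simp add: u_def)
  have last: "fc X (Suc (Suc m)) (Suc (Suc m)) u = x" "fc X (Suc (Suc m)) (Suc (Suc m)) v = y"
    using elts by (auto simp: u_def v_def fc_dg_cycle[OF x])
  let ?w = "u \<otimes>\<^bsub>?G\<^esub> v \<otimes>\<^bsub>?G\<^esub> inv\<^bsub>?G\<^esub> u \<otimes>\<^bsub>?G\<^esub> inv\<^bsub>?G\<^esub> v"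
  have "?w \<in> moore X (Suc (Suc m))"
    unfolding moore_Suc
  proof (intro conjI allI impI)
    fix i assume i: "i \<le> Suc m"
    show "fc X (Suc (Suc m)) i ?w = \<one>\<^bsub>lev X (Suc m)\<^esub>"
    proof (cases "i = Suc m")
      case True
      then show ?thesis
        using u_fc uv by simp
    next
      case False
      then show ?thesis
        using v_fc[of i] uv i by simp
    qed
  qed (use uv in simp)
  then have "fc X (Suc (Suc m)) (Suc (Suc m)) ?w \<in> boundaries X (Suc m)"
    unfolding boundaries_def by (rule imageI)
  then show ?thesis
    using uv by (simp add: last)
qed

end

section \<open>The subgroups \<open>\<mu>\<close>\<close>

text \<open>Both subgroups \<open>\<mu>\<close> are of this form.\<close>

definition faces_in :: "nat \<Rightarrow> (nat \<Rightarrow> 'a set) \<Rightarrow> 'a sgrp \<Rightarrow> nat \<Rightarrow> 'a set" where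
  "faces_in m J X k = {x \<in> elts X k. \<forall>\<sigma>\<in>simplices m k. classifying_map X k x \<sigma> \<in> J (sdim \<sigma>)}"

definition mu_le_faces :: "'a sgrp \<Rightarrow> nat \<Rightarrow> nat \<Rightarrow> 'a set" where
  "mu_le_faces X n j = (if j < n then {\<one>\<^bsub>lev X j\<^esub>} else boundaries X j)"

context sgroup
begin

text \<open>Evaluation at \<sigma> is a homomorphism, so this is an intersection of preimages of
  normal subgroups.\<close>

lemma faces_in_normal:
  assumes "\<And>j. J j \<lhd> lev X j"
  shows "faces_in m J X k \<lhd> lev X k"
  unfolding grp.normal_inv_iff
proof (intro conjI ballI grp.subgroupI)
  note J = normal_imp_subgroup[OF assms]
  show "faces_in m J X k \<subseteq> elts X k"
    by (auto simp: faces_in_def)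
  show "faces_in m J X k \<noteq> {}"
  proof -
    have "\<one>\<^bsub>lev X k\<^esub> \<in> faces_in m J X k"
      by (simp add: faces_in_def classifying_map_one subgroup.one_closed[OF J])
    then show ?thesis by blast
  qed
  show "inv\<^bsub>lev X k\<^esub> x \<in> faces_in m J X k" if "x \<in> faces_in m J X k" for x
    using that subgroup.m_inv_closed[OF J] by (simp add: faces_in_def classifying_map_inv)
  show "x \<otimes>\<^bsub>lev X k\<^esub> y \<in> faces_in m J X k" if "x \<in> faces_in m J X k" "y \<in> faces_in m J X k" for x y
    using that subgroup.m_closed[OF J] by (simp add: faces_in_def classifying_map_mult)
  show "x \<otimes>\<^bsub>lev X k\<^esub> h \<otimes>\<^bsub>lev X k\<^esub> inv\<^bsub>lev X k\<^esub> x \<in> faces_in m J X k"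
    if "x \<in> elts X k" "h \<in> faces_in m J X k" for x h
    using that normal.inv_op_closed2[OF assms] classifying_map_in[of x k]
    by (simp add: faces_in_def classifying_map_mult classifying_map_inv)
qed

lemma fc_faces_in:
  "i \<le> Suc k \<Longrightarrow> x \<in> faces_in m J X (Suc k) \<Longrightarrow> fc X (Suc k) i x \<in> faces_in m J X k"
  using map_coface_simplex[of _ m k i]
  by (fastforce simp: faces_in_def classifying_map_fc)

lemma dg_faces_in:
  "i \<le> k \<Longrightarrow> x \<in> faces_in m J X k \<Longrightarrow> dg X k i x \<in> faces_in m J X (Suc k)"
  using map_codegen_simplex[of _ m k i]
  by (fastforce simp: faces_in_def classifying_map_dg)

lemma hom_faces_in:
  assumes "sgroup Y" "f \<in> simplicial_hom X Y" "\<And>j. f j ` J j \<subseteq> L j" "x \<in> faces_in m J X k"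
  shows "f k x \<in> faces_in m L Y k"
  using assms(3,4) simplicial_hom_closed[OF assms(2)] unfolding image_subset_iff
  by (auto simp: faces_in_def classifying_map_natural[OF assms(1,2)])

lemma mu_le_faces_normal: "mu_le_faces X n j \<lhd> lev X j"
  by (simp add: mu_le_faces_def grp.one_is_normal boundaries_normal)

lemma trunc_lev: "j \<le> m \<Longrightarrow> lev (trunc m X) j = lev X j"
  by (simp add: trunc_def)

text \<open>The unit restricts the classifying map to dimensions at most \<open>n - 1\<close>, so it
  is trivial on x exactly when all these values are. In these dimensions \<open>trunc\<close> leaves
  the levels unchanged.\<close>

lemma mu_ge_eq: "mu_ge n X = faces_in (n - 1) (\<lambda>j. {\<one>\<^bsub>lev X j\<^esub>}) X"
proof
  fix k
  have "restrict (classifying_map X k x) (simplices (n - 1) k) =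
      (\<lambda>\<sigma>\<in>simplices (n - 1) k. \<one>\<^bsub>lev (trunc (n - 1) X) (sdim \<sigma>)\<^esub>) \<longleftrightarrow>
      (\<forall>\<sigma>\<in>simplices (n - 1) k. classifying_map X k x \<sigma> = \<one>\<^bsub>lev X (sdim \<sigma>)\<^esub>)" for x
    using simplices_sdim[of _ "n - 1" k] by (auto simp: restrict_def fun_eq_iff trunc_lev)
  then show "mu_ge n X k = faces_in (n - 1) (\<lambda>j. {\<one>\<^bsub>lev X j\<^esub>}) X k"
    by (auto simp: mu_ge_def kernel_def cosk_def cosk_unit_def faces_in_def)
qed

text \<open>Read in the quotient, this says that the Moore complex of X modulo
  \<open>faces_in\<close> vanishes above degree n. A simplex missing a vertex up to
  \<open>k - 1\<close> or \<open>k\<close> is covered by the facets in the hypothesis; the remaining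
  candidate is the last facet, which is small enough only for \<open>k = n\<close>.\<close>

lemma mu_le_faces_quotient_moore:
  assumes "k \<ge> n" "x \<in> elts X (Suc k)"
    and faces: "\<And>i. i \<le> k \<Longrightarrow> fc X (Suc k) i x \<in> faces_in n (mu_le_faces X n) X k"
  shows "x \<in> faces_in n (mu_le_faces X n) X (Suc k)"
proof -
  have "classifying_map X (Suc k) x \<sigma> \<in> mu_le_faces X n (sdim \<sigma>)" if \<sigma>: "\<sigma> \<in> simplices n (Suc k)" for \<sigma>
  proof (cases "{..<Suc k} \<subseteq> set \<sigma>")
    case False
    then obtain i where "i < Suc k" and i: "i \<notin> set \<sigma>" by blast
    then have i: "i \<le> k" "i \<notin> set \<sigma>" by auto
    obtain \<tau> where \<tau>: "\<tau> \<in> simplices n k" "\<sigma> = map (coface i) \<tau>"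
      using missing_vertex_coface[OF \<sigma> _ i(2)] i by auto
    have "classifying_map X (Suc k) x \<sigma> = classifying_map X k (fc X (Suc k) i x) \<tau>"
      using assms(2) i \<tau> by (simp add: classifying_map_fc)
    then show ?thesis
      using faces[OF i(1)] \<tau> by (simp add: faces_in_def)
  next
    case True
    have len: "length \<sigma> \<le> Suc k"
      using length_simplex[OF \<sigma>] simplices_sdim[OF \<sigma>] assms(1) by simp
    then have id: "\<sigma> = [0..<Suc k]"
      using \<sigma> True by (intro sorted_eq_upt) (auto simp: simplices_iff)
    then have "k = n"
      using simplices_sdim[OF \<sigma>] assms(1) by (simp del: upt_Suc)
    have b: "fc X (Suc n) i x \<in> boundaries X n" if "i \<le> n" for i
    proof -
      have "fc X (Suc n) i x \<in> elts X n"
        using assms(2) that \<open>k = n\<close> by simp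
      then show ?thesis
        using faces[of i] that \<open>k = n\<close> upt_simplex[of n n] classifying_map_id
        by (force simp: faces_in_def mu_le_faces_def simp del: upt_Suc)
    qed
    \<comment> \<open>The first n + 1 faces are boundaries, hence so is their alternating product,
      and it agrees with the last face up to a boundary.\<close>
    let ?p = "alt_prod (lev X n) (\<lambda>i. fc X (Suc n) i x) n"
    have p: "?p \<in> boundaries X n"
      using b by (intro grp.alt_prod_in_subgroup boundaries_subgroup) auto
    have "fc X (Suc n) (Suc n) x \<otimes>\<^bsub>lev X n\<^esub> inv\<^bsub>lev X n\<^esub> ?p \<in> boundaries X n"
      using b boundaries_le_cycles assms(2) \<open>k = n\<close> by (intro last_face_mod_boundaries) auto
    moreover have "fc X (Suc n) (Suc n) x \<in> elts X n" "?p \<in> elts X n"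
      using assms(2) \<open>k = n\<close> p boundaries_le_cycles cycles_closed by auto
    ultimately have "fc X (Suc n) (Suc n) x \<in> boundaries X n"
      using subgroup.m_closed[OF boundaries_subgroup _ p, of "fc X (Suc n) (Suc n) x \<otimes>\<^bsub>lev X n\<^esub> inv\<^bsub>lev X n\<^esub> ?p"]
      by (simp add: grp.m_assoc)
    moreover have "classifying_map X (Suc n) x [0..<Suc n] = fc X (Suc n) (Suc n) x"
    proof -
      have "sface (Suc n) [0..<Suc (Suc n)] = [0..<Suc n]"
        by (simp add: sface_def)
      then show ?thesis
        using classifying_map_sface[of x "Suc n" "[0..<Suc (Suc n)]" \<infinity> "Suc n"] assms(2) \<open>k = n\<close>
        by (simp add: upt_simplex classifying_map_id del: upt_Suc)
    qed
    ultimately show ?thesis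
      using id \<open>k = n\<close> by (simp add: mu_le_faces_def del: upt_Suc)
  qed
  then show ?thesis
    using assms(2) by (simp add: faces_in_def)
qed

text \<open>Up to degree n the identity simplex itself is among the tested ones. Above it, the faces
  of x are trivial by induction, which puts x into a Moore complex that vanishes there.\<close>

lemma trivial_if_faces_trivial:
  assumes "\<And>i. i > n \<Longrightarrow> moore X i = {\<one>\<^bsub>lev X i\<^esub>}"
    and "x \<in> faces_in n (\<lambda>j. {\<one>\<^bsub>lev X j\<^esub>}) X k"
  shows "x = \<one>\<^bsub>lev X k\<^esub>"
  using assms(2)
proof (induction k arbitrary: x)
  case 0
  then show ?case
    using upt_simplex[of 0 n] classifying_map_id[of x 0] by (auto simp: faces_in_def sdim_def)
next
  case (Suc k)
  have x: "x \<in> elts X (Suc k)"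
    using Suc.prems by (simp add: faces_in_def)
  show ?case
  proof (cases "Suc k \<le> n")
    case True
    then show ?thesis
      using upt_simplex[of "Suc k" n] classifying_map_id[OF x] Suc.prems
      by (force simp: faces_in_def simp del: upt_Suc)
  next
    case False
    have "x \<in> moore X (Suc k)"
      using x Suc.IH fc_faces_in[OF _ Suc.prems] by (auto simp: moore_Suc)
    then show ?thesis
      using assms(1)[of "Suc k"] False by auto
  qed
qed

text \<open>A boundary is the last face of a Moore element \<open>z\<close>, and \<open>f\<close>
  sends \<open>z\<close> into the Moore complex of Y in degree n + 1, which vanishes. So all
  simplices of f x of dimension at most n are trivial.\<close>

lemma hom_kills_mu_le_faces:
  assumes Y: "sgroup Y" "\<And>i. i > n \<Longrightarrow> moore Y i = {\<one>\<^bsub>lev Y i\<^esub>}"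
    and f: "f \<in> simplicial_hom X Y" and x: "x \<in> faces_in n (mu_le_faces X n) X k"
  shows "f k x = \<one>\<^bsub>lev Y k\<^esub>"
proof -
  interpret Y: sgroup Y by fact
  note one = simplicial_hom_one[OF simplicial_group Y.simplicial_group f]
  have "f n b = \<one>\<^bsub>lev Y n\<^esub>" if "b \<in> boundaries X n" for b
  proof -
    obtain z where z: "z \<in> moore X (Suc n)" "b = fc X (Suc n) (Suc n) z"
      using \<open>b \<in> boundaries X n\<close> by (auto simp: boundaries_def)
    have "fc Y (Suc n) i (f (Suc n) z) = \<one>\<^bsub>lev Y n\<^esub>" if "i \<le> n" for i
      using z that by (simp add: moore_Suc one flip: simplicial_hom_fc[OF f])
    then have "f (Suc n) z \<in> moore Y (Suc n)"
      using z simplicial_hom_closed[OF f] by (simp add: Y.moore_Suc moore_Suc)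
    then have "f (Suc n) z = \<one>\<^bsub>lev Y (Suc n)\<^esub>"
      using Y(2)[of "Suc n"] by simp
    then show ?thesis
      using z by (simp add: simplicial_hom_fc[OF f] moore_Suc)
  qed
  then have "f k x \<in> faces_in n (\<lambda>j. {\<one>\<^bsub>lev Y j\<^esub>}) Y k"
    using x simplicial_hom_closed[OF f] simplices_sdim[of _ n k]
    by (fastforce simp: faces_in_def classifying_map_natural[OF Y(1) f] mu_le_faces_def one split: if_splits)
  from Y.trivial_if_faces_trivial[of n, OF _ this] Y(2) show ?thesis
    by simp
qed

end

section \<open>Factorisation through quotients and the universal property\<close>

lemma simplicial_hom_factor:
  assumes X: "simplicial_group X" and R: "simplicial_group R" and Y: "simplicial_group Y"
    and u: "u \<in> simplicial_hom X R" "\<And>k. u k ` elts X k = elts R k"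
    and f: "f \<in> simplicial_hom X Y"
    and ker: "\<And>k x. x \<in> elts X k \<Longrightarrow> u k x = \<one>\<^bsub>lev R k\<^esub> \<Longrightarrow> f k x = \<one>\<^bsub>lev Y k\<^esub>"
  shows "\<exists>!g. g \<in> simplicial_hom R Y \<and> simplicial_comp X g u = f"
proof -
  interpret X: sgroup X by standard fact
  interpret R: sgroup R by standard fact
  interpret Y: sgroup Y by standard fact
  have eq: "f k x = f k y" if "x \<in> elts X k" "y \<in> elts X k" "u k x = u k y" for k x y
  proof -
    interpret u: group_hom "lev X k" "lev R k" "u k"
      using simplicial_hom_hom[OF u(1)] by unfold_locales
    interpret f: group_hom "lev X k" "lev Y k" "f k"
      using simplicial_hom_hom[OF f] by unfold_locales
    have "f k (x \<otimes>\<^bsub>lev X k\<^esub> inv\<^bsub>lev X k\<^esub> y) = \<one>\<^bsub>lev Y k\<^esub>"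
      using that by (intro ker) auto
    then show ?thesis
      using that by (simp add: Y.grp.mult_inv_eq_one_iff)
  qed
  define g where "g k = (\<lambda>r\<in>elts R k. f k (SOME x. x \<in> elts X k \<and> u k x = r))" for k
  have closed: "u k x \<in> elts R k" "f k x \<in> elts Y k" if "x \<in> elts X k" for k x
    using simplicial_hom_closed[OF u(1) that] simplicial_hom_closed[OF f that] by simp_all
  have g: "g k (u k x) = f k x" if "x \<in> elts X k" for k x
  proof -
    let ?y = "SOME y. y \<in> elts X k \<and> u k y = u k x"
    have "?y \<in> elts X k \<and> u k ?y = u k x"
      by (rule someI[of _ x]) (simp add: that)
    then have "f k ?y = f k x"
      using that by (intro eq) auto
    then show ?thesis
      using closed[OF that] by (simp add: g_def)
  qed
  have surj: "\<exists>x\<in>elts X k. r = u k x" if "r \<in> elts R k" for k r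
    using that unfolding u(2)[symmetric] by auto
  have "g \<in> simplicial_hom R Y"
    unfolding simplicial_hom_def
  proof (intro CollectI conjI allI ballI impI IntI homI)
    show "g k r \<in> elts Y k" if "r \<in> elts R k" for k r
      using surj[OF that] g closed by auto
    show "g k (r \<otimes>\<^bsub>lev R k\<^esub> s) = g k r \<otimes>\<^bsub>lev Y k\<^esub> g k s" if rs: "r \<in> elts R k" "s \<in> elts R k" for k r s
    proof -
      obtain x y where "x \<in> elts X k" "y \<in> elts X k" "r = u k x" "s = u k y"
        using surj rs by meson
      then show ?thesis
        using hom_mult[OF simplicial_hom_hom[OF f, of k]] g
        by (simp flip: hom_mult[OF simplicial_hom_hom[OF u(1), of k]])
    qed
    show "g k \<in> extensional (elts R k)" for k
      by (simp add: g_def)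
    show "g k (fc R (Suc k) i r) = fc Y (Suc k) i (g (Suc k) r)"
      if r: "r \<in> elts R (Suc k)" and i: "i \<le> Suc k" for k i r
    proof -
      obtain x where "x \<in> elts X (Suc k)" "r = u (Suc k) x"
        using surj[OF r] by blast
      then show ?thesis
        using i g by (simp add: simplicial_hom_fc[OF f] flip: simplicial_hom_fc[OF u(1)])
    qed
    show "g (Suc k) (dg R k i r) = dg Y k i (g k r)"
      if r: "r \<in> elts R k" and i: "i \<le> k" for k i r
    proof -
      obtain x where "x \<in> elts X k" "r = u k x"
        using surj[OF r] by blast
      then show ?thesis
        using i g by (simp add: simplicial_hom_dg[OF f] flip: simplicial_hom_dg[OF u(1)])
    qed
  qed
  moreover have "simplicial_comp X g u = f"
  proof
    fix k
    show "simplicial_comp X g u k = f k"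
      using simplicial_hom_extensional[OF f, of k]
      by (intro extensionalityI[of _ "elts X k"]) (auto simp: simplicial_comp_def compose_def g)
  qed
  moreover have "h = g" if h: "h \<in> simplicial_hom R Y" "simplicial_comp X h u = f" for h
  proof
    fix k
    show "h k = g k"
    proof (rule extensionalityI)
      show "h k \<in> extensional (elts R k)" "g k \<in> extensional (elts R k)"
        using simplicial_hom_extensional[OF h(1)] by (auto simp: g_def)
      fix r assume "r \<in> elts R k"
      then obtain x where x: "x \<in> elts X k" "r = u k x"
        using surj by blast
      have "f k x = h k (u k x)"
        using x unfolding h(2)[symmetric] by (simp add: simplicial_comp_def compose_def)
      then show "h k r = g k r"
        using x g by simp
    qed
  qed
  ultimately show ?thesis by blast
qed

text \<open>Quotients of \<open>X\<close> can be realised on representatives of the cosets, that is, without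
  changing the type of elements.\<close>

lemma (in sgroup_quotient) quotient_on_representatives:
  assumes P: "\<And>k. P k = elts X k"
  obtains R :: "'a sgrp" and u :: "nat \<Rightarrow> 'a \<Rightarrow> 'a" where "simplicial_group R" "u \<in> simplicial_hom X R" "\<And>k. u k ` elts X k = elts R k"
    "\<And>k x. x \<in> elts X k \<Longrightarrow> u k x = \<one>\<^bsub>lev R k\<^esub> \<longleftrightarrow> x \<in> Q k"
proof -
  define r where "r k x = (SOME y. y \<in> elts X k \<and> coset k y = coset k x)" for k x
  have r: "r k x \<in> elts X k" "coset k (r k x) = coset k x" if "x \<in> elts X k" for k x
  proof -
    have "r k x \<in> elts X k \<and> coset k (r k x) = coset k x"
      unfolding r_def by (rule someI[of _ x]) (simp add: that)
    then show "r k x \<in> elts X k" "coset k (r k x) = coset k x" by auto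
  qed
  have r_cong: "r k x = r k y" if "coset k x = coset k y" for k x y
    by (simp add: r_def that)
  have r_eq_iff: "r k x = r k y \<longleftrightarrow> coset k x = coset k y" if "x \<in> elts X k" "y \<in> elts X k" for k x y
    using r[OF that(1)] r[OF that(2)] r_cong[of k x y] by metis
  \<comment> \<open>Each operation of X is followed by passing to the chosen representative, so that
    elements of the original type stand for the cosets.\<close>
  define R where "R = \<lparr>
    lev = \<lambda>k. \<lparr>carrier = r k ` elts X k, mult = \<lambda>x y. r k (x \<otimes>\<^bsub>lev X k\<^esub> y), one = r k \<one>\<^bsub>lev X k\<^esub>\<rparr>,
    fc = \<lambda>k i x. r (k - 1) (fc X k i x), dg = \<lambda>k i x. r (Suc k) (dg X k i x)\<rparr>"
  define u where "u k = restrict (r k) (elts X k)" for k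
  have mult: "r k (x \<otimes>\<^bsub>lev X k\<^esub> y) = r k (r k x \<otimes>\<^bsub>lev X k\<^esub> r k y)"
    if "x \<in> elts X k" "y \<in> elts X k" for k x y
    using quot_simps(3)[of x k y] quot_simps(3)[of "r k x" k "r k y"] that r
    by (intro r_cong) (simp add: P)
  have fc: "r k (fc X (Suc k) i (r (Suc k) x)) = r k (fc X (Suc k) i x)"
    if "x \<in> elts X (Suc k)" "i \<le> Suc k" for k i x
    using quot_fc[of i k x] quot_fc[of i k "r (Suc k) x"] that r by (intro r_cong) (simp add: P)
  have dg: "r (Suc k) (dg X k i (r k x)) = r (Suc k) (dg X k i x)"
    if "x \<in> elts X k" "i \<le> k" for k i x
    using quot_dg[of i k x] quot_dg[of i k "r k x"] that r by (intro r_cong) (simp add: P)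
  have surj: "u k ` elts X k = elts R k" for k
    by (simp add: u_def R_def)
  have 1: "simplicial_group R"
  proof (rule simplicial_group_image[of X u])
    show "sgroup X" ..
  qed (use mult in \<open>simp_all add: u_def R_def fc dg\<close>)
  have 2: "u \<in> simplicial_hom X R"
    using mult by (auto simp: simplicial_hom_def hom_def u_def R_def fc dg)
  have 3: "u k x = \<one>\<^bsub>lev R k\<^esub> \<longleftrightarrow> x \<in> Q k" if "x \<in> elts X k" for k x
    using that r_eq_iff[of x k "\<one>\<^bsub>lev X k\<^esub>"] by (simp add: u_def R_def coset_eq_iff)
  show thesis
    by (rule that[OF 1 2 surj 3])
qed

lemma moore_one: "simplicial_group X \<Longrightarrow> \<one>\<^bsub>lev X k\<^esub> \<in> moore X k"
proof -
  assume "simplicial_group X"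
  then interpret sgroup X by (rule sgroup.intro)
  show ?thesis
    by (cases k) (simp_all add: moore_Suc, simp add: moore_def)
qed

context sgroup
begin

lemma quotient_mu_le_faces: "sgroup_quotient X (elts X) (faces_in n (mu_le_faces X n) X)"
proof (intro sgroup_quotient.intro simplicial_subgroup.intro simplicial_subgroup_axioms.intro
    sgroup_quotient_axioms.intro)
  show "sgroup X" ..
  show "faces_in n (mu_le_faces X n) X k \<lhd> lev X k" for k
    by (rule faces_in_normal[OF mu_le_faces_normal])
  show "faces_in n (mu_le_faces X n) X k \<subseteq> elts X k" for k
    by (auto simp: faces_in_def)
qed (simp_all add: grp.subgroup_self fc_faces_in dg_faces_in)

text \<open>The quotient by \<open>faces_in\<close> lies in the subcategory by
  \<open>mu_le_faces_quotient_moore\<close>, and maps into the subcategory kill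
  \<open>faces_in\<close> by \<open>hom_kills_mu_le_faces\<close>, so they factor uniquely.
  Existence is what makes the choice in \<open>Cot_with_unit\<close> meet its specification.\<close>

lemma reflection_exists:
  obtains R :: "'a sgrp" and u :: "nat \<Rightarrow> 'a \<Rightarrow> 'a" where "is_reflection SimpGrp (M_le n) X R u"
    "\<And>k x. x \<in> elts X k \<Longrightarrow> u k x = \<one>\<^bsub>lev R k\<^esub> \<longleftrightarrow> x \<in> faces_in n (mu_le_faces X n) X k"
proof -
  interpret sgroup_quotient X "elts X" "faces_in n (mu_le_faces X n) X"
    by (rule quotient_mu_le_faces)
  obtain R :: "'a sgrp" and u where R: "simplicial_group R" and u: "u \<in> simplicial_hom X R" "\<And>k. u k ` elts X k = elts R k"
    and ker: "\<And>k x. x \<in> elts X k \<Longrightarrow> u k x = \<one>\<^bsub>lev R k\<^esub> \<longleftrightarrow> x \<in> faces_in n (mu_le_faces X n) X k"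
    by (rule quotient_on_representatives) auto
  interpret R: sgroup R by standard fact
  have "moore R i = {\<one>\<^bsub>lev R i\<^esub>}" if "i > n" for i
  proof -
    obtain k where i: "i = Suc k" "k \<ge> n"
      using \<open>i > n\<close> by (cases i) auto
    have "y = \<one>\<^bsub>lev R (Suc k)\<^esub>" if y: "y \<in> moore R (Suc k)" for y
    proof -
      obtain x where x: "x \<in> elts X (Suc k)" "y = u (Suc k) x"
        using y u(2)[of "Suc k"] by (auto simp: R.moore_Suc)
      have "fc X (Suc k) i x \<in> faces_in n (mu_le_faces X n) X k" if "i \<le> k" for i
        using y x that by (simp add: R.moore_Suc flip: ker simplicial_hom_fc[OF u(1)])
      then show ?thesis
        using mu_le_faces_quotient_moore[OF i(2) x(1)] ker x by simp
    qed
    then show ?thesis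
      using i moore_one[OF R] by blast
  qed
  then have "R \<in> Obj (M_le n)"
    using R by (simp add: M_le_def full_subcat_def SimpGrp_def)
  moreover have "\<forall>Y\<in>Obj (M_le n :: ('a sgrp, nat \<Rightarrow> 'a \<Rightarrow> 'a) cat). \<forall>f\<in>simplicial_hom X Y.
      \<exists>!g. g \<in> simplicial_hom R Y \<and> simplicial_comp X g u = f"
  proof (intro ballI)
    fix Y :: "'a sgrp" and f assume that: "Y \<in> Obj (M_le n)" "f \<in> simplicial_hom X Y"
    have Y: "simplicial_group Y" "\<And>i. i > n \<Longrightarrow> moore Y i = {\<one>\<^bsub>lev Y i\<^esub>}"
      using that(1) by (auto simp: M_le_def full_subcat_def SimpGrp_def)
    have ker': "f k x = \<one>\<^bsub>lev Y k\<^esub>" if "x \<in> elts X k" "u k x = \<one>\<^bsub>lev R k\<^esub>" for k x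
      using that ker[OF that(1)]
      by (intro hom_kills_mu_le_faces[OF sgroup.intro[OF Y(1)] Y(2) \<open>f \<in> simplicial_hom X Y\<close>]) auto
    show "\<exists>!g. g \<in> simplicial_hom R Y \<and> simplicial_comp X g u = f"
      by (rule simplicial_hom_factor[OF simplicial_group R Y(1) u that(2) ker'])
  qed
  ultimately have "is_reflection SimpGrp (M_le n) X R u"
    using u(1) by (simp add: is_reflection_def SimpGrp_def M_le_def full_subcat_def)
  then show thesis
    by (rule that[OF _ ker])
qed

text \<open>Only the universal property of the chosen \<open>Cot\<close> is available. The
  constructed quotient map factors through its unit, which bounds the kernel from above; the unit
  maps into the subcategory and so kills \<open>faces_in\<close>, which bounds it from
  below.\<close>

lemma mu_le_eq: "mu_le n X = faces_in n (mu_le_faces X n) X"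
proof
  fix k
  let ?C = "Cot n X" and ?c = "Cot_unit n X"
  obtain R :: "'a sgrp" and u where R: "is_reflection SimpGrp (M_le n) X R u"
    and ker: "\<And>k x. x \<in> elts X k \<Longrightarrow> u k x = \<one>\<^bsub>lev R k\<^esub> \<longleftrightarrow> x \<in> faces_in n (mu_le_faces X n) X k"
    using reflection_exists[of n] by metis
  have "case Cot_with_unit n X of (R, u) \<Rightarrow> is_reflection SimpGrp (M_le n) X R u"
    unfolding Cot_with_unit_def by (rule someI[of _ "(R, u)"]) (simp add: R)
  then have C: "is_reflection SimpGrp (M_le n) X ?C ?c"
    by (simp add: Cot_def Cot_unit_def case_prod_beta)
  have c: "simplicial_group ?C" "\<And>i. i > n \<Longrightarrow> moore ?C i = {\<one>\<^bsub>lev ?C i\<^esub>}" "?c \<in> simplicial_hom X ?C"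
    using C by (auto simp: is_reflection_def M_le_def full_subcat_def SimpGrp_def)
  have "\<exists>!g. g \<in> Hom (M_le n) ?C R \<and> Cmp SimpGrp X ?C R g ?c = u"
    using C R unfolding is_reflection_def by blast
  then obtain g where g: "g \<in> simplicial_hom ?C R" "simplicial_comp X g ?c = u"
    by (auto simp: is_reflection_def M_le_def full_subcat_def SimpGrp_def)
  have R': "simplicial_group R"
    using R by (simp add: is_reflection_def M_le_def full_subcat_def SimpGrp_def)
  show "mu_le n X k = faces_in n (mu_le_faces X n) X k"
  proof (intro equalityI subsetI)
    fix x assume "x \<in> mu_le n X k"
    then have x: "x \<in> elts X k" "?c k x = \<one>\<^bsub>lev ?C k\<^esub>"
      by (auto simp: mu_le_def kernel_def)
    then have "u k x = \<one>\<^bsub>lev R k\<^esub>"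
      unfolding g(2)[symmetric]
      by (simp add: simplicial_comp_def compose_def simplicial_hom_one[OF c(1) R' g(1)])
    then show "x \<in> faces_in n (mu_le_faces X n) X k"
      using ker[OF x(1)] by simp
  next
    fix x assume x: "x \<in> faces_in n (mu_le_faces X n) X k"
    then have "?c k x = \<one>\<^bsub>lev ?C k\<^esub>"
      by (intro hom_kills_mu_le_faces[OF sgroup.intro[OF c(1)] c(2,3)])
    then show "x \<in> mu_le n X k"
      using x by (auto simp: mu_le_def kernel_def faces_in_def)
  qed
qed

end

section \<open>Functoriality of the quotients and of the homotopy groups\<close>

lemma simplicial_comp_in:
  assumes X: "simplicial_group X" and f: "f \<in> simplicial_hom X Y" and g: "g \<in> simplicial_hom Y Z"
  shows "simplicial_comp X g f \<in> simplicial_hom X Z"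
proof -
  interpret X: sgroup X by (rule sgroup.intro[OF X])
  have closed: "f k x \<in> elts Y k" "g k (f k x) \<in> elts Z k" if "x \<in> elts X k" for k x
    using simplicial_hom_closed[OF f that] simplicial_hom_closed[OF g] by auto
  have mult: "g k (f k (x \<otimes>\<^bsub>lev X k\<^esub> y)) = g k (f k x) \<otimes>\<^bsub>lev Z k\<^esub> g k (f k y)"
    if "x \<in> elts X k" "y \<in> elts X k" for k x y
    using that closed hom_mult[OF simplicial_hom_hom[OF f, of k]] hom_mult[OF simplicial_hom_hom[OF g, of k]]
    by simp
  show ?thesis
    unfolding simplicial_hom_def
    by (auto simp: hom_def simplicial_comp_def compose_def closed mult simplicial_hom_fc[OF f]
        simplicial_hom_fc[OF g] simplicial_hom_dg[OF f] simplicial_hom_dg[OF g])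
qed

locale quotient_functor =
  fixes P Q :: "'a sgrp \<Rightarrow> nat \<Rightarrow> 'a set"
  assumes quot: "simplicial_group X \<Longrightarrow> sgroup_quotient X (P X) (Q X)"
    and hom_P: "simplicial_group X \<Longrightarrow> simplicial_group Y \<Longrightarrow> f \<in> simplicial_hom X Y \<Longrightarrow>
      x \<in> P X k \<Longrightarrow> f k x \<in> P Y k"
    and hom_Q: "simplicial_group X \<Longrightarrow> simplicial_group Y \<Longrightarrow> f \<in> simplicial_hom X Y \<Longrightarrow>
      x \<in> Q X k \<Longrightarrow> f k x \<in> Q Y k"
begin

lemma
  shows quot_functor_coset: "simplicial_group X \<Longrightarrow> simplicial_group Y \<Longrightarrow>
      f \<in> simplicial_hom X Y \<Longrightarrow> x \<in> P X k \<Longrightarrow>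
      Farr (quot_functor P Q) X Y f k (Q X k #>\<^bsub>lev X k\<^esub> x) = Q Y k #>\<^bsub>lev Y k\<^esub> f k x"
    and is_functor_quot_functor: "is_functor SimpGrp SimpGrp (quot_functor P Q)"
proof -
  let ?F = "quot_functor P Q"
  have hom: "f k \<in> hom ((lev X k)\<lparr>carrier := P X k\<rparr>) (lev Y k)"
    if "simplicial_group X" "f \<in> simplicial_hom X Y" for X Y :: "'a sgrp" and f k
  proof -
    interpret X: sgroup_quotient X "P X" "Q X" by (rule quot[OF that(1)])
    show ?thesis
      using simplicial_hom_hom[OF that(2), of k] X.sub_closed[of _ k] by (auto simp: hom_def)
  qed
  show coset: "Farr ?F X Y f k (Q X k #>\<^bsub>lev X k\<^esub> x) = Q Y k #>\<^bsub>lev Y k\<^esub> f k x"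
    if "simplicial_group X" "simplicial_group Y" "f \<in> simplicial_hom X Y" "x \<in> P X k"
    for X Y :: "'a sgrp" and f k x
  proof -
    interpret X: sgroup_quotient X "P X" "Q X" by (rule quot[OF that(1)])
    interpret Y: sgroup_quotient Y "P Y" "Q Y" by (rule quot[OF that(2)])
    have "coset_map (lev Y k) (Q Y k) (f k) (Q X k #>\<^bsub>lev X k\<^esub> x) = Q Y k #>\<^bsub>lev Y k\<^esub> f k x"
      using hom_Q[OF that(1,2,3)]
      by (intro coset_map_coset[OF X.normal Y.normal X.subgroup X.Q_le_P hom[OF that(1,3)] _ that(4)]) auto
    then show ?thesis
      using that(4) by (simp add: quot_functor_def)
  qed
  have ext: "Farr ?F X Y f k \<in> extensional (elts (quot_sgrp X (P X) (Q X)) k)" for X Y f k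
    by (simp add: quot_functor_def)
  have in_hom: "Farr ?F X Y f \<in> simplicial_hom (quot_sgrp X (P X) (Q X)) (quot_sgrp Y (P Y) (Q Y))"
    if "simplicial_group X" "simplicial_group Y" "f \<in> simplicial_hom X Y" for X Y f
  proof -
    interpret X: sgroup_quotient X "P X" "Q X" by (rule quot[OF that(1)])
    interpret Y: sgroup_quotient Y "P Y" "Q Y" by (rule quot[OF that(2)])
    have mult: "f k (x \<otimes>\<^bsub>lev X k\<^esub> y) = f k x \<otimes>\<^bsub>lev Y k\<^esub> f k y" if "x \<in> P X k" "y \<in> P X k" for k x y
      using hom_mult[OF simplicial_hom_hom[OF \<open>f \<in> simplicial_hom X Y\<close>, of k]] that X.sub_closed by simp
    show ?thesis
      unfolding simplicial_hom_def using ext[of X Y f] hom_P[OF that]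
      by (auto simp: hom_def coset[OF that] mult subgroup.m_closed[OF X.subgroup] X.fc_sub X.dg_sub
          X.sub_closed simplicial_hom_fc[OF that(3)] simplicial_hom_dg[OF that(3)])
  qed
  show "is_functor SimpGrp SimpGrp ?F"
    unfolding is_functor_def
  proof (intro conjI ballI)
    fix X :: "'a sgrp" assume "X \<in> Obj SimpGrp"
    then have X: "simplicial_group X" by (simp add: SimpGrp_def)
    interpret X: sgroup_quotient X "P X" "Q X" by (rule quot[OF X])
    show "Fobj ?F X \<in> Obj SimpGrp"
      by (simp add: quot_functor_def SimpGrp_def X.simplicial_group_quot)
    have id: "simplicial_id X \<in> simplicial_hom X X"
      unfolding simplicial_hom_def by (auto simp: hom_def simplicial_id_def)
    have "Farr ?F X X (simplicial_id X) k = simplicial_id (quot_sgrp X (P X) (Q X)) k" for k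
    proof (rule extensionalityI[OF ext])
      fix C assume "C \<in> elts (quot_sgrp X (P X) (Q X)) k"
      then show "Farr ?F X X (simplicial_id X) k C = simplicial_id (quot_sgrp X (P X) (Q X)) k C"
        using coset[OF X X id] X.sub_closed by (auto simp: simplicial_id_def)
    qed (simp add: simplicial_id_def)
    then show "Farr ?F X X (Idn SimpGrp X) = Idn SimpGrp (Fobj ?F X)"
      by (simp add: SimpGrp_def fun_eq_iff) (simp add: quot_functor_def)
  next
    fix X Y :: "'a sgrp" and f assume "X \<in> Obj SimpGrp" "Y \<in> Obj SimpGrp" "f \<in> Hom SimpGrp X Y"
    then show "Farr ?F X Y f \<in> Hom SimpGrp (Fobj ?F X) (Fobj ?F Y)"
      using in_hom[of X Y f] by (simp add: SimpGrp_def) (simp add: quot_functor_def)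
  next
    fix X Y Z :: "'a sgrp" and f g
    assume "X \<in> Obj SimpGrp" "Y \<in> Obj SimpGrp" "Z \<in> Obj SimpGrp"
      and "f \<in> Hom SimpGrp X Y" "g \<in> Hom SimpGrp Y Z"
    then have X: "simplicial_group X" and Y: "simplicial_group Y" and Z: "simplicial_group Z"
      and f: "f \<in> simplicial_hom X Y" and g: "g \<in> simplicial_hom Y Z"
      by (auto simp: SimpGrp_def)
    interpret X: sgroup_quotient X "P X" "Q X" by (rule quot[OF X])
    have "Farr ?F X Z (simplicial_comp X g f) k =
        simplicial_comp (quot_sgrp X (P X) (Q X)) (Farr ?F Y Z g) (Farr ?F X Y f) k" for k
    proof (rule extensionalityI[OF ext])
      fix C assume "C \<in> elts (quot_sgrp X (P X) (Q X)) k"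
      then obtain x where x: "x \<in> P X k" "C = Q X k #>\<^bsub>lev X k\<^esub> x" by auto
      then show "Farr ?F X Z (simplicial_comp X g f) k C =
          simplicial_comp (quot_sgrp X (P X) (Q X)) (Farr ?F Y Z g) (Farr ?F X Y f) k C"
        using coset[OF X Z simplicial_comp_in[OF X f g] x(1)] coset[OF X Y f x(1)]
          coset[OF Y Z g hom_P[OF X Y f x(1)]] X.sub_closed[OF x(1)]
        by (simp add: simplicial_comp_def compose_def)
    qed (simp add: simplicial_comp_def compose_def)
    then show "Farr ?F X Z (Cmp SimpGrp X Y Z g f) =
        Cmp SimpGrp (Fobj ?F X) (Fobj ?F Y) (Fobj ?F Z) (Farr ?F Y Z g) (Farr ?F X Y f)"
      by (simp add: SimpGrp_def fun_eq_iff) (simp add: quot_functor_def)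
  qed
qed

end

context sgroup
begin

lemma homotopy_group_simps:
  "carrier (homotopy_group n X) = (\<lambda>x. boundaries X n #>\<^bsub>lev X n\<^esub> x) ` cycles X n"
  "\<one>\<^bsub>homotopy_group n X\<^esub> = boundaries X n"
  "x \<in> elts X n \<Longrightarrow> y \<in> elts X n \<Longrightarrow>
    (boundaries X n #>\<^bsub>lev X n\<^esub> x) \<otimes>\<^bsub>homotopy_group n X\<^esub> (boundaries X n #>\<^bsub>lev X n\<^esub> y) =
    boundaries X n #>\<^bsub>lev X n\<^esub> (x \<otimes>\<^bsub>lev X n\<^esub> y)"
  by (simp_all add: homotopy_group_def carrier_FactGroup normal.rcos_sum[OF boundaries_normal])

lemma group_homotopy_group: "group (homotopy_group n X)"
  unfolding homotopy_group_def
  by (intro normal.factorgroup_is_group grp.normal_restrict_supergroup cycles_subgroup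
      boundaries_normal boundaries_le_cycles)

lemma comm_group_homotopy_group: "comm_group (homotopy_group (Suc m) X)"
proof (rule group.group_comm_groupI[OF group_homotopy_group])
  let ?B = "boundaries X (Suc m)" and ?G = "lev X (Suc m)"
  fix C D assume "C \<in> carrier (homotopy_group (Suc m) X)" "D \<in> carrier (homotopy_group (Suc m) X)"
  then obtain x y where xy: "x \<in> cycles X (Suc m)" "y \<in> cycles X (Suc m)"
    "C = ?B #>\<^bsub>?G\<^esub> x" "D = ?B #>\<^bsub>?G\<^esub> y"
    unfolding homotopy_group_simps by blast
  have elts: "x \<in> carrier ?G" "y \<in> carrier ?G"
    using xy cycles_closed by auto
  have "?B #>\<^bsub>?G\<^esub> (x \<otimes>\<^bsub>?G\<^esub> y) = ?B #>\<^bsub>?G\<^esub> (y \<otimes>\<^bsub>?G\<^esub> x)"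
    using commutator_boundary[OF xy(1,2)] elts
    by (simp add: normal.coset_eq_iff[OF boundaries_normal] grp.inv_mult_group grp.m_assoc)
  then show "C \<otimes>\<^bsub>homotopy_group (Suc m) X\<^esub> D = D \<otimes>\<^bsub>homotopy_group (Suc m) X\<^esub> C"
    using xy elts by (simp add: homotopy_group_simps)
qed

lemma hom_cycles:
  assumes Y: "simplicial_group Y" and f: "f \<in> simplicial_hom X Y" and x: "x \<in> cycles X n"
  shows "f n x \<in> cycles Y n"
proof -
  interpret Y: sgroup Y by (rule sgroup.intro[OF Y])
  show ?thesis
  proof (cases n)
    case 0
    then show ?thesis
      using x simplicial_hom_closed[OF f] by (simp add: cycles_0 Y.cycles_0)
  next
    case (Suc k)
    then show ?thesis
      using x simplicial_hom_closed[OF f]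
      by (simp add: cycles_Suc Y.cycles_Suc simplicial_hom_one[OF simplicial_group Y f]
          flip: simplicial_hom_fc[OF f])
  qed
qed

lemma hom_boundaries:
  assumes Y: "simplicial_group Y" and f: "f \<in> simplicial_hom X Y" and b: "b \<in> boundaries X n"
  shows "f n b \<in> boundaries Y n"
proof -
  interpret Y: sgroup Y by (rule sgroup.intro[OF Y])
  obtain z where z: "z \<in> moore X (Suc n)" "b = fc X (Suc n) (Suc n) z"
    using b by (auto simp: boundaries_def)
  then have "f (Suc n) z \<in> moore Y (Suc n)"
    using simplicial_hom_closed[OF f]
    by (simp add: moore_Suc Y.moore_Suc simplicial_hom_one[OF simplicial_group Y f]
        flip: simplicial_hom_fc[OF f])
  moreover have "f n b = fc Y (Suc n) (Suc n) (f (Suc n) z)"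
    using z by (simp add: moore_Suc simplicial_hom_fc[OF f])
  ultimately show ?thesis
    by (auto simp: boundaries_def)
qed

lemma pi_functor_coset:
  assumes Y: "simplicial_group Y" and f: "f \<in> simplicial_hom X Y" and x: "x \<in> cycles X n"
  shows "Farr (pi_functor n) X Y f (boundaries X n #>\<^bsub>lev X n\<^esub> x) = boundaries Y n #>\<^bsub>lev Y n\<^esub> f n x"
proof -
  interpret Y: sgroup Y by (rule sgroup.intro[OF Y])
  have "coset_map (lev Y n) (boundaries Y n) (f n) (boundaries X n #>\<^bsub>lev X n\<^esub> x) =
      boundaries Y n #>\<^bsub>lev Y n\<^esub> f n x"
    using simplicial_hom_hom[OF f, of n] cycles_closed hom_boundaries[OF Y f]
    by (intro coset_map_coset[OF boundaries_normal Y.boundaries_normal cycles_subgroup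
          boundaries_le_cycles _ _ x]) (auto simp: hom_def)
  then show ?thesis
    using x by (simp add: pi_functor_def homotopy_group_simps)
qed

end

lemma is_functor_pi_functor_Grp: "is_functor SimpGrp Grp (pi_functor n)"
  unfolding is_functor_def
proof (intro conjI ballI)
  let ?F = "pi_functor n"
  have ext: "Farr ?F X Y f \<in> extensional (carrier (homotopy_group n X))" for X Y f
    by (simp add: pi_functor_def)
  {
    fix X :: "'a sgrp" assume "X \<in> Obj SimpGrp"
    then have X: "simplicial_group X" by (simp add: SimpGrp_def)
    interpret X: sgroup X by (rule sgroup.intro[OF X])
    show "Fobj ?F X \<in> Obj Grp"
      by (simp add: pi_functor_def Grp_def X.group_homotopy_group)
    have id: "simplicial_id X \<in> simplicial_hom X X"
      unfolding simplicial_hom_def by (auto simp: hom_def simplicial_id_def)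
    have "Farr ?F X X (simplicial_id X) = (\<lambda>C\<in>carrier (homotopy_group n X). C)"
    proof (rule extensionalityI[OF ext])
      fix C assume "C \<in> carrier (homotopy_group n X)"
      then show "Farr ?F X X (simplicial_id X) C = (\<lambda>C\<in>carrier (homotopy_group n X). C) C"
        using X.pi_functor_coset[OF X id] X.cycles_closed
        by (auto simp: simplicial_id_def X.homotopy_group_simps)
    qed simp
    then show "Farr ?F X X (Idn SimpGrp X) = Idn Grp (Fobj ?F X)"
      by (simp add: SimpGrp_def Grp_def) (simp add: pi_functor_def)
  next
    fix X Y :: "'a sgrp" and f assume "X \<in> Obj SimpGrp" "Y \<in> Obj SimpGrp" "f \<in> Hom SimpGrp X Y"
    then have X: "simplicial_group X" and Y: "simplicial_group Y" and f: "f \<in> simplicial_hom X Y"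
      by (auto simp: SimpGrp_def)
    interpret X: sgroup X by (rule sgroup.intro[OF X])
    interpret Y: sgroup Y by (rule sgroup.intro[OF Y])
    have closed: "x \<in> elts X n" "f n x \<in> elts Y n" if "x \<in> cycles X n" for x
      using X.cycles_closed[OF that] simplicial_hom_closed[OF f] by auto
    have "Farr ?F X Y f \<in> hom (homotopy_group n X) (homotopy_group n Y)"
    proof (rule homI)
      fix C assume "C \<in> carrier (homotopy_group n X)"
      then show "Farr ?F X Y f C \<in> carrier (homotopy_group n Y)"
        using X.hom_cycles[OF Y f] X.pi_functor_coset[OF Y f]
        by (auto simp: X.homotopy_group_simps Y.homotopy_group_simps)
    next
      fix C D assume "C \<in> carrier (homotopy_group n X)" "D \<in> carrier (homotopy_group n X)"
      then obtain x y where xy: "x \<in> cycles X n" "y \<in> cycles X n"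
        "C = boundaries X n #>\<^bsub>lev X n\<^esub> x" "D = boundaries X n #>\<^bsub>lev X n\<^esub> y"
        unfolding X.homotopy_group_simps by blast
      have "f n (x \<otimes>\<^bsub>lev X n\<^esub> y) = f n x \<otimes>\<^bsub>lev Y n\<^esub> f n y"
        using hom_mult[OF simplicial_hom_hom[OF f, of n]] closed xy by simp
      then show "Farr ?F X Y f (C \<otimes>\<^bsub>homotopy_group n X\<^esub> D) =
          Farr ?F X Y f C \<otimes>\<^bsub>homotopy_group n Y\<^esub> Farr ?F X Y f D"
        using xy closed subgroup.m_closed[OF X.cycles_subgroup xy(1,2)]
        by (simp add: X.homotopy_group_simps Y.homotopy_group_simps X.pi_functor_coset[OF Y f])
    qed
    then show "Farr ?F X Y f \<in> Hom Grp (Fobj ?F X) (Fobj ?F Y)"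
      using ext[of X Y f] by (simp add: Grp_def) (simp add: pi_functor_def)
  next
    fix X Y Z :: "'a sgrp" and f g
    assume "X \<in> Obj SimpGrp" "Y \<in> Obj SimpGrp" "Z \<in> Obj SimpGrp"
      and "f \<in> Hom SimpGrp X Y" "g \<in> Hom SimpGrp Y Z"
    then have X: "simplicial_group X" and Y: "simplicial_group Y" and Z: "simplicial_group Z"
      and f: "f \<in> simplicial_hom X Y" and g: "g \<in> simplicial_hom Y Z"
      by (auto simp: SimpGrp_def)
    interpret X: sgroup X by (rule sgroup.intro[OF X])
    interpret Y: sgroup Y by (rule sgroup.intro[OF Y])
    have "Farr ?F X Z (simplicial_comp X g f) =
        compose (carrier (homotopy_group n X)) (Farr ?F Y Z g) (Farr ?F X Y f)"
    proof (rule extensionalityI[OF ext])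
      fix C assume C: "C \<in> carrier (homotopy_group n X)"
      then obtain x where x: "x \<in> cycles X n" "C = boundaries X n #>\<^bsub>lev X n\<^esub> x"
        unfolding X.homotopy_group_simps by blast
      then show "Farr ?F X Z (simplicial_comp X g f) C =
          compose (carrier (homotopy_group n X)) (Farr ?F Y Z g) (Farr ?F X Y f) C"
        using X.pi_functor_coset[OF Z simplicial_comp_in[OF X f g] x(1)] X.pi_functor_coset[OF Y f x(1)]
          Y.pi_functor_coset[OF Z g X.hom_cycles[OF Y f x(1)]] X.cycles_closed[OF x(1)] C
        by (simp add: simplicial_comp_def compose_def)
    qed (simp add: compose_def)
    then show "Farr ?F X Z (Cmp SimpGrp X Y Z g f) =
        Cmp Grp (Fobj ?F X) (Fobj ?F Y) (Fobj ?F Z) (Farr ?F Y Z g) (Farr ?F X Y f)"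
      by (simp add: SimpGrp_def Grp_def) (simp add: pi_functor_def)
  }
qed

lemma is_functor_pi_functor_Ab:
  assumes "n \<ge> 1"
  shows "is_functor (SimpGrp :: ('a sgrp, nat \<Rightarrow> 'a \<Rightarrow> 'a) cat) Ab (pi_functor n)"
proof -
  obtain m where n: "n = Suc m"
    using assms by (cases n) auto
  have "comm_group (Fobj (pi_functor n) X)" if "X \<in> Obj SimpGrp" for X :: "'a sgrp"
    using that sgroup.comm_group_homotopy_group[of X m]
    by (simp add: SimpGrp_def sgroup_def n pi_functor_def)
  then show ?thesis
    using is_functor_pi_functor_Grp[of n] by (simp add: is_functor_def Ab_def full_subcat_def)
qed

lemma simplicial_group_Dis: "group G \<Longrightarrow> simplicial_group (Fobj Dis G)"
  by (rule simplicial_groupI) (auto simp: Dis_def hom_def)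

lemma is_functor_Dis: "is_functor Grp SimpGrp Dis"
  unfolding is_functor_def
  by (auto simp: Grp_def SimpGrp_def simplicial_group_Dis)
    (auto simp: Dis_def simplicial_hom_def hom_def simplicial_id_def simplicial_comp_def fun_eq_iff)

section \<open>Coskeleta and Eilenberg--MacLane simplicial groups\<close>

text \<open>The faces and degeneracies of \<open>cosk\<^sub>m T\<close> are precompositions, so its simplicial identities
  come from \<open>\<Delta>[k]\<close> and not from \<open>T\<close>.\<close>

locale truncated_groups =
  fixes m :: nat and T :: "'a sgrp"
  assumes group_lev [simp]: "j \<le> m \<Longrightarrow> group (lev T j)"
    and fc_hom: "j < m \<Longrightarrow> i \<le> Suc j \<Longrightarrow> fc T (Suc j) i \<in> hom (lev T (Suc j)) (lev T j)"
    and dg_hom: "j < m \<Longrightarrow> i \<le> j \<Longrightarrow> dg T j i \<in> hom (lev T j) (lev T (Suc j))"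
begin

lemma cosk_simps:
  "elts (cosk m T) k = simplex_maps m T k"
  "f \<otimes>\<^bsub>lev (cosk m T) k\<^esub> g = (\<lambda>\<sigma>\<in>simplices m k. f \<sigma> \<otimes>\<^bsub>lev T (sdim \<sigma>)\<^esub> g \<sigma>)"
  "\<one>\<^bsub>lev (cosk m T) k\<^esub> = (\<lambda>\<sigma>\<in>simplices m k. \<one>\<^bsub>lev T (sdim \<sigma>)\<^esub>)"
  "fc (cosk m T) (Suc k) i f = (\<lambda>\<tau>\<in>simplices m k. f (map (coface i) \<tau>))"
  "dg (cosk m T) k i f = (\<lambda>\<tau>\<in>simplices m (Suc k). f (map (codegen i) \<tau>))"
  by (simp_all add: cosk_def)

lemma group_sdim: "\<sigma> \<in> simplices m k \<Longrightarrow> group (lev T (sdim \<sigma>))"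
  using simplices_sdim by simp

lemma fc_group_hom:
  assumes "\<sigma> \<in> simplices m k" "i \<le> sdim \<sigma>" "1 \<le> sdim \<sigma>"
  shows "group_hom (lev T (sdim \<sigma>)) (lev T (sdim (sface i \<sigma>))) (fc T (sdim \<sigma>) i)"
proof -
  obtain j where "sdim \<sigma> = Suc j"
    using assms(3) by (cases "sdim \<sigma>") auto
  then show ?thesis
    using assms simplices_sdim[OF assms(1)] fc_hom[of j i]
    by (simp add: sface_simplex group_hom_def group_hom_axioms_def)
qed

lemma dg_group_hom:
  assumes "\<sigma> \<in> simplices m k" "i \<le> sdim \<sigma>" "Suc (sdim \<sigma>) \<le> m"
  shows "group_hom (lev T (sdim \<sigma>)) (lev T (sdim (sdegen i \<sigma>))) (dg T (sdim \<sigma>) i)"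
  using assms dg_hom[of "sdim \<sigma>" i]
  by (simp add: sdegen_simplex group_hom_def group_hom_axioms_def)

text \<open>The defining conditions equate values of homomorphisms, so they cut a subgroup out of
  the product.\<close>

lemma simplex_maps_subgroup:
  "subgroup (simplex_maps m T k) (product_group (simplices m k) (\<lambda>\<sigma>. lev T (sdim \<sigma>)))"
    (is "subgroup _ ?G")
proof -
  interpret G: group ?G
    by (rule product_group) (rule group_sdim)
  show ?thesis
  proof
    show sub: "simplex_maps m T k \<subseteq> carrier ?G"
      by (auto simp: simplex_maps_def)
    show "\<one>\<^bsub>?G\<^esub> \<in> simplex_maps m T k"
      using group_hom.hom_one[OF fc_group_hom] group_hom.hom_one[OF dg_group_hom]
        monoid.one_closed[OF group.is_monoid[OF group_sdim]]
      by (auto simp: simplex_maps_def sface_simplex(1) sdegen_simplex(1))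
    show "f \<otimes>\<^bsub>?G\<^esub> g \<in> simplex_maps m T k"
      if f: "f \<in> simplex_maps m T k" and g: "g \<in> simplex_maps m T k" for f g
      using group_hom.hom_mult[OF fc_group_hom] group_hom.hom_mult[OF dg_group_hom]
        monoid.m_closed[OF group.is_monoid[OF group_sdim]] simplex_maps_in[OF f] simplex_maps_in[OF g]
        simplex_maps_face[OF f] simplex_maps_face[OF g] simplex_maps_degen[OF f] simplex_maps_degen[OF g]
      by (auto simp: simplex_maps_def sface_simplex(1) sdegen_simplex(1))
    show "inv\<^bsub>?G\<^esub> f \<in> simplex_maps m T k" if f: "f \<in> simplex_maps m T k" for f
    proof -
      have "inv\<^bsub>?G\<^esub> f = (\<lambda>\<sigma>\<in>simplices m k. inv\<^bsub>lev T (sdim \<sigma>)\<^esub> f \<sigma>)"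
        using f sub by (intro inv_product_group group_sdim) auto
      then show ?thesis
        using group_hom.hom_inv[OF fc_group_hom] group_hom.hom_inv[OF dg_group_hom]
          group.inv_closed[OF group_sdim] simplex_maps_in[OF f] simplex_maps_face[OF f] simplex_maps_degen[OF f]
        by (auto simp: simplex_maps_def sface_simplex(1) sdegen_simplex(1))
    qed
  qed
qed

lemma group_cosk: "group (lev (cosk m T) k)"
  unfolding cosk_def
  by (simp, rule group.subgroup_imp_group[OF product_group simplex_maps_subgroup]) (rule group_sdim)

lemma simplicial_group_cosk: "simplicial_group (cosk m T)"
proof (rule simplicial_groupI)
  note codegen = map_codegen_simplex[where m = "enat m"]
  show "group (lev (cosk m T) k)" for k
    by (rule group_cosk)
  show "fc (cosk m T) (Suc k) i \<in> hom (lev (cosk m T) (Suc k)) (lev (cosk m T) k)" for k i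
    by (auto simp: hom_def cosk_simps simplex_maps_coface map_coface_simplex intro!: restrict_ext)
  show "dg (cosk m T) k i \<in> hom (lev (cosk m T) k) (lev (cosk m T) (Suc k))" if "i \<le> k" for k i
    using that by (auto simp: hom_def cosk_simps simplex_maps_codegen codegen intro!: restrict_ext)
  show "fc (cosk m T) (Suc k) i (fc (cosk m T) (Suc (Suc k)) j f) =
      fc (cosk m T) (Suc k) (j - 1) (fc (cosk m T) (Suc (Suc k)) i f)" if "i < j" for k i j f
  proof -
    have "coface j \<circ> coface i = coface i \<circ> coface (j - 1)"
      using that by (auto simp: coface_def fun_eq_iff)
    then show ?thesis
      by (auto simp: cosk_simps map_coface_simplex)
  qed
  show "fc (cosk m T) (Suc (Suc k)) i (dg (cosk m T) (Suc k) j f) =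
      dg (cosk m T) k (j - 1) (fc (cosk m T) (Suc k) i f)" if "i < j" "j \<le> Suc k" for k i j f
  proof -
    have "codegen j \<circ> coface i = coface i \<circ> codegen (j - 1)"
      using that by (auto simp: coface_def codegen_def fun_eq_iff)
    then show ?thesis
      using that by (auto simp: cosk_simps map_coface_simplex codegen)
  qed
  show "fc (cosk m T) (Suc k) j (dg (cosk m T) k j f) = f"
    "fc (cosk m T) (Suc k) (Suc j) (dg (cosk m T) k j f) = f"
    if "f \<in> elts (cosk m T) k" for k j f
  proof -
    have "codegen j \<circ> coface j = id" "codegen j \<circ> coface (Suc j) = id"
      by (auto simp: coface_def codegen_def fun_eq_iff)
    moreover have "f \<in> extensional (simplices m k)"
      using that simplex_maps_extensional by (simp add: cosk_simps)
    ultimately show "fc (cosk m T) (Suc k) j (dg (cosk m T) k j f) = f"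
      "fc (cosk m T) (Suc k) (Suc j) (dg (cosk m T) k j f) = f"
      by (auto simp: cosk_simps map_coface_simplex extensional_restrict[symmetric] cong: restrict_cong
          intro!: extensionalityI[of _ "simplices m k"])
  qed
  show "fc (cosk m T) (Suc (Suc k)) i (dg (cosk m T) (Suc k) j f) =
      dg (cosk m T) k j (fc (cosk m T) (Suc k) (i - 1) f)" if "Suc j < i" "i \<le> Suc (Suc k)" for k i j f
  proof -
    have "codegen j \<circ> coface i = coface (i - 1) \<circ> codegen j"
      using that by (auto simp: coface_def codegen_def fun_eq_iff)
    then show ?thesis
      using that by (auto simp: cosk_simps map_coface_simplex codegen)
  qed
  show "dg (cosk m T) (Suc k) i (dg (cosk m T) k j f) = dg (cosk m T) (Suc k) (Suc j) (dg (cosk m T) k i f)"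
    if "i \<le> j" "j \<le> k" for k i j f
  proof -
    have "codegen j \<circ> codegen i = codegen i \<circ> codegen (Suc j)"
      using that by (auto simp: codegen_def fun_eq_iff)
    then show ?thesis
      using that by (auto simp: cosk_simps codegen)
  qed
qed

lemma cosk_arr_simplicial_hom:
  assumes T': "truncated_groups m T'"
    and hom: "\<And>j. j \<le> m \<Longrightarrow> t j \<in> hom (lev T j) (lev T' j)"
    and fc: "\<And>j i x. j < m \<Longrightarrow> i \<le> Suc j \<Longrightarrow> x \<in> elts T (Suc j) \<Longrightarrow>
      t j (fc T (Suc j) i x) = fc T' (Suc j) i (t (Suc j) x)"
    and dg: "\<And>j i x. j < m \<Longrightarrow> i \<le> j \<Longrightarrow> x \<in> elts T j \<Longrightarrow> t (Suc j) (dg T j i x) = dg T' j i (t j x)"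
  shows "cosk_arr m T t \<in> simplicial_hom (cosk m T) (cosk m T')"
proof -
  interpret T': truncated_groups m T' by fact
  have closed: "t (sdim \<sigma>) x \<in> elts T' (sdim \<sigma>)" if "\<sigma> \<in> simplices m k" "x \<in> elts T (sdim \<sigma>)" for \<sigma> k x
    using hom[OF simplices_sdim[OF that(1)]] that(2) by (rule hom_in_carrier)
  have mult: "t (sdim \<sigma>) (x \<otimes>\<^bsub>lev T (sdim \<sigma>)\<^esub> y) = t (sdim \<sigma>) x \<otimes>\<^bsub>lev T' (sdim \<sigma>)\<^esub> t (sdim \<sigma>) y"
    if "\<sigma> \<in> simplices m k" "x \<in> elts T (sdim \<sigma>)" "y \<in> elts T (sdim \<sigma>)" for \<sigma> k x y
    using hom_mult[OF hom[OF simplices_sdim[OF that(1)]]] that by simp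
  have "t (sdim (sface i \<sigma>)) (f (sface i \<sigma>)) = fc T' (sdim \<sigma>) i (t (sdim \<sigma>) (f \<sigma>))"
    if f: "f \<in> simplex_maps m T k" and \<sigma>: "\<sigma> \<in> simplices m k" "i \<le> sdim \<sigma>" "1 \<le> sdim \<sigma>" for f k \<sigma> i
  proof -
    obtain j where "sdim \<sigma> = Suc j"
      using \<sigma> by (cases "sdim \<sigma>") auto
    then show ?thesis
      using fc[of j i "f \<sigma>"] \<sigma> simplices_sdim[OF \<sigma>(1)] simplex_maps_in[OF f \<sigma>(1)] simplex_maps_face[OF f \<sigma>]
      by (simp add: sface_simplex)
  qed
  moreover have "t (sdim (sdegen i \<sigma>)) (f (sdegen i \<sigma>)) = dg T' (sdim \<sigma>) i (t (sdim \<sigma>) (f \<sigma>))"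
    if f: "f \<in> simplex_maps m T k" and \<sigma>: "\<sigma> \<in> simplices m k" "i \<le> sdim \<sigma>" "Suc (sdim \<sigma>) \<le> m" for f k \<sigma> i
    using dg[of "sdim \<sigma>" i "f \<sigma>"] \<sigma> simplex_maps_in[OF f \<sigma>(1)] simplex_maps_degen[OF f \<sigma>(1,2)]
    by (simp add: sdegen_simplex)
  ultimately have maps: "cosk_arr m T t k f \<in> simplex_maps m T' k" if "f \<in> simplex_maps m T k" for f k
    using that closed simplex_maps_in[OF that]
    by (simp add: cosk_arr_def cosk_simps simplex_maps_def sface_simplex(1) sdegen_simplex(1))
  have eq: "cosk_arr m T t k f \<sigma> = t (sdim \<sigma>) (f \<sigma>)" if "f \<in> simplex_maps m T k" "\<sigma> \<in> simplices m k" for f k \<sigma>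
    using that by (simp add: cosk_arr_def cosk_simps)
  have arr: "cosk_arr m T t k f = (\<lambda>\<sigma>\<in>simplices m k. t (sdim \<sigma>) (f \<sigma>))" if "f \<in> simplex_maps m T k" for k f
    using that by (simp add: cosk_arr_def cosk_simps)
  show ?thesis
    unfolding simplicial_hom_def
  proof (intro CollectI conjI allI ballI impI IntI homI)
    fix k f assume "f \<in> elts (cosk m T) k"
    then show "cosk_arr m T t k f \<in> elts (cosk m T') k"
      using maps by (simp add: cosk_simps T'.cosk_simps)
  next
    fix k f g assume fg: "f \<in> elts (cosk m T) k" "g \<in> elts (cosk m T) k"
    then have "f \<otimes>\<^bsub>lev (cosk m T) k\<^esub> g \<in> simplex_maps m T k"
      using monoid.m_closed[OF group.is_monoid[OF group_cosk]] cosk_simps(1) by blast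
    then show "cosk_arr m T t k (f \<otimes>\<^bsub>lev (cosk m T) k\<^esub> g) =
        cosk_arr m T t k f \<otimes>\<^bsub>lev (cosk m T') k\<^esub> cosk_arr m T t k g"
      using fg simplex_maps_in[of f m T k] simplex_maps_in[of g m T k]
      by (simp add: arr) (auto simp: arr cosk_simps T'.cosk_simps mult)
  next
    show "cosk_arr m T t k \<in> extensional (elts (cosk m T) k)" for k
      by (simp add: cosk_arr_def)
  next
    fix k i f assume "f \<in> elts (cosk m T) (Suc k)"
    then show "cosk_arr m T t k (fc (cosk m T) (Suc k) i f) =
        fc (cosk m T') (Suc k) i (cosk_arr m T t (Suc k) f)"
      by (auto simp: arr cosk_simps T'.cosk_simps simplex_maps_coface map_coface_simplex)
  next
    fix k i f assume "f \<in> elts (cosk m T) k" "i \<le> k"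
    then show "cosk_arr m T t (Suc k) (dg (cosk m T) k i f) = dg (cosk m T') k i (cosk_arr m T t k f)"
      by (auto simp: arr cosk_simps T'.cosk_simps simplex_maps_codegen map_codegen_simplex)
  qed
qed

end

section \<open>The truncated groups k(A,n) and the functor K(_,n)\<close>

lemma em_trunc_simps:
  "j \<le> Suc n \<Longrightarrow> lev (em_trunc A n) j = em_lev A n j"
  "fc (em_trunc A n) (Suc n) i v =
    (\<lambda>_\<in>{..<1}. if i = 0 then v 0 else if i = Suc n then v n else v (i - 1) \<otimes>\<^bsub>A\<^esub> v i)"
  "j < n \<Longrightarrow> fc (em_trunc A n) (Suc j) i v = \<one>\<^bsub>em_lev A n j\<^esub>"
  "dg (em_trunc A n) n i v = (\<lambda>j\<in>{..<Suc n}. if j = i then v 0 else \<one>\<^bsub>A\<^esub>)"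
  "j < n \<Longrightarrow> dg (em_trunc A n) j i v = \<one>\<^bsub>em_lev A n (Suc j)\<^esub>"
  by (simp_all add: em_trunc_def trunc_def)

lemma em_lev_simps:
  "carrier (em_lev A n k) = (\<Pi>\<^sub>E i\<in>{..<em_rank n k}. carrier A)"
  "\<one>\<^bsub>em_lev A n k\<^esub> = (\<lambda>i\<in>{..<em_rank n k}. \<one>\<^bsub>A\<^esub>)"
  "v \<otimes>\<^bsub>em_lev A n k\<^esub> w = (\<lambda>i\<in>{..<em_rank n k}. v i \<otimes>\<^bsub>A\<^esub> w i)"
  by (simp_all add: em_lev_def)

lemma group_em_lev: "group A \<Longrightarrow> group (em_lev A n k)"
  by (simp add: em_lev_def)

lemma em_rank_simps [simp]:
  "em_rank n n = 1" "em_rank n (Suc n) = Suc n" "j < n \<Longrightarrow> em_rank n j = 0"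
  by (simp_all add: em_rank_def)

lemma em_dim_cases [consumes 1]:
  assumes "\<sigma> \<in> simplices (enat (n + 1)) k"
  obtains "sdim \<sigma> < n" | "sdim \<sigma> = n" | "sdim \<sigma> = Suc n"
  using simplices_sdim[OF assms] by fastforce

locale em_sgrp =
  fixes A :: "'a monoid" and n :: nat
  assumes comm_group: "comm_group A"
begin

sublocale A: comm_group A
  by (rule comm_group)

sublocale truncated_groups "n + 1" "em_trunc A n"
proof (rule truncated_groups.intro)
  show "group (lev (em_trunc A n) j)" if "j \<le> n + 1" for j
    using that by (simp add: em_trunc_simps group_em_lev A.is_group)
  show "fc (em_trunc A n) (Suc j) i \<in> hom (lev (em_trunc A n) (Suc j)) (lev (em_trunc A n) j)"
    if j: "j < n + 1" and i: "i \<le> Suc j" for i j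
  proof (cases "j = n")
    case True
    have closed: "v l \<in> carrier A" if "v \<in> elts (em_trunc A n) (Suc n)" "l \<le> n" for v l
      using that PiE_mem[of v "{..<Suc n}" _ l]
      by (simp add: em_trunc_simps em_lev_simps del: lessThan_Suc)
    define d where "d v = (if i = 0 then v 0 else if i = Suc n then v n else v (i - 1) \<otimes>\<^bsub>A\<^esub> v i)" for v
    have fc: "fc (em_trunc A n) (Suc n) i v = (\<lambda>_\<in>{..<1}. d v)" for v
      by (simp add: em_trunc_simps d_def)
    have i: "i \<le> Suc n" using i True by simp
    show ?thesis
      unfolding True fc
    proof (rule homI)
      fix v assume v: "v \<in> elts (em_trunc A n) (Suc n)"
      have "d v \<in> carrier A"
        using closed[OF v] i by (auto simp: d_def)
      then show "(\<lambda>_\<in>{..<1}. d v) \<in> elts (em_trunc A n) n"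
        by (simp add: em_trunc_simps em_lev_simps restrict_PiE_iff)
      fix w assume w: "w \<in> elts (em_trunc A n) (Suc n)"
      let ?vw = "v \<otimes>\<^bsub>lev (em_trunc A n) (Suc n)\<^esub> w"
      have "?vw l = v l \<otimes>\<^bsub>A\<^esub> w l" if "l \<le> n" for l
        using that by (simp add: em_trunc_simps em_lev_simps)
      \<comment> \<open>The middle faces add two projections, which is a homomorphism because
        \<open>A\<close> is commutative.\<close>
      then have "d ?vw = d v \<otimes>\<^bsub>A\<^esub> d w"
        using closed[OF v] closed[OF w] i by (simp add: d_def A.m_ac)
      then show "(\<lambda>_\<in>{..<1}. d ?vw) =
          (\<lambda>_\<in>{..<1}. d v) \<otimes>\<^bsub>lev (em_trunc A n) n\<^esub> (\<lambda>_\<in>{..<1}. d w)"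
        by (auto simp: em_trunc_simps(1) em_lev_simps intro!: restrict_ext)
    qed
  next
    case False
    then have "j < n" using j by simp
    then show ?thesis
      by (intro homI) (simp_all add: em_trunc_simps em_lev_simps restrict_def)
  qed
  show "dg (em_trunc A n) j i \<in> hom (lev (em_trunc A n) j) (lev (em_trunc A n) (Suc j))"
    if j: "j < n + 1" and i: "i \<le> j" for i j
  proof (cases "j = n")
    case True
    have elts: "v 0 \<in> carrier A" if "v \<in> elts (em_trunc A n) n" for v
      using that by (auto simp: em_trunc_simps em_lev_simps)
    show ?thesis
      unfolding True
    proof (rule homI)
      fix v assume "v \<in> elts (em_trunc A n) n"
      then show "dg (em_trunc A n) n i v \<in> elts (em_trunc A n) (Suc n)"
        using elts by (simp add: em_trunc_simps em_lev_simps restrict_PiE_iff del: lessThan_Suc)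
    next
      fix v w assume "v \<in> elts (em_trunc A n) n" "w \<in> elts (em_trunc A n) n"
      then show "dg (em_trunc A n) n i (v \<otimes>\<^bsub>lev (em_trunc A n) n\<^esub> w) =
          dg (em_trunc A n) n i v \<otimes>\<^bsub>lev (em_trunc A n) (Suc n)\<^esub> dg (em_trunc A n) n i w"
        by (simp add: em_trunc_simps em_lev_simps del: lessThan_Suc) (rule restrict_ext, simp)
    qed
  next
    case False
    then have "j < n" using j by simp
    then show ?thesis
      by (intro homI) (auto simp: em_trunc_simps em_lev_simps intro!: restrict_ext)
  qed
qed

lemma em_trunc_arr_simplicial_hom:
  assumes "comm_group B" and h: "h \<in> hom A B"
  shows "cosk_arr (n + 1) (em_trunc A n) (em_trunc_arr n h) \<in>
    simplicial_hom (cosk (n + 1) (em_trunc A n)) (cosk (n + 1) (em_trunc B n))"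
proof -
  interpret B: em_sgrp B n by (rule em_sgrp.intro[OF assms(1)])
  have closed: "h a \<in> carrier B" if "a \<in> carrier A" for a
    using h that by (rule hom_in_carrier)
  have mult: "h (a \<otimes>\<^bsub>A\<^esub> b) = h a \<otimes>\<^bsub>B\<^esub> h b" if "a \<in> carrier A" "b \<in> carrier A" for a b
    using h that by (rule hom_mult)
  have one: "h \<one>\<^bsub>A\<^esub> = \<one>\<^bsub>B\<^esub>"
    using h A.is_group B.A.is_group by (rule hom_one)
  show ?thesis
  proof (rule cosk_arr_simplicial_hom)
    show "truncated_groups (n + 1) (em_trunc B n)" ..
    show "em_trunc_arr n h j \<in> hom (lev (em_trunc A n) j) (lev (em_trunc B n) j)" if "j \<le> n + 1" for j
      using that by (intro homI) (auto simp: em_trunc_simps em_lev_simps em_trunc_arr_def closed mult PiE_iff fun_eq_iff)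
    show "em_trunc_arr n h j (fc (em_trunc A n) (Suc j) i v) =
        fc (em_trunc B n) (Suc j) i (em_trunc_arr n h (Suc j) v)"
      if "j < n + 1" "i \<le> Suc j" "v \<in> elts (em_trunc A n) (Suc j)" for j i v
    proof (cases "j = n")
      case True
      then show ?thesis
        using that by (auto simp: em_trunc_simps em_lev_simps em_trunc_arr_def mult PiE_iff fun_eq_iff)
    next
      case False
      then have "j < n" using that(1) by simp
      then show ?thesis
        by (simp add: em_trunc_simps em_lev_simps em_trunc_arr_def restrict_def)
    qed
    show "em_trunc_arr n h (Suc j) (dg (em_trunc A n) j i v) =
        dg (em_trunc B n) j i (em_trunc_arr n h j v)"
      if "j < n + 1" "i \<le> j" "v \<in> elts (em_trunc A n) j" for j i v
    proof (cases "j = n")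
      case True
      then show ?thesis
        using that by (auto simp: em_trunc_simps em_lev_simps em_trunc_arr_def one fun_eq_iff)
    next
      case False
      then have "j < n" using that(1) by simp
      then show ?thesis
        by (simp add: em_trunc_simps em_lev_simps em_trunc_arr_def one cong: restrict_cong)
    qed
  qed
qed

lemma em_maps_in:
  assumes "f \<in> simplex_maps (enat (n + 1)) (em_trunc A n) k" "\<sigma> \<in> simplices (enat (n + 1)) k"
  shows "f \<sigma> \<in> (\<Pi>\<^sub>E i\<in>{..<em_rank n (sdim \<sigma>)}. carrier A)"
  using simplex_maps_in[OF assms] simplices_sdim[OF assms(2)] by (simp add: em_trunc_simps em_lev_simps)

end

lemma is_functor_K_functor: "is_functor Ab SimpGrp (K_functor n)"
  unfolding is_functor_def
proof (intro conjI ballI)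
  let ?K = "K_functor n"
  have ext: "Farr ?K A B h k \<in> extensional (elts (Fobj ?K A) k)" for A B h k
    by (simp add: K_functor_def cosk_arr_def)
  have Obj: "comm_group A" if "A \<in> Obj Ab" for A
    using that by (simp add: Ab_def full_subcat_def)
  {
    fix A assume "A \<in> Obj Ab"
    then interpret A: em_sgrp A n by (rule em_sgrp.intro[OF Obj])
    show "Fobj ?K A \<in> Obj SimpGrp"
      using A.simplicial_group_cosk by (simp add: K_functor_def SimpGrp_def)
    have "Farr ?K A A (\<lambda>x\<in>carrier A. x) k = simplicial_id (Fobj ?K A) k" for k
    proof (rule extensionalityI[OF ext])
      fix f assume "f \<in> elts (Fobj ?K A) k"
      then have f: "f \<in> simplex_maps (enat (n + 1)) (em_trunc A n) k"
        by (simp add: K_functor_def A.cosk_simps[simplified])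
      have "em_trunc_arr n (\<lambda>x\<in>carrier A. x) (sdim \<sigma>) (f \<sigma>) = f \<sigma>" if "\<sigma> \<in> simplices (enat (n + 1)) k" for \<sigma>
        using A.em_maps_in[OF f that]
        by (intro extensionalityI[of _ "{..<em_rank n (sdim \<sigma>)}"]) (auto simp: em_trunc_arr_def PiE_iff)
      then have "cosk_arr (n + 1) (em_trunc A n) (em_trunc_arr n (\<lambda>x\<in>carrier A. x)) k f = f"
        using f simplex_maps_extensional[OF f]
        by (intro extensionalityI[of _ "simplices (enat (n + 1)) k"])
          (auto simp: cosk_arr_def A.cosk_simps[simplified])
      then show "Farr ?K A A (\<lambda>x\<in>carrier A. x) k f = simplicial_id (Fobj ?K A) k f"
        using f by (simp add: K_functor_def simplicial_id_def A.cosk_simps[simplified])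
    qed (simp add: simplicial_id_def)
    then show "Farr ?K A A (Idn Ab A) = Idn SimpGrp (Fobj ?K A)"
      by (simp add: Ab_def full_subcat_def Grp_def SimpGrp_def fun_eq_iff)
  next
    fix A B h assume AB: "A \<in> Obj Ab" "B \<in> Obj Ab" and "h \<in> Hom Ab A B"
    then have h: "h \<in> hom A B"
      by (simp add: Ab_def full_subcat_def Grp_def)
    interpret A: em_sgrp A n by (rule em_sgrp.intro[OF Obj[OF AB(1)]])
    show "Farr ?K A B h \<in> Hom SimpGrp (Fobj ?K A) (Fobj ?K B)"
      using A.em_trunc_arr_simplicial_hom[OF Obj[OF AB(2)] h] by (simp add: K_functor_def SimpGrp_def)
  next
    fix A B C h g assume AB: "A \<in> Obj Ab" "B \<in> Obj Ab" "C \<in> Obj Ab" and "h \<in> Hom Ab A B" "g \<in> Hom Ab B C"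
    then have h: "h \<in> hom A B"
      by (simp add: Ab_def full_subcat_def Grp_def)
    interpret A: em_sgrp A n by (rule em_sgrp.intro[OF Obj[OF AB(1)]])
    interpret B: em_sgrp B n by (rule em_sgrp.intro[OF Obj[OF AB(2)]])
    have "Farr ?K A C (compose (carrier A) g h) k =
        simplicial_comp (Fobj ?K A) (Farr ?K B C g) (Farr ?K A B h) k" for k
    proof (rule extensionalityI[OF ext])
      fix f assume f: "f \<in> elts (Fobj ?K A) k"
      then have f': "f \<in> simplex_maps (enat (n + 1)) (em_trunc A n) k"
        by (simp add: K_functor_def A.cosk_simps[simplified])
      have "Farr ?K A B h k f \<in> elts (Fobj ?K B) k"
        using simplicial_hom_closed[OF A.em_trunc_arr_simplicial_hom[OF Obj[OF AB(2)] h]] f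
        by (simp add: K_functor_def)
      moreover have "em_trunc_arr n (compose (carrier A) g h) (sdim \<sigma>) (f \<sigma>) =
          em_trunc_arr n g (sdim \<sigma>) (em_trunc_arr n h (sdim \<sigma>) (f \<sigma>))"
        if "\<sigma> \<in> simplices (enat (n + 1)) k" for \<sigma>
        using A.em_maps_in[OF f' that] by (auto simp: em_trunc_arr_def compose_def PiE_iff)
      ultimately show "Farr ?K A C (compose (carrier A) g h) k f =
          simplicial_comp (Fobj ?K A) (Farr ?K B C g) (Farr ?K A B h) k f"
        using f by (auto simp: K_functor_def simplicial_comp_def compose_def cosk_arr_def)
    qed (simp add: simplicial_comp_def compose_def)
    then show "Farr ?K A C (Cmp Ab A B C g h) =
        Cmp SimpGrp (Fobj ?K A) (Fobj ?K B) (Fobj ?K C) (Farr ?K B C g) (Farr ?K A B h)"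
      by (simp add: Ab_def full_subcat_def Grp_def SimpGrp_def fun_eq_iff)
  }
qed

section \<open>The two isomorphisms\<close>

lemma (in normal) coset_eq_self_iff: "x \<in> carrier G \<Longrightarrow> H #> x = H \<longleftrightarrow> x \<in> H"
  using coset_join1[OF _ _ is_subgroup] coset_join2[OF _ is_subgroup] by blast

lemma is_functor_comp_functor:
  "is_functor C D F \<Longrightarrow> is_functor D E G \<Longrightarrow> is_functor C E (G \<circ>\<^sub>F F)"
  by (simp add: is_functor_def comp_functor_def)

text \<open>Both isomorphisms are reduced to a natural family \<phi> of surjections defined on
  elements of \<open>P X\<close>, with kernel \<open>Q X\<close>; naturality on cosets is then
  evaluation at a representative.\<close>

lemma (in quotient_functor) naturally_isomorphic_quot_functor:
  fixes G :: "('a sgrp, nat \<Rightarrow> 'a \<Rightarrow> 'a, 'q sgrp, nat \<Rightarrow> 'q \<Rightarrow> 'q) func"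
  assumes G: "is_functor SimpGrp SimpGrp G"
    and hom: "\<And>(X :: 'a sgrp) k. simplicial_group X \<Longrightarrow>
      \<phi> X k \<in> hom ((lev X k)\<lparr>carrier := P X k\<rparr>) (lev (Fobj G X) k)"
    and fc: "\<And>(X :: 'a sgrp) k i x. simplicial_group X \<Longrightarrow> i \<le> Suc k \<Longrightarrow> x \<in> P X (Suc k) \<Longrightarrow>
      \<phi> X k (fc X (Suc k) i x) = fc (Fobj G X) (Suc k) i (\<phi> X (Suc k) x)"
    and dg: "\<And>(X :: 'a sgrp) k i x. simplicial_group X \<Longrightarrow> i \<le> k \<Longrightarrow> x \<in> P X k \<Longrightarrow>
      \<phi> X (Suc k) (dg X k i x) = dg (Fobj G X) k i (\<phi> X k x)"
    and surj: "\<And>(X :: 'a sgrp) k. simplicial_group X \<Longrightarrow> elts (Fobj G X) k \<subseteq> \<phi> X k ` P X k"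
    and kernel: "\<And>(X :: 'a sgrp) k x. simplicial_group X \<Longrightarrow> x \<in> P X k \<Longrightarrow>
      \<phi> X k x = \<one>\<^bsub>lev (Fobj G X) k\<^esub> \<longleftrightarrow> x \<in> Q X k"
    and natural: "\<And>(X :: 'a sgrp) Y f k x. simplicial_group X \<Longrightarrow> simplicial_group Y \<Longrightarrow>
      f \<in> simplicial_hom X Y \<Longrightarrow> x \<in> P X k \<Longrightarrow> \<phi> Y k (f k x) = Farr G X Y f k (\<phi> X k x)"
  shows "naturally_isomorphic SimpGrp (quot_functor P Q) G"
proof -
  let ?q = "\<lambda>X k x. Q X k #>\<^bsub>lev X k\<^esub> x"
  have "\<exists>\<eta>. simplicial_iso (quot_sgrp X (P X) (Q X)) (Fobj G X) \<eta> \<and>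
      (\<forall>k. \<forall>x\<in>P X k. \<eta> k (?q X k x) = \<phi> X k x)" if X: "simplicial_group X" for X
  proof -
    interpret X: sgroup_quotient X "P X" "Q X" by (rule quot[OF X])
    have Y: "simplicial_group (Fobj G X)"
      using G X by (simp add: is_functor_def SimpGrp_def)
    obtain \<eta> where "simplicial_iso (quot_sgrp X (P X) (Q X)) (Fobj G X) \<eta>"
      "\<And>k x. x \<in> P X k \<Longrightarrow> \<eta> k (?q X k x) = \<phi> X k x"
      using X.quot_iso[OF Y hom[OF X] fc[OF X] dg[OF X] surj[OF X] kernel[OF X]] by blast
    then show ?thesis by blast
  qed
  then obtain \<eta> where iso: "\<And>X. simplicial_group X \<Longrightarrow>
      simplicial_iso (quot_sgrp X (P X) (Q X)) (Fobj G X) (\<eta> X)"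
    and \<eta>: "\<And>X k x. simplicial_group X \<Longrightarrow> x \<in> P X k \<Longrightarrow> \<eta> X k (?q X k x) = \<phi> X k x"
    by metis
  have "simplicial_comp (quot_sgrp X (P X) (Q X)) (\<eta> Y) (Farr (quot_functor P Q) X Y f) =
      simplicial_comp (quot_sgrp X (P X) (Q X)) (Farr G X Y f) (\<eta> X)"
    if X: "simplicial_group X" and Y: "simplicial_group Y" and f: "f \<in> simplicial_hom X Y" for X Y f
  proof
    fix k
    interpret X: sgroup_quotient X "P X" "Q X" by (rule quot[OF X])
    have "\<eta> Y k (Farr (quot_functor P Q) X Y f k (?q X k x)) = Farr G X Y f k (\<eta> X k (?q X k x))"
      if x: "x \<in> P X k" for x
      by (simp add: quot_functor_coset[OF X Y f x] \<eta>[OF Y hom_P[OF X Y f x]] \<eta>[OF X x] natural[OF X Y f x])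
    then show "simplicial_comp (quot_sgrp X (P X) (Q X)) (\<eta> Y) (Farr (quot_functor P Q) X Y f) k =
        simplicial_comp (quot_sgrp X (P X) (Q X)) (Farr G X Y f) (\<eta> X) k"
      by (auto simp: simplicial_comp_def compose_def intro!: restrict_ext)
  qed
  moreover note is_functor_quot_functor
  moreover have "Fobj (quot_functor P Q) X = quot_sgrp X (P X) (Q X)" for X
    by (simp add: quot_functor_def)
  ultimately show ?thesis
    unfolding naturally_isomorphic_def using G iso
    by (auto simp: SimpGrp_def intro!: exI[of _ \<eta>])
qed

lemma (in sgroup) quotient_mu_le: "sgroup_quotient X (elts X) (mu_le n X)"
  unfolding mu_le_eq by (rule quotient_mu_le_faces)

lemma hom_mu_le:
  assumes "simplicial_group X" "simplicial_group Y" "f \<in> simplicial_hom X Y" "x \<in> mu_le n X k"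
  shows "f k x \<in> mu_le n Y k"
proof -
  interpret X: sgroup X by (rule sgroup.intro[OF assms(1)])
  interpret Y: sgroup Y by (rule sgroup.intro[OF assms(2)])
  have "f j ` mu_le_faces X n j \<subseteq> mu_le_faces Y n j" for j
    using simplicial_hom_one[OF assms(1-3)] X.hom_boundaries[OF assms(2,3)]
    by (auto simp: mu_le_faces_def)
  then show ?thesis
    using X.hom_faces_in[OF Y.sgroup_axioms assms(3), of "mu_le_faces X n" "mu_le_faces Y n" x n k] assms(4)
    by (simp add: X.mu_le_eq Y.mu_le_eq)
qed

lemma hom_mu_ge:
  assumes "simplicial_group X" "simplicial_group Y" "f \<in> simplicial_hom X Y" "x \<in> mu_ge n X k"
  shows "f k x \<in> mu_ge n Y k"
proof -
  interpret X: sgroup X by (rule sgroup.intro[OF assms(1)])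
  interpret Y: sgroup Y by (rule sgroup.intro[OF assms(2)])
  show ?thesis
    using X.hom_faces_in[OF Y.sgroup_axioms assms(3), of "\<lambda>j. {\<one>\<^bsub>lev X j\<^esub>}" "\<lambda>j. {\<one>\<^bsub>lev Y j\<^esub>}"] assms(4)
    by (simp add: X.mu_ge_eq Y.mu_ge_eq simplicial_hom_one[OF assms(1-3)])
qed

lemma quotient_functor_mu_le: "quotient_functor elts (mu_le n)"
proof (rule quotient_functor.intro)
  fix X Y :: "'a sgrp" and f k x
  assume X: "simplicial_group X"
  show "sgroup_quotient X (elts X) (mu_le n X)"
    by (rule sgroup.quotient_mu_le[OF sgroup.intro[OF X]])
  assume Y: "simplicial_group Y" and f: "f \<in> simplicial_hom X Y"
  show "f k x \<in> elts Y k" if "x \<in> elts X k"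
    by (rule simplicial_hom_closed[OF f that])
  show "f k x \<in> mu_le n Y k" if "x \<in> mu_le n X k"
    by (rule hom_mu_le[OF X Y f that])
qed

subsection \<open>The connected components\<close>

context sgroup
begin

text \<open>The edge [0,v] joins the two vertices. In degree 0 every element is a cycle, so
  \<open>last_face_mod_boundaries\<close> identifies the classes of its ends. For
  \<open>v = 0\<close> the edge is degenerate.\<close>

lemma vertices_connected:
  assumes x: "x \<in> elts X k" and v: "v \<le> k"
  shows "boundaries X 0 #>\<^bsub>lev X 0\<^esub> classifying_map X k x [v] =
    boundaries X 0 #>\<^bsub>lev X 0\<^esub> classifying_map X k x [0]"
proof -
  have \<sigma>: "[0, v] \<in> simplices \<infinity> k"
    using v by (simp add: simplices_iff)
  let ?e = "classifying_map X k x [0, v]"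
  have dim: "sdim [0, v] = Suc 0" "sface 0 [0, v] = [v]" "sface (Suc 0) [0, v] = [0]"
    by (simp_all add: sdim_def sface_def)
  have e: "?e \<in> elts X (Suc 0)"
    using classifying_map_in[OF x \<sigma>] dim by simp
  have "fc X (Suc 0) 0 ?e = classifying_map X k x [v]" "fc X (Suc 0) (Suc 0) ?e = classifying_map X k x [0]"
    using classifying_map_sface[OF x \<sigma>, of 0] classifying_map_sface[OF x \<sigma>, of "Suc 0"] dim by auto
  moreover have "fc X (Suc 0) (Suc 0) ?e \<otimes>\<^bsub>lev X 0\<^esub> inv\<^bsub>lev X 0\<^esub> fc X (Suc 0) 0 ?e \<in> boundaries X 0"
    using last_face_mod_boundaries[OF e] e by (simp add: cycles_0)
  moreover have "fc X (Suc 0) (Suc 0) ?e \<in> elts X 0" "fc X (Suc 0) 0 ?e \<in> elts X 0"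
    using e by simp_all
  ultimately have "boundaries X 0 #>\<^bsub>lev X 0\<^esub> classifying_map X k x [0] =
      boundaries X 0 #>\<^bsub>lev X 0\<^esub> classifying_map X k x [v]"
    by (simp add: normal.coset_eq_iff[OF boundaries_normal])
  then show ?thesis ..
qed

text \<open>Repeated application of s_0 does not change the vertex 0.\<close>

lemma vertex_surj:
  assumes "x \<in> elts X 0"
  shows "\<exists>y\<in>elts X k. classifying_map X k y [0] = x"
proof (induction k)
  case 0
  then show ?case
    using classifying_map_id[OF assms] assms by auto
next
  case (Suc k)
  then obtain y where y: "y \<in> elts X k" "classifying_map X k y [0] = x"
    by blast
  have "[0] \<in> simplices \<infinity> (Suc k)"
    by (simp add: simplices_iff)
  then have "classifying_map X (Suc k) (dg X k 0 y) [0] = x"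
    using classifying_map_dg[OF y(1), of 0 "[0]"] y(2) by (simp add: codegen_def)
  then show ?case
    using y(1) by (intro bexI[of _ "dg X k 0 y"]) auto
qed

end

lemma naturally_isomorphic_Pi_zero:
  "naturally_isomorphic (SimpGrp :: ('a sgrp, nat \<Rightarrow> 'a \<Rightarrow> 'a) cat) Pi_zero (Dis \<circ>\<^sub>F pi_functor 0)"
  unfolding Pi_zero_def
proof (rule quotient_functor.naturally_isomorphic_quot_functor[OF quotient_functor_mu_le, where
      \<phi> = "\<lambda>X k x. boundaries X 0 #>\<^bsub>lev X 0\<^esub> classifying_map X k x [0]"])
  let ?G = "Dis \<circ>\<^sub>F pi_functor 0"
  let ?c = "\<lambda>(X :: 'a sgrp) k x. boundaries X 0 #>\<^bsub>lev X 0\<^esub> classifying_map X k x [0]"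
  show "is_functor SimpGrp SimpGrp ?G"
    by (rule is_functor_comp_functor[OF is_functor_pi_functor_Grp is_functor_Dis])
  have vertex: "[v] \<in> simplices m k" "sdim [v] = 0" if "v \<le> k" for v m k
    using that by (simp_all add: simplices_iff sdim_def enat_0)
  fix X :: "'a sgrp" assume X: "simplicial_group X"
  interpret X: sgroup X by (rule sgroup.intro[OF X])
  have G: "lev (Fobj ?G X) k = homotopy_group 0 X" "fc (Fobj ?G X) k i C = C" "dg (Fobj ?G X) k i C = C"
    for k i C
    by (simp_all add: comp_functor_def Dis_def pi_functor_def)
  have closed: "classifying_map X k x [v] \<in> elts X 0" if "x \<in> elts X k" "v \<le> k" for k x v
    using X.classifying_map_in[OF that(1) vertex(1)[OF that(2), of \<infinity>]] by (simp add: sdim_def)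
  show "?c X k \<in>
      hom ((lev X k)\<lparr>carrier := elts X k\<rparr>) (lev (Fobj ?G X) k)" for k
    using closed X.classifying_map_mult[OF _ _ vertex(1)[of 0 k \<infinity>]]
    by (intro homI) (auto simp: G X.homotopy_group_simps X.cycles_0 sdim_def)
  show "elts (Fobj ?G X) k \<subseteq> ?c X k ` elts X k" for k
    using X.vertex_surj[of _ k] by (fastforce simp: G X.homotopy_group_simps X.cycles_0)
  {
    fix k i x assume i: "i \<le> Suc k" and x: "x \<in> elts X (Suc k)"
    \<comment> \<open>For \<open>i = 0\<close>, vertex 0 of d_i x is vertex 1 of x; its class is the
      same because all vertices of a simplex are connected.\<close>
    have "coface i 0 \<le> Suc k"
      by (simp add: coface_def)
    then show "?c X k (fc X (Suc k) i x) =
        fc (Fobj ?G X) (Suc k) i (?c X (Suc k) x)"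
      using X.classifying_map_fc[OF x i vertex(1)[of 0 k \<infinity>]] X.vertices_connected[OF x, of "coface i 0"]
      by (simp add: G)
  next
    fix k i x assume i: "i \<le> k" and x: "x \<in> elts X k"
    show "?c X (Suc k) (dg X k i x) =
        dg (Fobj ?G X) k i (?c X k x)"
      using X.classifying_map_dg[OF x i vertex(1)[of 0 "Suc k" \<infinity>]] by (simp add: G codegen_def)
  next
    fix k x assume x: "x \<in> elts X k"
    let ?B = "boundaries X 0" and ?x = "classifying_map X k x"
    note self = normal.coset_eq_self_iff[OF X.boundaries_normal[of 0]]
    have "x \<in> mu_le 0 X k \<longleftrightarrow> (\<forall>\<sigma>\<in>simplices 0 k. ?x \<sigma> \<in> ?B)"
      using x by (auto simp: X.mu_le_eq faces_in_def mu_le_faces_def simplices_iff zero_enat_def)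
    also have "\<dots> \<longleftrightarrow> (\<forall>v\<le>k. ?x [v] \<in> ?B)"
    proof
      assume *: "\<forall>v\<le>k. ?x [v] \<in> ?B"
      show "\<forall>\<sigma>\<in>simplices 0 k. ?x \<sigma> \<in> ?B"
      proof
        fix \<sigma> assume "\<sigma> \<in> simplices 0 k"
        then obtain v where "\<sigma> = [v]" "v \<le> k"
          by (cases \<sigma>) (auto simp: simplices_iff sdim_def zero_enat_def)
        then show "?x \<sigma> \<in> ?B"
          using * by simp
      qed
    qed (simp add: vertex)
    also have "\<dots> \<longleftrightarrow> ?x [0] \<in> ?B"
      using X.vertices_connected[OF x] self closed[OF x] by (metis le0)
    finally show "?c X k x = \<one>\<^bsub>lev (Fobj ?G X) k\<^esub> \<longleftrightarrow> x \<in> mu_le 0 X k"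
      using self closed[OF x] by (simp add: G X.homotopy_group_simps)
  }
  fix Y :: "'a sgrp" and f assume Y: "simplicial_group Y" and f: "f \<in> simplicial_hom X Y"
  interpret Y: sgroup Y by (rule sgroup.intro[OF Y])
  fix k x assume x: "x \<in> elts X k"
  have "classifying_map Y k (f k x) [0] = f 0 (classifying_map X k x [0])"
    using X.classifying_map_natural[OF Y.sgroup_axioms f x vertex(1)[of 0 k \<infinity>]] by (simp add: sdim_def)
  then show "?c Y k (f k x) =
      Farr ?G X Y f k (?c X k x)"
    using X.pi_functor_coset[OF Y f, of "classifying_map X k x [0]" 0] closed[OF x]
    by (simp add: comp_functor_def Dis_def X.cycles_0)
qed

subsection \<open>The higher homotopy groups\<close>

text \<open>Induction on the degree: an element is moved into the Moore complex by dividing out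
  degeneracies of its faces, and these lie in \<open>S\<close> because the lower degree
  does.\<close>

lemma (in sgroup) generated_by_moore:
  assumes S: "\<And>k. subgroup (S k) (lev X k)"
    and dg: "\<And>k i x. i \<le> k \<Longrightarrow> x \<in> S k \<Longrightarrow> dg X k i x \<in> S (Suc k)"
    and moore: "\<And>k. moore X k \<subseteq> S k"
  shows "elts X k \<subseteq> S k"
proof (induction k)
  case 0
  then show ?case
    using moore[of 0] by (simp add: moore_def)
next
  case (Suc k)
  show ?case
  proof
    fix y assume y: "y \<in> elts X (Suc k)"
    \<comment> \<open>The implication records that \<open>w\<close> differs from \<open>y\<close>
      only by factors in \<open>S\<close>.\<close>
    have "\<exists>w\<in>elts X (Suc k). (\<forall>i<j. fc X (Suc k) i w = \<one>\<^bsub>lev X k\<^esub>) \<and> (w \<in> S (Suc k) \<longrightarrow> y \<in> S (Suc k))"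
      if "j \<le> Suc k" for j
      using that
    proof (induction j)
      case 0
      then show ?case using y by auto
    next
      case (Suc j)
      then obtain w where w: "w \<in> elts X (Suc k)" "\<forall>i<j. fc X (Suc k) i w = \<one>\<^bsub>lev X k\<^esub>"
        "w \<in> S (Suc k) \<longrightarrow> y \<in> S (Suc k)" and j: "j \<le> k"
        by auto
      \<comment> \<open>Dividing by s_j d_j w removes face j. An earlier face i of this factor is
        s_(j-1) d_(j-1) d_i w, which is already trivial.\<close>
      let ?s = "dg X k j (fc X (Suc k) j w)"
      let ?w = "w \<otimes>\<^bsub>lev X (Suc k)\<^esub> inv\<^bsub>lev X (Suc k)\<^esub> ?s"
      have s: "?s \<in> S (Suc k)" "?s \<in> elts X (Suc k)"
        using dg[OF j subsetD[OF \<open>elts X k \<subseteq> S k\<close>]] w j by auto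
      have "fc X (Suc k) i ?w = \<one>\<^bsub>lev X k\<^esub>" if "i < Suc j" for i
      proof (cases "i = j")
        case True
        then show ?thesis using w j by simp
      next
        case False
        then have "i < j" using that by simp
        then obtain k' where k: "k = Suc k'"
          using j by (cases k) auto
        have "fc X (Suc k) i ?s = dg X k' (j - 1) (fc X k i (fc X (Suc k) j w))"
          using w j \<open>i < j\<close> k fc_dg_below[of "fc X (Suc k) j w" k' i j] by simp
        also have "fc X k i (fc X (Suc k) j w) = fc X k (j - 1) (fc X (Suc k) i w)"
          using w j \<open>i < j\<close> k fc_fc[of w k' i j] by simp
        finally show ?thesis
          using w j \<open>i < j\<close> k s by simp
      qed
      moreover have "?w \<in> S (Suc k) \<longrightarrow> y \<in> S (Suc k)"
      proof
        assume "?w \<in> S (Suc k)"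
        then have "?w \<otimes>\<^bsub>lev X (Suc k)\<^esub> ?s \<in> S (Suc k)"
          using s subgroup.m_closed[OF S] by blast
        then show "y \<in> S (Suc k)"
          using w s by (simp add: grp.m_assoc)
      qed
      ultimately show ?case
        using w s by (intro bexI[of _ ?w]) auto
    qed
    from this[of "Suc k"] obtain w where w: "w \<in> elts X (Suc k)"
      "\<forall>i<Suc k. fc X (Suc k) i w = \<one>\<^bsub>lev X k\<^esub>" "w \<in> S (Suc k) \<longrightarrow> y \<in> S (Suc k)"
      by auto
    then have "w \<in> moore X (Suc k)"
      by (simp add: moore_Suc)
    then show "y \<in> S (Suc k)"
      using moore w(3) by blast
  qed
qed

section \<open>Alternating products in abelian groups and rigidity of K(A,n)\<close>

context comm_group
begin

lemma alt_prod_closed [simp]: "(\<And>i. i \<le> j \<Longrightarrow> a i \<in> carrier G) \<Longrightarrow> alt_prod G a j \<in> carrier G"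
  using alt_prod_in_subgroup[OF subgroup_self] by blast

lemma alt_prod_mult:
  assumes "\<And>i. i \<le> j \<Longrightarrow> a i \<in> carrier G" "\<And>i. i \<le> j \<Longrightarrow> b i \<in> carrier G"
  shows "alt_prod G (\<lambda>i. a i \<otimes> b i) j = alt_prod G a j \<otimes> alt_prod G b j"
  using assms by (induction j) (simp_all add: inv_mult m_ac)

text \<open>These are the coordinates of a degenerate simplex: s_i of a cycle has that cycle as
  faces i and i + 1 and trivial faces elsewhere. Alternation leaves it in place i alone, matching
  the inclusion s_i in k(A,n).\<close>

lemma alt_prod_pair:
  "a \<in> carrier G \<Longrightarrow>
    alt_prod G (\<lambda>l. if l = i \<or> l = Suc i then a else \<one>) j = (if j = i then a else \<one>)"
  by (induction j) auto

lemma alt_prod_one: "alt_prod G (\<lambda>_. \<one>) j = \<one>"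
  by (induction j) auto

lemma alt_prod_hom:
  assumes "group H" "h \<in> hom G H" "\<And>i. i \<le> j \<Longrightarrow> a i \<in> carrier G"
  shows "h (alt_prod G a j) = alt_prod H (\<lambda>i. h (a i)) j"
proof -
  interpret H: group_hom G H h
    using assms by (simp add: group_hom_def group_hom_axioms_def is_group)
  show ?thesis
    using assms(3) by (induction j) auto
qed

end

context em_sgrp
begin

text \<open>The equations d_0 = p_0 and d_i = p_(i-1) + p_i are triangular, so the first n + 1 faces
  determine all coordinates.\<close>

lemma face_eq_imp_eq:
  assumes v: "v \<in> (\<Pi>\<^sub>E i\<in>{..<Suc n}. carrier A)" and w: "w \<in> (\<Pi>\<^sub>E i\<in>{..<Suc n}. carrier A)"
    and eq: "\<And>i. i \<le> n \<Longrightarrow> fc (em_trunc A n) (Suc n) i v = fc (em_trunc A n) (Suc n) i w"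
  shows "v = w"
proof (rule PiE_ext[OF v w])
  have closed: "v i \<in> carrier A" "w i \<in> carrier A" if "i \<le> n" for i
    using PiE_mem[OF v, of i] PiE_mem[OF w, of i] that by simp_all
  fix i assume "i \<in> {..<Suc n}"
  then have "i \<le> n" by simp
  then show "v i = w i"
  proof (induction i)
    case 0
    then show ?case
      using fun_cong[OF eq[of 0], of 0] by (simp add: em_trunc_simps)
  next
    case (Suc i)
    then have "v i \<otimes>\<^bsub>A\<^esub> v (Suc i) = w i \<otimes>\<^bsub>A\<^esub> w (Suc i)"
      using fun_cong[OF eq[OF Suc.prems], of 0] by (simp add: em_trunc_simps)
    then show ?case
      using Suc closed[of i] closed[of "Suc i"] by simp
  qed
qed

text \<open>Below dimension n all values are trivial, on degenerate n-simplices they come from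
  below, and in dimension n + 1 the faces determine them.\<close>

lemma em_maps_eqI:
  assumes f: "f \<in> simplex_maps (enat (n + 1)) (em_trunc A n) k"
    and g: "g \<in> simplex_maps (enat (n + 1)) (em_trunc A n) k"
    and eq: "\<And>\<sigma>. \<sigma> \<in> simplices (enat (n + 1)) k \<Longrightarrow> sdim \<sigma> = n \<Longrightarrow> distinct \<sigma> \<Longrightarrow> f \<sigma> = g \<sigma>"
  shows "f = g"
proof -
  have eq_n: "f \<sigma> = g \<sigma>" if \<sigma>: "\<sigma> \<in> simplices (enat (n + 1)) k" "sdim \<sigma> = n" for \<sigma>
  proof (cases "distinct \<sigma>")
    case False
    obtain i where i: "Suc i < length \<sigma>" "sdegen i (sface i \<sigma>) = \<sigma>"
      using non_distinct_is_degenerate[OF _ False] \<sigma>(1) unfolding simplices_iff by metis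
    then obtain m where m: "n = Suc m" "i \<le> m"
      using \<sigma> by (cases n) (auto simp: sdim_def)
    have face: "sface i \<sigma> \<in> simplices (enat (n + 1)) k" "sdim (sface i \<sigma>) = m"
      using sface_simplex[OF \<sigma>(1), of i] m \<sigma>(2) by auto
    show ?thesis
      using simplex_maps_degen[OF f face(1), of i] simplex_maps_degen[OF g face(1), of i] i m face(2)
      by (simp add: em_trunc_simps)
  qed (use eq \<sigma> in blast)
  have "f \<sigma> = g \<sigma>" if \<sigma>: "\<sigma> \<in> simplices (enat (n + 1)) k" for \<sigma>
  proof -
    from \<sigma> show ?thesis
    proof (cases rule: em_dim_cases)
      case 1
      then show ?thesis
        using em_maps_in[OF f \<sigma>] em_maps_in[OF g \<sigma>] by simp
    next
      case 3
      show ?thesis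
      proof (rule face_eq_imp_eq)
        show "f \<sigma> \<in> (\<Pi>\<^sub>E i\<in>{..<Suc n}. carrier A)" "g \<sigma> \<in> (\<Pi>\<^sub>E i\<in>{..<Suc n}. carrier A)"
          using em_maps_in[OF f \<sigma>] em_maps_in[OF g \<sigma>] 3 by (simp_all del: lessThan_Suc)
        show "fc (em_trunc A n) (Suc n) i (f \<sigma>) = fc (em_trunc A n) (Suc n) i (g \<sigma>)" if "i \<le> n" for i
          using simplex_maps_face[OF f \<sigma>, of i] simplex_maps_face[OF g \<sigma>, of i] that 3
            eq_n[of "sface i \<sigma>"] sface_simplex[OF \<sigma>, of i] by simp
      qed
    qed (use eq_n \<sigma> in blast)
  qed
  then show ?thesis
    by (rule extensionalityI[OF simplex_maps_extensional[OF f] simplex_maps_extensional[OF g]])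
qed

text \<open>For k < n there is no nondegenerate n-simplex. For k > n such a simplex lies in one of
  the first k facets, where \<open>f\<close> is trivial, unless it is the last facet of
  \<Delta>[n+1]. There the first n + 1 faces of the top value vanish, so by
  \<open>face_eq_imp_eq\<close> the top value vanishes, and with it the last face.\<close>

lemma moore_em:
  assumes "k \<noteq> n" and f: "f \<in> moore (cosk (n + 1) (em_trunc A n)) k"
  shows "f = \<one>\<^bsub>lev (cosk (n + 1) (em_trunc A n)) k\<^esub>"
proof -
  let ?K = "cosk (n + 1) (em_trunc A n)"
  interpret K: sgroup ?K by (rule sgroup.intro[OF simplicial_group_cosk])
  have f': "f \<in> simplex_maps (enat (n + 1)) (em_trunc A n) k"
    using f by (simp add: moore_def cosk_simps[simplified])
  have one: "\<one>\<^bsub>lev ?K k\<^esub> \<in> simplex_maps (enat (n + 1)) (em_trunc A n) k"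
    using K.grp.one_closed[of k] unfolding cosk_simps(1) .
  show ?thesis
  proof (rule em_maps_eqI[OF f' one])
    fix \<sigma> assume \<sigma>: "\<sigma> \<in> simplices (enat (n + 1)) k" "sdim \<sigma> = n" "distinct \<sigma>"
    have "length \<sigma> \<le> Suc k"
      using \<sigma> card_mono[of "{..k}" "set \<sigma>"] by (simp add: simplices_iff distinct_card)
    then obtain k' where k: "k = Suc k'" "n \<le> k'"
      using length_simplex[OF \<sigma>(1)] \<sigma>(2) assms(1) by (cases k) auto
    have fc_f: "fc ?K (Suc k') i f = \<one>\<^bsub>lev ?K k'\<^esub>" if "i \<le> k'" for i
      using f that unfolding k(1) K.moore_Suc by blast
    have face_one: "f (map (coface i) \<tau>) = \<one>\<^bsub>lev (em_trunc A n) (sdim \<tau>)\<^esub>"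
      if "i \<le> k'" "\<tau> \<in> simplices (enat (n + 1)) k'" for i \<tau>
      using fun_cong[OF fc_f[OF that(1)], of \<tau>] that(2) by (simp add: cosk_simps[simplified])
    have "f \<sigma> = \<one>\<^bsub>lev (em_trunc A n) n\<^esub>"
    proof (cases "{..<k} \<subseteq> set \<sigma>")
      case False
      then obtain i where i: "i < k" "i \<notin> set \<sigma>" by blast
      then obtain \<tau> where \<tau>: "\<tau> \<in> simplices (enat (n + 1)) k'" "\<sigma> = map (coface i) \<tau>"
        using missing_vertex_coface[of \<sigma> "enat (n + 1)" k' i] \<sigma>(1) k by auto
      then show ?thesis
        using face_one[of i \<tau>] i k \<sigma>(2) by simp
    next
      case True
      have id: "\<sigma> = [0..<k]"
        using True \<sigma> length_simplex[OF \<sigma>(1)] k by (intro sorted_eq_upt) (auto simp: simplices_iff)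
      then have "k' = n"
        using \<sigma>(2) k by (simp del: upt_Suc)
      let ?\<iota> = "[0..<Suc (Suc n)]" and ?o = "\<one>\<^bsub>em_lev A n (Suc n)\<^esub>"
      have \<iota>: "?\<iota> \<in> simplices (enat (n + 1)) k"
        using k \<open>k' = n\<close> by (simp add: upt_simplex del: upt_Suc)
      have o: "?o \<in> (\<Pi>\<^sub>E i\<in>{..<Suc n}. carrier A)"
        using monoid.one_closed[OF group.is_monoid[OF group_em_lev[OF A.is_group]], of n "Suc n"]
        by (simp add: em_lev_simps(1) del: lessThan_Suc)
      have o_fc: "fc (em_trunc A n) (Suc n) i ?o = \<one>\<^bsub>em_lev A n n\<^esub>" if "i \<le> Suc n" for i
        using that by (auto simp: em_trunc_simps em_lev_simps intro!: restrict_ext)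
      have "f ?\<iota> = ?o"
      proof (rule face_eq_imp_eq[OF _ o])
        show "f ?\<iota> \<in> (\<Pi>\<^sub>E i\<in>{..<Suc n}. carrier A)"
          using em_maps_in[OF f' \<iota>] by (simp del: upt_Suc lessThan_Suc)
        show "fc (em_trunc A n) (Suc n) i (f ?\<iota>) = fc (em_trunc A n) (Suc n) i ?o" if "i \<le> n" for i
          using simplex_maps_face[OF f' \<iota>, of i] face_one[of i "[0..<Suc n]"] that \<open>k' = n\<close> o_fc[of i]
          by (simp add: map_coface_upt upt_simplex em_trunc_simps(1) del: upt_Suc)
      qed
      moreover have "\<sigma> = sface (Suc n) ?\<iota>"
        using id k \<open>k' = n\<close> by (simp add: sface_def)
      ultimately show ?thesis
        using simplex_maps_face[OF f' \<iota>, of "Suc n"] o_fc[of "Suc n"]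
        by (simp add: em_trunc_simps(1) del: upt_Suc)
    qed
    then show "f \<sigma> = \<one>\<^bsub>lev ?K k\<^esub> \<sigma>"
      using \<sigma> by (simp add: cosk_simps[simplified])
  qed
qed

end

text \<open>An \<open>(n+1)\<close>-simplex with trivial \<open>(n-1)\<close>-faces is determined modulo \<open>\<mu>\<^bsub>n\<ge>\<^esub>\<close> by the classes
  \<open>a\<^sub>0, \<dots>, a\<^sub>n\<close> of its faces in \<open>\<pi>\<^sub>n\<close>. Solving \<open>a\<^sub>0 = p\<^sub>0\<close>, \<open>a\<^sub>j = p\<^sub>j\<^sub>-\<^sub>1 + p\<^sub>j\<close> for the coordinates
  \<open>p\<^sub>j\<close> of \<open>k(\<pi>\<^sub>n, n)\<close> gives alternating sums.\<close>

definition em_coords :: "'a sgrp \<Rightarrow> nat \<Rightarrow> nat \<Rightarrow> 'a \<Rightarrow> nat \<Rightarrow> 'a set" where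
  "em_coords X n j z = (\<lambda>i\<in>{..<em_rank n j}.
     if j = n then boundaries X n #>\<^bsub>lev X n\<^esub> z
     else alt_prod (homotopy_group n X) (\<lambda>l. boundaries X n #>\<^bsub>lev X n\<^esub> fc X (Suc n) l z) i)"

definition to_em :: "nat \<Rightarrow> 'a sgrp \<Rightarrow> nat \<Rightarrow> 'a \<Rightarrow> nat list \<Rightarrow> nat \<Rightarrow> 'a set" where
  "to_em n X k x = (\<lambda>\<sigma>\<in>simplices (enat (n + 1)) k. em_coords X n (sdim \<sigma>) (classifying_map X k x \<sigma>))"

section \<open>The comparison map to K(\<pi>_n,n)\<close>

locale sgroup_pi = sgroup X for X :: "'a sgrp" +
  fixes n :: nat
  assumes n_pos: "n \<ge> 1"
begin

abbreviation "\<pi> \<equiv> homotopy_group n X"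
abbreviation "B \<equiv> boundaries X n"
abbreviation "cls z \<equiv> B #>\<^bsub>lev X n\<^esub> z"
abbreviation "K \<equiv> cosk (n + 1) (em_trunc \<pi> n)"

lemma comm_group_pi: "comm_group \<pi>"
  using comm_group_homotopy_group[of "n - 1"] n_pos by simp

sublocale em: em_sgrp \<pi> n
  by (rule em_sgrp.intro[OF comm_group_pi])

sublocale K: sgroup K
  by (rule sgroup.intro[OF em.simplicial_group_cosk])

lemma cls_closed [simp]: "z \<in> cycles X n \<Longrightarrow> cls z \<in> carrier \<pi>"
  by (simp add: homotopy_group_simps)

lemma cls_one [simp]: "cls \<one>\<^bsub>lev X n\<^esub> = \<one>\<^bsub>\<pi>\<^esub>"
  using subgroup.one_closed[OF boundaries_subgroup]
  by (simp add: homotopy_group_simps normal.coset_eq_self_iff[OF boundaries_normal])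

lemma cls_eq_one_iff: "z \<in> cycles X n \<Longrightarrow> cls z = \<one>\<^bsub>\<pi>\<^esub> \<longleftrightarrow> z \<in> B"
  by (simp add: homotopy_group_simps normal.coset_eq_self_iff[OF boundaries_normal] cycles_closed)

lemma cls_mult:
  "y \<in> cycles X n \<Longrightarrow> z \<in> cycles X n \<Longrightarrow> cls (y \<otimes>\<^bsub>lev X n\<^esub> z) = cls y \<otimes>\<^bsub>\<pi>\<^esub> cls z"
  by (simp add: homotopy_group_simps cycles_closed)

text \<open>Passing to classes is multiplicative on cycles; in the abelian target the order of the
  factors no longer matters.\<close>

lemma cls_alt_prod:
  assumes "\<And>i. i \<le> j \<Longrightarrow> a i \<in> cycles X n"
  shows "cls (alt_prod (lev X n) a j) = alt_prod \<pi> (\<lambda>i. cls (a i)) j"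
  using assms
proof (induction j)
  case (Suc j)
  have p: "alt_prod (lev X n) a j \<in> cycles X n"
    using Suc.prems by (intro grp.alt_prod_in_subgroup cycles_subgroup) auto
  then have inv: "inv\<^bsub>lev X n\<^esub> alt_prod (lev X n) a j \<in> cycles X n"
    by (rule subgroup.m_inv_closed[OF cycles_subgroup])
  have "cls (inv\<^bsub>lev X n\<^esub> alt_prod (lev X n) a j) \<otimes>\<^bsub>\<pi>\<^esub> cls (alt_prod (lev X n) a j) = \<one>\<^bsub>\<pi>\<^esub>"
    using p inv cycles_closed by (simp flip: cls_mult)
  then have "cls (inv\<^bsub>lev X n\<^esub> alt_prod (lev X n) a j) = inv\<^bsub>\<pi>\<^esub> cls (alt_prod (lev X n) a j)"
    using p inv em.A.inv_equality by simp
  then show ?case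
    using Suc inv by (simp add: cls_mult)
qed simp

text \<open>This relation makes the last face p_n of k(\<pi>_n,n) agree with the class of the last
  face of \<open>z\<close>.\<close>

lemma alt_prod_faces:
  assumes z: "z \<in> elts X (Suc n)" and faces: "\<And>i. i \<le> Suc n \<Longrightarrow> fc X (Suc n) i z \<in> cycles X n"
  shows "alt_prod \<pi> (\<lambda>l. cls (fc X (Suc n) l z)) n = cls (fc X (Suc n) (Suc n) z)"
proof -
  have "alt_prod (lev X n) (\<lambda>i. fc X (Suc n) i z) n \<in> elts X n"
    using faces cycles_closed by (intro grp.alt_prod_in_subgroup grp.subgroup_self) auto
  then have "cls (fc X (Suc n) (Suc n) z) = cls (alt_prod (lev X n) (\<lambda>i. fc X (Suc n) i z) n)"
    using last_face_mod_boundaries[OF z] faces z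
    by (simp add: normal.coset_eq_iff[OF boundaries_normal])
  then show ?thesis
    using faces by (simp add: cls_alt_prod)
qed

context
  fixes k x
  assumes x: "x \<in> mu_ge n X k"
begin

lemma mu_ge_closed: "x \<in> elts X k"
  using x by (simp add: mu_ge_eq faces_in_def)

lemma classifying_map_low:
  "\<sigma> \<in> simplices m k \<Longrightarrow> sdim \<sigma> < n \<Longrightarrow> classifying_map X k x \<sigma> = \<one>\<^bsub>lev X (sdim \<sigma>)\<^esub>"
  using x by (auto simp: mu_ge_eq faces_in_def simplices_iff)

text \<open>The faces of an n-simplex of x have dimension n - 1 and are therefore trivial.\<close>

lemma classifying_map_cycle:
  assumes "\<sigma> \<in> simplices m k" "sdim \<sigma> = n"
  shows "classifying_map X k x \<sigma> \<in> cycles X n"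
proof -
  obtain j where n: "n = Suc j"
    using n_pos by (cases n) auto
  show ?thesis
    using classifying_map_in[OF mu_ge_closed assms(1)] classifying_map_sface[OF mu_ge_closed assms(1)]
      classifying_map_low[OF sface_simplex(1)[OF assms(1)]] assms(2) n
    by (auto simp: cycles_Suc sface_simplex[OF assms(1)])
qed

lemma fc_classifying_map_cycle:
  assumes "\<sigma> \<in> simplices m k" "sdim \<sigma> = Suc n" "i \<le> Suc n"
  shows "fc X (Suc n) i (classifying_map X k x \<sigma>) \<in> cycles X n"
  using classifying_map_cycle[OF sface_simplex(1)[OF assms(1)], of i] sface_simplex(2)[OF assms(1), of i]
    classifying_map_sface[OF mu_ge_closed assms(1), of i] assms by simp

lemma em_coords_closed:
  assumes "\<sigma> \<in> simplices (enat (n + 1)) k"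
  shows "em_coords X n (sdim \<sigma>) (classifying_map X k x \<sigma>) \<in> elts (em_trunc \<pi> n) (sdim \<sigma>)"
proof -
  from assms show ?thesis
  proof (cases rule: em_dim_cases)
    case 1
    then show ?thesis by (simp add: em_coords_def em_trunc_simps em_lev_simps restrict_def)
  next
    case 2
    then show ?thesis
      using classifying_map_cycle[OF assms]
      by (simp add: em_coords_def em_trunc_simps em_lev_simps restrict_PiE_iff)
  next
    case 3
    then show ?thesis
      using fc_classifying_map_cycle[OF assms]
      by (simp add: em_coords_def em_trunc_simps em_lev_simps restrict_PiE_iff del: lessThan_Suc)
  qed
qed

lemma em_coords_face:
  assumes \<sigma>: "\<sigma> \<in> simplices (enat (n + 1)) k" "i \<le> sdim \<sigma>" "1 \<le> sdim \<sigma>"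
  shows "em_coords X n (sdim \<sigma> - 1) (classifying_map X k x (sface i \<sigma>)) =
    fc (em_trunc \<pi> n) (sdim \<sigma>) i (em_coords X n (sdim \<sigma>) (classifying_map X k x \<sigma>))"
proof -
  obtain d where d: "sdim \<sigma> = Suc d" "d \<le> n"
    using \<sigma>(3) simplices_sdim[OF \<sigma>(1)] by (cases "sdim \<sigma>") auto
  show ?thesis
  proof (cases "d = n")
    case False
    then show ?thesis
      using d by (simp add: em_coords_def em_trunc_simps em_lev_simps restrict_def)
  next
    case True
    let ?z = "classifying_map X k x \<sigma>" and ?a = "\<lambda>l. cls (fc X (Suc n) l (classifying_map X k x \<sigma>))"
    have z: "?z \<in> elts X (Suc n)"
      using classifying_map_in[OF mu_ge_closed \<sigma>(1)] d True by simp
    have faces: "fc X (Suc n) l ?z \<in> cycles X n" if "l \<le> Suc n" for l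
      using fc_classifying_map_cycle[OF \<sigma>(1)] d True that by simp
    then have a: "?a l \<in> carrier \<pi>" if "l \<le> Suc n" for l
      using that by simp
    \<comment> \<open>Since p_i = a_i - p_(i-1), the sum p_(i-1) + p_i gives back a_i. For i = n + 1
      the claim is \<open>alt_prod_faces\<close>.\<close>
    have E: "(if i = 0 then alt_prod \<pi> ?a 0 else if i = Suc n then alt_prod \<pi> ?a n
        else alt_prod \<pi> ?a (i - 1) \<otimes>\<^bsub>\<pi>\<^esub> alt_prod \<pi> ?a i) = ?a i"
    proof (cases i)
      case (Suc i')
      show ?thesis
      proof (cases "i' = n")
        case True
        then show ?thesis
          using Suc alt_prod_faces[OF z faces] by simp
      next
        case False
        then have "alt_prod \<pi> ?a i' \<in> carrier \<pi>" "?a (Suc i') \<in> carrier \<pi>"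
          using a Suc \<sigma>(2) d by (auto intro!: em.A.alt_prod_closed)
        then show ?thesis
          using Suc False em.A.m_lcomm[of "alt_prod \<pi> ?a i'" "?a (Suc i')" "inv\<^bsub>\<pi>\<^esub> alt_prod \<pi> ?a i'"]
          by simp
      qed
    qed simp
    have v: "em_coords X n (Suc n) ?z j = alt_prod \<pi> ?a j" if "j \<le> n" for j
      using that by (simp add: em_coords_def)
    have "i \<le> Suc n"
      using \<sigma>(2) d True by simp
    then have "(if i = 0 then em_coords X n (Suc n) ?z 0 else if i = Suc n then em_coords X n (Suc n) ?z n
        else em_coords X n (Suc n) ?z (i - 1) \<otimes>\<^bsub>\<pi>\<^esub> em_coords X n (Suc n) ?z i) = ?a i"
      using E v[of 0] v[of n] v[of "i - 1"] v[of i] by (simp split: if_splits)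
    then have "em_coords X n n (fc X (Suc n) i ?z) =
        fc (em_trunc \<pi> n) (Suc n) i (em_coords X n (Suc n) ?z)"
      unfolding em_trunc_simps(2) by (simp only:) (simp add: em_coords_def)
    then show ?thesis
      using classifying_map_sface[OF mu_ge_closed \<sigma>] d True by simp
  qed
qed

lemma em_coords_degen:
  assumes \<sigma>: "\<sigma> \<in> simplices (enat (n + 1)) k" "i \<le> sdim \<sigma>" "sdim \<sigma> \<le> n"
  shows "em_coords X n (Suc (sdim \<sigma>)) (classifying_map X k x (sdegen i \<sigma>)) =
    dg (em_trunc \<pi> n) (sdim \<sigma>) i (em_coords X n (sdim \<sigma>) (classifying_map X k x \<sigma>))"
proof -
  let ?z = "classifying_map X k x \<sigma>"
  have dg: "classifying_map X k x (sdegen i \<sigma>) = dg X (sdim \<sigma>) i ?z"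
    by (rule classifying_map_sdegen[OF mu_ge_closed \<sigma>(1,2)])
  show ?thesis
  proof (cases "sdim \<sigma> = n")
    case False
    then have "?z = \<one>\<^bsub>lev X (sdim \<sigma>)\<^esub>"
      using classifying_map_low[OF \<sigma>(1)] \<sigma>(3) by simp
    then show ?thesis
      using False \<sigma>(2,3) unfolding dg
      by (cases "Suc (sdim \<sigma>) = n") (simp_all add: em_coords_def em_trunc_simps em_lev_simps restrict_def)
  next
    case True
    then have z: "?z \<in> cycles X n" "?z \<in> elts X n"
      using classifying_map_cycle[OF \<sigma>(1)] cycles_closed by auto
    have i: "i \<le> n"
      using True \<sigma>(2) by simp
    \<comment> \<open>Only faces i and i + 1 of s_i applied to a cycle can be nontrivial, so
      \<open>alt_prod_pair\<close> computes the coordinates.\<close>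
    have "cls (fc X (Suc n) l (dg X n i ?z)) = (if l = i \<or> l = Suc i then cls ?z else \<one>\<^bsub>\<pi>\<^esub>)"
      if "l \<le> Suc n" for l
      using z i that by (auto simp: fc_dg_cycle[OF z(1)])
    then have "alt_prod \<pi> (\<lambda>l. cls (fc X (Suc n) l (dg X n i ?z))) j = (if j = i then cls ?z else \<one>\<^bsub>\<pi>\<^esub>)"
      if "j < Suc n" for j
      using that alt_prod_cong[of j "\<lambda>l. cls (fc X (Suc n) l (dg X n i ?z))"
          "\<lambda>l. if l = i \<or> l = Suc i then cls ?z else \<one>\<^bsub>\<pi>\<^esub>" \<pi>] em.A.alt_prod_pair[OF cls_closed[OF z(1)], of i j]
      by simp
    then show ?thesis
      unfolding dg True
      by (simp add: em_coords_def em_trunc_simps del: lessThan_Suc cong: restrict_cong)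
        (rule restrict_ext, simp)
  qed
qed

lemma to_em_closed: "to_em n X k x \<in> simplex_maps (enat (n + 1)) (em_trunc \<pi> n) k"
  unfolding simplex_maps_def
  using em_coords_closed em_coords_face em_coords_degen
  by (auto simp: to_em_def sface_simplex sdegen_simplex)

text \<open>Triviality is decided in dimension n, where a class vanishes exactly on boundaries; the
  coordinates in dimension n + 1 are alternating products of such classes.\<close>

lemma to_em_eq_one_iff: "to_em n X k x = \<one>\<^bsub>lev K k\<^esub> \<longleftrightarrow> x \<in> mu_le n X k"
proof
  assume eq: "to_em n X k x = \<one>\<^bsub>lev K k\<^esub>"
  have "classifying_map X k x \<sigma> \<in> mu_le_faces X n (sdim \<sigma>)" if \<sigma>: "\<sigma> \<in> simplices (enat n) k" for \<sigma>
  proof (cases "sdim \<sigma> < n")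
    case True
    then show ?thesis
      using classifying_map_low[OF \<sigma>] by (simp add: mu_le_faces_def)
  next
    case False
    then have dim: "sdim \<sigma> = n"
      using simplices_sdim[OF \<sigma>] by simp
    have "\<sigma> \<in> simplices (enat (n + 1)) k"
      using \<sigma> by (rule simplices_mono) simp
    then have "em_coords X n n (classifying_map X k x \<sigma>) = \<one>\<^bsub>em_lev \<pi> n n\<^esub>"
      using fun_cong[OF eq, of \<sigma>] dim by (simp add: to_em_def em.cosk_simps[simplified] em_trunc_simps)
    from fun_cong[OF this, of 0] have "cls (classifying_map X k x \<sigma>) = \<one>\<^bsub>\<pi>\<^esub>"
      by (simp add: em_coords_def em_lev_simps)
    then show ?thesis
      using classifying_map_cycle[OF \<sigma> dim] dim by (simp add: cls_eq_one_iff mu_le_faces_def)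
  qed
  then show "x \<in> mu_le n X k"
    using mu_ge_closed by (simp add: mu_le_eq faces_in_def)
next
  assume "x \<in> mu_le n X k"
  then have b: "classifying_map X k x \<sigma> \<in> B" if "\<sigma> \<in> simplices (enat (n + 1)) k" "sdim \<sigma> = n" for \<sigma>
    using that by (force simp: mu_le_eq faces_in_def mu_le_faces_def simplices_iff)
  have "em_coords X n (sdim \<sigma>) (classifying_map X k x \<sigma>) = \<one>\<^bsub>lev (em_trunc \<pi> n) (sdim \<sigma>)\<^esub>"
    if \<sigma>: "\<sigma> \<in> simplices (enat (n + 1)) k" for \<sigma>
  proof -
    from \<sigma> show ?thesis
    proof (cases rule: em_dim_cases)
      case 1
      then show ?thesis by (simp add: em_coords_def em_trunc_simps em_lev_simps restrict_def)
    next
      case 2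
      then have "cls (classifying_map X k x \<sigma>) = \<one>\<^bsub>\<pi>\<^esub>"
        using b[OF \<sigma>] classifying_map_cycle[OF \<sigma>] by (simp add: cls_eq_one_iff)
      with 2 show ?thesis
        by (simp add: em_coords_def em_trunc_simps em_lev_simps)
    next
      case 3
      have "cls (fc X (Suc n) l (classifying_map X k x \<sigma>)) = \<one>\<^bsub>\<pi>\<^esub>" if "l \<le> Suc n" for l
        using fc_classifying_map_cycle[OF \<sigma> 3 that] b[of "sface l \<sigma>"] sface_simplex[OF \<sigma>, of l] 3 that
          classifying_map_sface[OF mu_ge_closed \<sigma>, of l] by (simp add: cls_eq_one_iff)
      then have "alt_prod \<pi> (\<lambda>l. cls (fc X (Suc n) l (classifying_map X k x \<sigma>))) j = \<one>\<^bsub>\<pi>\<^esub>" if "j < Suc n" for j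
        using that alt_prod_cong[of j _ "\<lambda>_. \<one>\<^bsub>\<pi>\<^esub>" \<pi>] em.A.alt_prod_one[of j] by simp
      then show ?thesis
        using 3 by (simp add: em_coords_def em_trunc_simps em_lev_simps del: lessThan_Suc cong: restrict_cong)
    qed
  qed
  then show "to_em n X k x = \<one>\<^bsub>lev K k\<^esub>"
    by (auto simp: to_em_def em.cosk_simps[simplified] intro!: restrict_ext)
qed

end

lemma mu_ge_normal: "mu_ge n X k \<lhd> lev X k"
  unfolding mu_ge_eq by (rule faces_in_normal) (rule grp.one_is_normal)

lemma quotient_mu_ge_mu_le: "sgroup_quotient X (mu_ge n X) (mu_le n X)"
proof (intro sgroup_quotient.intro simplicial_subgroup.intro simplicial_subgroup_axioms.intro
    sgroup_quotient_axioms.intro)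
  show "sgroup X" ..
  show "subgroup (mu_ge n X k) (lev X k)" for k
    by (rule normal_imp_subgroup[OF mu_ge_normal])
  show "mu_le n X k \<lhd> lev X k" for k
    unfolding mu_le_eq by (rule faces_in_normal[OF mu_le_faces_normal])
  show "mu_le n X k \<subseteq> mu_ge n X k" for k
  proof
    fix x assume x: "x \<in> mu_le n X k"
    have "classifying_map X k x \<sigma> = \<one>\<^bsub>lev X (sdim \<sigma>)\<^esub>" if \<sigma>: "\<sigma> \<in> simplices (enat (n - 1)) k" for \<sigma>
    proof -
      have "\<sigma> \<in> simplices (enat n) k" "sdim \<sigma> < n"
        using simplices_mono[OF \<sigma>, of n] simplices_sdim[OF \<sigma>] n_pos by auto
      then show ?thesis
        using x by (auto simp: mu_le_eq faces_in_def mu_le_faces_def)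
    qed
    then show "x \<in> mu_ge n X k"
      using x by (simp add: mu_le_eq mu_ge_eq faces_in_def)
  qed
qed (simp_all add: mu_ge_eq mu_le_eq fc_faces_in dg_faces_in)

text \<open>In dimension n + 1 the coordinates are multiplicative because \<pi>_n is commutative,
  through \<open>alt_prod_mult\<close>.\<close>

lemma to_em_mult:
  assumes x: "x \<in> mu_ge n X k" and y: "y \<in> mu_ge n X k"
  shows "to_em n X k (x \<otimes>\<^bsub>lev X k\<^esub> y) = to_em n X k x \<otimes>\<^bsub>lev K k\<^esub> to_em n X k y"
proof -
  have "em_coords X n (sdim \<sigma>) (classifying_map X k (x \<otimes>\<^bsub>lev X k\<^esub> y) \<sigma>) =
      em_coords X n (sdim \<sigma>) (classifying_map X k x \<sigma>) \<otimes>\<^bsub>lev (em_trunc \<pi> n) (sdim \<sigma>)\<^esub>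
      em_coords X n (sdim \<sigma>) (classifying_map X k y \<sigma>)"
    if \<sigma>: "\<sigma> \<in> simplices (enat (n + 1)) k" for \<sigma>
  proof -
    note mult = classifying_map_mult[OF mu_ge_closed[OF x] mu_ge_closed[OF y] \<sigma>]
    from \<sigma> show ?thesis
    proof (cases rule: em_dim_cases)
      case 1
      then show ?thesis by (simp add: em_coords_def em_trunc_simps em_lev_simps restrict_def)
    next
      case 2
      then show ?thesis
        using classifying_map_cycle[OF x \<sigma>] classifying_map_cycle[OF y \<sigma>]
        by (simp add: mult em_coords_def em_trunc_simps em_lev_simps cls_mult cong: restrict_cong)
    next
      case 3
      let ?x = "classifying_map X k x \<sigma>" and ?y = "classifying_map X k y \<sigma>"
      have elts: "?x \<in> elts X (Suc n)" "?y \<in> elts X (Suc n)"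
        using classifying_map_in[OF mu_ge_closed[OF x] \<sigma>] classifying_map_in[OF mu_ge_closed[OF y] \<sigma>] 3
        by auto
      note cyc = fc_classifying_map_cycle[OF x \<sigma> 3] fc_classifying_map_cycle[OF y \<sigma> 3]
      have "alt_prod \<pi> (\<lambda>l. cls (fc X (Suc n) l (?x \<otimes>\<^bsub>lev X (Suc n)\<^esub> ?y))) j =
          alt_prod \<pi> (\<lambda>l. cls (fc X (Suc n) l ?x)) j \<otimes>\<^bsub>\<pi>\<^esub> alt_prod \<pi> (\<lambda>l. cls (fc X (Suc n) l ?y)) j"
        if "j < Suc n" for j
      proof -
        have "alt_prod \<pi> (\<lambda>l. cls (fc X (Suc n) l (?x \<otimes>\<^bsub>lev X (Suc n)\<^esub> ?y))) j =
            alt_prod \<pi> (\<lambda>l. cls (fc X (Suc n) l ?x) \<otimes>\<^bsub>\<pi>\<^esub> cls (fc X (Suc n) l ?y)) j"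
          using that elts cyc by (intro alt_prod_cong) (simp add: cls_mult)
        then show ?thesis
          using that cyc by (simp add: em.A.alt_prod_mult)
      qed
      then show ?thesis
        using 3 by (simp add: mult em_coords_def em_trunc_simps em_lev_simps del: lessThan_Suc cong: restrict_cong)
    qed
  qed
  then show ?thesis
    by (auto simp: to_em_def em.cosk_simps[simplified] intro!: restrict_ext)
qed

lemma to_em_hom: "to_em n X k \<in> hom ((lev X k)\<lparr>carrier := mu_ge n X k\<rparr>) (lev K k)"
  using to_em_closed by (intro homI) (simp_all add: to_em_mult em.cosk_simps(1)[simplified])

lemma to_em_fc:
  "i \<le> Suc k \<Longrightarrow> x \<in> mu_ge n X (Suc k) \<Longrightarrow>
    to_em n X k (fc X (Suc k) i x) = fc K (Suc k) i (to_em n X (Suc k) x)"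
  by (auto simp: to_em_def em.cosk_simps[simplified] map_coface_simplex classifying_map_fc mu_ge_closed
      intro!: restrict_ext)

lemma to_em_dg:
  "i \<le> k \<Longrightarrow> x \<in> mu_ge n X k \<Longrightarrow> to_em n X (Suc k) (dg X k i x) = dg K k i (to_em n X k x)"
  by (auto simp: to_em_def em.cosk_simps[simplified] map_codegen_simplex classifying_map_dg mu_ge_closed
      intro!: restrict_ext)

text \<open>A simplex of dimension below n cannot contain all n + 1 vertices, so it lies in a facet,
  and the facets of a cycle are trivial.\<close>

lemma cycle_in_mu_ge:
  assumes z: "z \<in> cycles X n"
  shows "z \<in> mu_ge n X n"
proof -
  obtain m where n: "n = Suc m"
    using n_pos by (cases n) auto
  have "classifying_map X n z \<sigma> = \<one>\<^bsub>lev X (sdim \<sigma>)\<^esub>" if \<sigma>: "\<sigma> \<in> simplices (enat m) n" for \<sigma>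
  proof -
    have "\<not> {..n} \<subseteq> set \<sigma>"
    proof
      assume "{..n} \<subseteq> set \<sigma>"
      from card_mono[OF finite_set this] show False
        using card_length[of \<sigma>] length_simplex[OF \<sigma>] simplices_sdim[OF \<sigma>] n by simp
    qed
    then obtain i where i: "i \<le> n" "i \<notin> set \<sigma>" by auto
    then obtain \<tau> where \<tau>: "\<tau> \<in> simplices (enat m) m" "\<sigma> = map (coface i) \<tau>"
      using missing_vertex_coface[of \<sigma> "enat m" m i] \<sigma> n by auto
    have "classifying_map X n z \<sigma> = classifying_map X m (fc X n i z) \<tau>"
      using z i \<tau> n classifying_map_fc[of z m i \<tau> "enat m"] by (simp add: cycles_Suc)
    then show ?thesis
      using z i \<tau> n by (simp add: cycles_Suc classifying_map_one)
  qed
  then show ?thesis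
    using cycles_closed[OF z] n by (simp add: mu_ge_eq faces_in_def)
qed

lemma to_em_surj: "elts K k \<subseteq> to_em n X k ` mu_ge n X k"
proof (rule K.generated_by_moore)
  interpret Q: sgroup_quotient X "mu_ge n X" "mu_le n X"
    by (rule quotient_mu_ge_mu_le)
  show sub: "subgroup (to_em n X k ` mu_ge n X k) (lev K k)" for k
  proof -
    interpret P: group "(lev X k)\<lparr>carrier := mu_ge n X k\<rparr>"
      by (rule grp.subgroup_imp_group[OF Q.subgroup])
    interpret group_hom "(lev X k)\<lparr>carrier := mu_ge n X k\<rparr>" "lev K k" "to_em n X k"
      using to_em_hom by unfold_locales
    show ?thesis
      using img_is_subgroup by simp
  qed
  show "dg K k i f \<in> to_em n X (Suc k) ` mu_ge n X (Suc k)"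
    if "i \<le> k" "f \<in> to_em n X k ` mu_ge n X k" for k i f
  proof -
    obtain x where x: "x \<in> mu_ge n X k" "f = to_em n X k x"
      using \<open>f \<in> to_em n X k ` mu_ge n X k\<close> by blast
    have "dg K k i f = to_em n X (Suc k) (dg X k i x)"
      unfolding x(2) by (rule to_em_dg[OF that(1) x(1), symmetric])
    then show ?thesis
      using Q.dg_sub[OF that(1) x(1)] by blast
  qed
  show "moore K k \<subseteq> to_em n X k ` mu_ge n X k" for k
  proof
    fix f assume f: "f \<in> moore K k"
    show "f \<in> to_em n X k ` mu_ge n X k"
    proof (cases "k = n")
      case False
      then show ?thesis
        using em.moore_em[OF _ f] subgroup.one_closed[OF sub[of k]] by simp
    next
      case True
      let ?\<iota> = "[0..<Suc n]"
      have \<iota>: "?\<iota> \<in> simplices (enat (n + 1)) n"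
        by (simp add: upt_simplex del: upt_Suc)
      have f': "f \<in> simplex_maps (enat (n + 1)) (em_trunc \<pi> n) n"
        using f True by (simp add: moore_def em.cosk_simps[simplified])
      have v: "f ?\<iota> \<in> (\<Pi>\<^sub>E i\<in>{..<1}. carrier \<pi>)"
        using em.em_maps_in[OF f' \<iota>] by (simp del: upt_Suc)
      \<comment> \<open>The value on the identity n-simplex is a class in \<pi>_n. Any cycle
        representing it maps to \<open>f\<close>, since the identity is the only nondegenerate
        n-simplex of \<Delta>[n].\<close>
      then obtain z where z: "z \<in> cycles X n" "f ?\<iota> 0 = cls z"
        by (auto simp: homotopy_group_simps PiE_iff simp del: upt_Suc)
      have "f = to_em n X n z"
      proof (rule em.em_maps_eqI[OF f' to_em_closed[OF cycle_in_mu_ge[OF z(1)]]])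
        fix \<sigma> assume \<sigma>: "\<sigma> \<in> simplices (enat (n + 1)) n" "sdim \<sigma> = n" "distinct \<sigma>"
        have "set \<sigma> = {..n}"
          using \<sigma> length_simplex[OF \<sigma>(1)] card_subset_eq[of "{..n}" "set \<sigma>"]
          by (simp add: simplices_iff distinct_card)
        then have "\<sigma> = ?\<iota>"
          using \<sigma> by (intro sorted_distinct_set_unique)
            (auto simp: simplices_iff atLeast0LessThan lessThan_Suc_atMost simp del: upt_Suc)
        moreover have "f ?\<iota> = em_coords X n n z"
          using v z(2) by (intro extensionalityI[of _ "{..<1}"])
            (auto simp: em_coords_def PiE_iff simp del: upt_Suc)
        ultimately show "f \<sigma> = to_em n X n z \<sigma>"
          using \<iota> cycles_closed[OF z(1)] by (simp add: to_em_def classifying_map_id del: upt_Suc)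
      qed
      then show ?thesis
        using True cycle_in_mu_ge[OF z(1)] by blast
    qed
  qed
qed

end

text \<open>The induced map on \<pi>_n is a homomorphism and so commutes with alternating products;
  the rest is naturality of classifying maps.\<close>

lemma to_em_natural:
  fixes X Y :: "'a sgrp"
  assumes n: "n \<ge> 1" and X: "simplicial_group X" and Y: "simplicial_group Y"
    and f: "f \<in> simplicial_hom X Y" and x: "x \<in> mu_ge n X k"
  shows "to_em n Y k (f k x) =
    cosk_arr (n + 1) (em_trunc (homotopy_group n X) n)
      (em_trunc_arr n (Farr (pi_functor n) X Y f)) k (to_em n X k x)"
proof -
  interpret X: sgroup_pi X n
    by (intro sgroup_pi.intro sgroup.intro X sgroup_pi_axioms.intro n)
  interpret Y: sgroup_pi Y n
    by (intro sgroup_pi.intro sgroup.intro Y sgroup_pi_axioms.intro n)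
  let ?h = "Farr (pi_functor n) X Y f"
  have "is_functor (SimpGrp :: ('a sgrp, nat \<Rightarrow> 'a \<Rightarrow> 'a) cat) Grp (pi_functor n)"
    by (rule is_functor_pi_functor_Grp)
  then have "Farr (pi_functor n) X Y f \<in> Hom Grp (Fobj (pi_functor n) X) (Fobj (pi_functor n) Y)"
    using X Y f by (simp add: is_functor_def SimpGrp_def)
  then have h: "?h \<in> hom X.\<pi> Y.\<pi>"
    by (simp add: Grp_def) (simp add: pi_functor_def)
  note cls = X.pi_functor_coset[OF Y f]
  have "em_coords Y n (sdim \<sigma>) (f (sdim \<sigma>) (classifying_map X k x \<sigma>)) =
      em_trunc_arr n ?h (sdim \<sigma>) (em_coords X n (sdim \<sigma>) (classifying_map X k x \<sigma>))"
    if \<sigma>: "\<sigma> \<in> simplices (enat (n + 1)) k" for \<sigma>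
  proof -
    from \<sigma> show ?thesis
    proof (cases rule: em_dim_cases)
      case 1
      then show ?thesis by (simp add: em_coords_def em_trunc_arr_def restrict_def)
    next
      case 2
      then show ?thesis
        using cls[OF X.classifying_map_cycle[OF x \<sigma> 2]]
        by (simp add: em_coords_def em_trunc_arr_def cong: restrict_cong)
    next
      case 3
      let ?z = "classifying_map X k x \<sigma>"
      have z: "?z \<in> elts X (Suc n)"
        using X.classifying_map_in[OF X.mu_ge_closed[OF x] \<sigma>] 3 by simp
      note cyc = X.fc_classifying_map_cycle[OF x \<sigma> 3]
      have "alt_prod Y.\<pi> (\<lambda>l. Y.cls (fc Y (Suc n) l (f (Suc n) ?z))) j =
          ?h (alt_prod X.\<pi> (\<lambda>l. X.cls (fc X (Suc n) l ?z)) j)" if "j < Suc n" for j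
      proof -
        have "alt_prod Y.\<pi> (\<lambda>l. Y.cls (fc Y (Suc n) l (f (Suc n) ?z))) j =
            alt_prod Y.\<pi> (\<lambda>l. ?h (X.cls (fc X (Suc n) l ?z))) j"
          using that cyc z by (intro alt_prod_cong) (simp add: cls simplicial_hom_fc[OF f])
        then show ?thesis
          using that cyc by (simp add: X.em.A.alt_prod_hom[OF Y.em.A.is_group h])
      qed
      then show ?thesis
        using 3 by (simp add: em_coords_def em_trunc_arr_def del: lessThan_Suc cong: restrict_cong)
    qed
  qed
  then show ?thesis
    using X.to_em_closed[OF x] X.classifying_map_natural[OF Y.sgroup_axioms f X.mu_ge_closed[OF x]]
    by (auto simp: cosk_arr_def X.em.cosk_simps(1)[simplified]) (auto simp: to_em_def intro!: restrict_ext)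
qed

lemma quotient_functor_mu_ge_mu_le:
  assumes "n \<ge> 1"
  shows "quotient_functor (mu_ge n) (mu_le n)"
proof (rule quotient_functor.intro)
  fix X Y :: "'a sgrp" and f k x
  assume X: "simplicial_group X"
  show "sgroup_quotient X (mu_ge n X) (mu_le n X)"
    by (rule sgroup_pi.quotient_mu_ge_mu_le[OF sgroup_pi.intro[OF sgroup.intro[OF X] sgroup_pi_axioms.intro[OF assms]]])
  assume Y: "simplicial_group Y" and f: "f \<in> simplicial_hom X Y"
  show "f k x \<in> mu_ge n Y k" if "x \<in> mu_ge n X k"
    by (rule hom_mu_ge[OF X Y f that])
  show "f k x \<in> mu_le n Y k" if "x \<in> mu_le n X k"
    by (rule hom_mu_le[OF X Y f that])
qed

lemma naturally_isomorphic_Pi_layer: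
  assumes n: "n \<ge> 1"
  shows "naturally_isomorphic (SimpGrp :: ('a sgrp, nat \<Rightarrow> 'a \<Rightarrow> 'a) cat)
    (Pi_layer n) (K_functor n \<circ>\<^sub>F pi_functor n)"
  unfolding Pi_layer_def
proof (rule quotient_functor.naturally_isomorphic_quot_functor[OF quotient_functor_mu_ge_mu_le[OF n],
      where \<phi> = "to_em n"])
  let ?G = "K_functor n \<circ>\<^sub>F pi_functor n"
  show "is_functor SimpGrp SimpGrp ?G"
    by (rule is_functor_comp_functor[OF is_functor_pi_functor_Ab[OF n] is_functor_K_functor])
  have G: "Fobj ?G X = cosk (n + 1) (em_trunc (homotopy_group n X) n)" for X
    by (simp add: comp_functor_def K_functor_def pi_functor_def)
  fix X :: "'a sgrp" assume X: "simplicial_group X"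
  interpret X: sgroup_pi X n
    by (intro sgroup_pi.intro sgroup.intro X sgroup_pi_axioms.intro n)
  show "to_em n X k \<in> hom ((lev X k)\<lparr>carrier := mu_ge n X k\<rparr>) (lev (Fobj ?G X) k)" for k
    unfolding G by (rule X.to_em_hom)
  show "to_em n X k (fc X (Suc k) i x) = fc (Fobj ?G X) (Suc k) i (to_em n X (Suc k) x)"
    if "i \<le> Suc k" "x \<in> mu_ge n X (Suc k)" for k i x
    unfolding G by (rule X.to_em_fc[OF that])
  show "to_em n X (Suc k) (dg X k i x) = dg (Fobj ?G X) k i (to_em n X k x)"
    if "i \<le> k" "x \<in> mu_ge n X k" for k i x
    unfolding G by (rule X.to_em_dg[OF that])
  show "elts (Fobj ?G X) k \<subseteq> to_em n X k ` mu_ge n X k" for k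
    unfolding G by (rule X.to_em_surj)
  show "to_em n X k x = \<one>\<^bsub>lev (Fobj ?G X) k\<^esub> \<longleftrightarrow> x \<in> mu_le n X k" if "x \<in> mu_ge n X k" for k x
    unfolding G by (rule X.to_em_eq_one_iff[OF that])
  fix Y :: "'a sgrp" and f assume Y: "simplicial_group Y" and f: "f \<in> simplicial_hom X Y"
  show "to_em n Y k (f k x) = Farr ?G X Y f k (to_em n X k x)" if "x \<in> mu_ge n X k" for k x
    using to_em_natural[OF n X Y f that] by (simp add: comp_functor_def K_functor_def pi_functor_def)
qed

theorem corollary7p7:
  shows
    "is_functor (SimpGrp :: ('a sgrp, nat \<Rightarrow> 'a \<Rightarrow> 'a) cat) Grp (pi_functor 0) \<and>
     is_functor (Grp :: ('a set monoid, 'a set \<Rightarrow> 'a set) cat) SimpGrp Dis \<and>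
     naturally_isomorphic (SimpGrp :: ('a sgrp, nat \<Rightarrow> 'a \<Rightarrow> 'a) cat)
       Pi_zero (Dis \<circ>\<^sub>F pi_functor 0) \<and>
     (\<forall>n\<ge>1.
        is_functor (SimpGrp :: ('a sgrp, nat \<Rightarrow> 'a \<Rightarrow> 'a) cat) Ab (pi_functor n) \<and>
        is_functor (Ab :: ('a set monoid, 'a set \<Rightarrow> 'a set) cat) SimpGrp (K_functor n) \<and>
        naturally_isomorphic (SimpGrp :: ('a sgrp, nat \<Rightarrow> 'a \<Rightarrow> 'a) cat)
          (Pi_layer n) (K_functor n \<circ>\<^sub>F pi_functor n))"
  by (simp add: is_functor_pi_functor_Grp is_functor_Dis naturally_isomorphic_Pi_zero
      is_functor_pi_functor_Ab is_functor_K_functor naturally_isomorphic_Pi_layer)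

end
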